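(* Let $a_1,a_2$ be integers, not both zero, and let $L=\{(x_1,x_2)\in\mathbb{Z}^2:\ a_1x_1+a_2x_2=0\}$. Consider the simple symmetric random walk on $\mathbb{Z}^2$ started at the origin. (i) If $r_n=n^{\alpha}$ with $0<\alpha\le 1/2$, then almost surely $$\frac{\alpha^2}{2\pi}\le \liminf_{n\to\infty}\frac{\xi^{(2)}_{B(r_n)\cap L}(n)}{(\log n)^2}\le \limsup_{n\to\infty}\frac{\xi^{(2)}_{B(r_n)\cap L}(n)}{(\log n)^2}\le \frac{1}{\pi}\min\left(\frac12,\,2\alpha\right).$$ (ii) If $r_n=\exp((\log n)^{\beta})$ with $1/2\le\beta<1$, then for any $\varepsilon>0$, almost surely there is a (random) $n_0$ such that for all $n\ge n_0$ $$\frac{1-\varepsilon}{2\pi}(\log n)^{2\beta}\le \xi^{(2)}_{B(r_n)\cap L}(n)\le (\log n)^{2\beta+\varepsilon}.$$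
   Context: The simple symmetric random walk on $\mathbb{Z}^2$ is $\mathbf{S}_0=\mathbf{0}$, $\mathbf{S}_n=\sum_{k=1}^n\mathbf{X}_k$, where $\mathbf{X}_1,\mathbf{X}_2,\dots$ are i.i.d. with $\mathbf{P}(\mathbf{X}_1=\mathbf{e}_i)=\mathbf{P}(\mathbf{X}_1=-\mathbf{e}_i)=\frac14$ for $i=1,2$, and $\mathbf{e}_1,\mathbf{e}_2$ are the standard unit vectors of $\mathbb{Z}^2$. Its local time at $\mathbf{x}\in\mathbb{Z}^2$ is $\xi^{(2)}(\mathbf{x},n)=\#\{k:\ 0<k\le n,\ \mathbf{S}_k=\mathbf{x}\}$. For $A\subseteq\mathbb{Z}^2$, $\xi^{(2)}_A(n)=\max_{\mathbf{x}\in A}\xi^{(2)}(\mathbf{x},n)$. For $r>0$, $B(r)=\{\mathbf{x}\in\mathbb{Z}^2:\ \|\mathbf{x}\|\le r\}$, where $\|\cdot\|$ is the Euclidean norm. *)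

theory Defs
  imports "HOL-Probability.Probability"
begin

locale simple_random_walk_Z2 = prob_space M
  for M :: "'a measure" and X :: "nat \<Rightarrow> 'a \<Rightarrow> int \<times> int" +
  assumes indep_steps: "indep_vars (\<lambda>_. count_space UNIV) X {1..}"
    and step_prob: "\<And>k e. k \<ge> 1 \<Longrightarrow> e \<in> {(1, 0), (-1, 0), (0, 1), (0, -1)} \<Longrightarrow>
      prob {\<omega> \<in> space M. X k \<omega> = e} = 1 / 4"

definition walk :: "(nat \<Rightarrow> 'a \<Rightarrow> int \<times> int) \<Rightarrow> nat \<Rightarrow> 'a \<Rightarrow> int \<times> int" where
  "walk X n \<omega> = (\<Sum>k = 1..n. X k \<omega>)"

text \<open>The starting time \<open>0\<close> is not counted.\<close>

definition local_time :: "(nat \<Rightarrow> 'a \<Rightarrow> int \<times> int) \<Rightarrow> int \<times> int \<Rightarrow> nat \<Rightarrow> 'a \<Rightarrow> nat" where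
  "local_time X x n \<omega> = card {k. 0 < k \<and> k \<le> n \<and> walk X k \<omega> = x}"

text \<open>The image below lies in \<open>{0..n}\<close>, so it is finite for every \<open>A\<close>, and \<open>Max\<close> is the true
  maximum whenever \<open>A\<close> is nonempty.\<close>

definition max_local_time ::
    "(nat \<Rightarrow> 'a \<Rightarrow> int \<times> int) \<Rightarrow> (int \<times> int) set \<Rightarrow> nat \<Rightarrow> 'a \<Rightarrow> nat" where
  "max_local_time X A n \<omega> = Max ((\<lambda>x. local_time X x n \<omega>) ` A)"

text \<open>The norm on \<open>real \<times> real\<close> is the Euclidean one.\<close>

definition lattice_ball :: "real \<Rightarrow> (int \<times> int) set" where
  "lattice_ball r = {(x\<^sub>1, x\<^sub>2). norm (real_of_int x\<^sub>1, real_of_int x\<^sub>2) \<le> r}"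

definition lattice_line :: "int \<Rightarrow> int \<Rightarrow> (int \<times> int) set" where
  "lattice_line a\<^sub>1 a\<^sub>2 = {(x\<^sub>1, x\<^sub>2). a\<^sub>1 * x\<^sub>1 + a\<^sub>2 * x\<^sub>2 = 0}"

end

theory Submission
  imports Defs "HOL-Real_Asymp.Real_Asymp"
begin

text \<open>
  An event that depends on the first \<open>n\<close> steps has a probability which is an average over the
  \<open>4 ^ n\<close> lists of unit steps.  Every probability estimate below is an inequality between such averages,
  proved by induction on the length of the path with the starting point left free; this replaces
  the Markov property, stopping times included.

  \<^bold>\<open>Green function.\<close>  In the coordinates \<open>x\<^sub>1 + x\<^sub>2\<close> and \<open>x\<^sub>1 - x\<^sub>2\<close> the walk is a pair of independent
  one-dimensional walks, so its heat kernel is a product of two binomial laws, and Wallis' product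
  gives the expected number of visits to the origin up to time \<open>n\<close> as \<open>ln n / \<pi> + O(1)\<close>.

  \<^bold>\<open>Upper bound, radius a power of \<open>n\<close>.\<close>  The local time of a point has a geometric tail of mean
  about \<open>ln n / \<pi>\<close>, hence reaches \<open>c (ln n)\<^sup>2\<close> with probability about \<open>n\<close> to the power \<open>- \<pi> c\<close>
  (\<open>visits_tail_uniform\<close>).  The line meets the ball in \<open>O(n\<^sup>\<alpha>)\<close> points, so \<open>\<alpha> / \<pi>\<close> bounds the limsup.
  Since \<open>\<alpha> \<le> 1 / 2\<close>, this is at most \<open>min (1 / 2) (2 \<alpha>) / \<pi>\<close>.

  \<^bold>\<open>Upper bound, radius \<open>exp ((ln n)\<^sup>\<beta>)\<close>.\<close>  The same union bound would only give the exponent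
  \<open>1 + \<beta>\<close>.  Local times of points at distance \<open>r\<close> are correlated at the scale \<open>ln r\<close>, which is much
  smaller than \<open>ln n\<close>: if a point is visited many times, then so is the origin.  The two-point bound
  \<open>two_point_tail\<close> makes this quantitative by rewarding visits to the point and penalising visits to
  a reference point near the origin.  The local time of the reference point is at most
  \<open>(ln n)\<close> to the power \<open>1 + \<epsilon>\<close>, and the assumption \<open>\<beta> \<ge> 1 / 2\<close> is what makes the price of the penalty
  affordable.

  \<^bold>\<open>Lower bound.\<close>  For radius \<open>r\<close> let \<open>N\<close> be a power of \<open>r\<close> with exponent slightly below \<open>2\<close>; with
  high probability the walk stays in the ball up to time \<open>N\<close> (\<open>exit_prob\<close>).  Start a trial at the
  first visit to the line, let it run for time \<open>T \<approx> r\<close>, start the next one at the first visit to the line after that, and so on.  A trial succeeds if the walk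
  returns \<open>u \<approx> (ln r)\<^sup>2 / (2 \<pi>)\<close> times to the starting point of the trial, which has probability about
  \<open>r\<close> to the power \<open>- 1 / 2\<close> (\<open>many_returns_lower\<close>).  About \<open>sqrt (N / T)\<close> trials fit into the time
  \<open>N\<close>, because the visits to the line form a recurrent renewal process with square-root tails.  Taking
  \<open>u\<close> and \<open>N\<close> smaller by arbitrarily small factors and powers makes the probability that all trials
  fail a negative power of \<open>r\<close> (\<open>line_maximum_lower\<close>).

  In both directions the exceptional probabilities are summable along \<open>n = 2 ^ k\<close>, and monotonicity
  in \<open>n\<close> together with the Borel--Cantelli lemma extends the bounds to all large \<open>n\<close>.
\<close>

section \<open>Averages over lattice paths\<close>

definition unit_steps :: "(int \<times> int) set" where
  "unit_steps = {(1, 0), (-1, 0), (0, 1), (0, -1)}"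

definition step_mean :: "(int \<times> int \<Rightarrow> real) \<Rightarrow> real" where
  "step_mean f = (\<Sum>e\<in>unit_steps. f e) / 4"

text \<open>
  The recursion peels off the first step, so that an induction on \<open>n\<close> is an application of the
  Markov property at time \<open>1\<close>.
\<close>

primrec path_mean :: "nat \<Rightarrow> ((int \<times> int) list \<Rightarrow> real) \<Rightarrow> real" where
  "path_mean 0 F = F []"
| "path_mean (Suc n) F = step_mean (\<lambda>e. path_mean n (\<lambda>w. F (e # w)))"

lemma step_mean_eq: "step_mean f = (f (1, 0) + f (-1, 0) + f (0, 1) + f (0, -1)) / 4"
  by (simp add: step_mean_def unit_steps_def)

lemma step_mean_mono: "(\<And>e. e \<in> unit_steps \<Longrightarrow> f e \<le> g e) \<Longrightarrow> step_mean f \<le> step_mean g"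
  unfolding step_mean_def by (intro divide_right_mono sum_mono) auto

lemma step_mean_const [simp]: "step_mean (\<lambda>e. c) = c"
  by (simp add: step_mean_eq)

lemma step_mean_add: "step_mean (\<lambda>e. f e + g e) = step_mean f + step_mean g"
  by (simp add: step_mean_eq add_divide_distrib)

lemma step_mean_diff: "step_mean (\<lambda>e. f e - g e) = step_mean f - step_mean g"
  by (simp add: step_mean_eq diff_divide_distrib add_divide_distrib)

lemma step_mean_cmult: "step_mean (\<lambda>e. c * f e) = c * step_mean f"
  by (simp add: step_mean_eq algebra_simps)

lemma step_mean_sum: "step_mean (\<lambda>e. \<Sum>i\<in>I. f i e) = (\<Sum>i\<in>I. step_mean (f i))"
  by (simp add: step_mean_eq sum.distrib add_divide_distrib sum_divide_distrib)

lemma step_mean_nonneg: "(\<And>e. f e \<ge> 0) \<Longrightarrow> step_mean f \<ge> 0"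
  by (simp add: step_mean_eq)

lemma path_mean_mono:
  "(\<And>w. length w = n \<Longrightarrow> set w \<subseteq> unit_steps \<Longrightarrow> F w \<le> G w) \<Longrightarrow> path_mean n F \<le> path_mean n G"
  by (induction n arbitrary: F G) (auto intro!: step_mean_mono)

lemma path_mean_cong:
  "(\<And>w. length w = n \<Longrightarrow> set w \<subseteq> unit_steps \<Longrightarrow> F w = G w) \<Longrightarrow> path_mean n F = path_mean n G"
  by (intro antisym path_mean_mono) simp_all

lemma path_mean_const [simp]: "path_mean n (\<lambda>w. c) = c"
  by (induction n) simp_all

lemma path_mean_add: "path_mean n (\<lambda>w. F w + G w) = path_mean n F + path_mean n G"
  by (induction n arbitrary: F G) (simp_all add: step_mean_add)

lemma path_mean_diff: "path_mean n (\<lambda>w. F w - G w) = path_mean n F - path_mean n G"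
  by (induction n arbitrary: F G) (simp_all add: step_mean_diff)

lemma path_mean_cmult: "path_mean n (\<lambda>w. c * F w) = c * path_mean n F"
  by (induction n arbitrary: F) (simp_all add: step_mean_cmult)

lemma path_mean_sum: "path_mean n (\<lambda>w. \<Sum>i\<in>I. F i w) = (\<Sum>i\<in>I. path_mean n (F i))"
  by (induction n arbitrary: F) (simp_all add: step_mean_sum)

lemma path_mean_nonneg: "(\<And>w. F w \<ge> 0) \<Longrightarrow> path_mean n F \<ge> 0"
  using path_mean_mono[of n "\<lambda>_. 0" F] by simp

text \<open>
  The Markov property at a fixed time.
\<close>

lemma path_mean_append:
  "path_mean (m + n) F = path_mean m (\<lambda>w. path_mean n (\<lambda>w'. F (w @ w')))"
  by (induction m arbitrary: F) simp_all

lemma path_mean_of_bool_le_1: "path_mean n (\<lambda>w. of_bool (P w)) \<le> 1"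
  using path_mean_mono[of n "\<lambda>w. of_bool (P w)" "\<lambda>_. 1"] by simp

lemma path_mean_of_bool_mono:
  "(\<And>w. length w = n \<Longrightarrow> set w \<subseteq> unit_steps \<Longrightarrow> P w \<Longrightarrow> Q w) \<Longrightarrow>
    path_mean n (\<lambda>w. of_bool (P w)) \<le> path_mean n (\<lambda>w. of_bool (Q w))"
  by (intro path_mean_mono) auto

lemma path_mean_not: "path_mean n (\<lambda>w. of_bool (\<not> P w)) = 1 - path_mean n (\<lambda>w. of_bool (P w))"
proof -
  have "(\<lambda>w. of_bool (\<not> P w) :: real) = (\<lambda>w. 1 - of_bool (P w))" by auto
  then show ?thesis by (simp add: path_mean_diff)
qed

section \<open>The one-dimensional walk\<close>

primrec srw1 :: "nat \<Rightarrow> int \<Rightarrow> real" where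
  "srw1 0 s = of_bool (s = 0)"
| "srw1 (Suc k) s = (srw1 k (s - 1) + srw1 k (s + 1)) / 2"

lemma srw1_nonneg: "srw1 k s \<ge> 0"
  by (induction k arbitrary: s) (auto intro!: divide_nonneg_nonneg add_nonneg_nonneg)

lemma srw1_minus: "srw1 k (- s) = srw1 k s"
proof (induction k arbitrary: s)
  case (Suc k)
  have "- s - 1 = - (s + 1)" "- s + 1 = - (s - 1)" by simp_all
  then show ?case by (simp only: srw1.simps Suc add.commute)
qed simp

lemma srw1_sum_le_1: "finite A \<Longrightarrow> (\<Sum>s\<in>A. srw1 k s) \<le> 1"
proof (induction k arbitrary: A)
  case 0
  then show ?case by (simp add: of_bool_def sum.If_cases card_le_Suc0_iff_eq)
next
  case (Suc k)
  have "(\<Sum>s\<in>A. srw1 k (s - 1)) = (\<Sum>s\<in>(\<lambda>s. s - 1) ` A. srw1 k s)"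
    by (subst sum.reindex) (auto simp: inj_on_def)
  moreover have "(\<Sum>s\<in>A. srw1 k (s + 1)) = (\<Sum>s\<in>(\<lambda>s. s + 1) ` A. srw1 k s)"
    by (subst sum.reindex) (auto simp: inj_on_def)
  ultimately have "(\<Sum>s\<in>A. srw1 k (s - 1)) + (\<Sum>s\<in>A. srw1 k (s + 1)) \<le> 1 + 1"
    using Suc by (intro add_mono) auto
  then show ?case by (simp add: sum.distrib flip: sum_divide_distrib)
qed

lemma srw1_odd: "odd (int k + s) \<Longrightarrow> srw1 k s = 0"
proof (induction k arbitrary: s)
  case (Suc k)
  then show ?case by (auto intro!: Suc.IH)
qed auto

text \<open>
  For the binomial law \<open>C(k, i) / 2\<^sup>k\<close> with \<open>s = 2 i - k\<close> this is the identity
  \<open>C(k, i) - C(k, i + 1) = C(k + 1, i + 1) (2 i + 1 - k) / (k + 1)\<close>.  It turns the sign of \<open>s\<close> into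
  monotonicity and the decay of \<open>s srw1 k s\<close> into a gradient bound.
\<close>

lemma srw1_difference:
  "of_int s * srw1 (Suc k) s = (real k + 1) / 2 * (srw1 k (s - 1) - srw1 k (s + 1))"
proof (induction k arbitrary: s)
  case 0
  then show ?case by (auto simp: of_bool_def)
next
  case (Suc k)
  have "of_int s * srw1 (Suc (Suc k)) s =
    ((of_int (s - 1) * srw1 (Suc k) (s - 1) + srw1 (Suc k) (s - 1)) +
     (of_int (s + 1) * srw1 (Suc k) (s + 1) - srw1 (Suc k) (s + 1))) / 2"
    unfolding srw1.simps(2)[of "Suc k"] by (simp add: algebra_simps del: srw1.simps)
  also have "\<dots> = (real (Suc k) + 1) / 2 * (srw1 (Suc k) (s - 1) - srw1 (Suc k) (s + 1))"
    unfolding Suc by (simp add: field_simps)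
  finally show ?case .
qed

lemma srw1_unimodal:
  assumes "s \<ge> -1" shows "srw1 k (s + 2) \<le> srw1 k s"
proof -
  have "0 \<le> (real k + 1) / 2 * (srw1 k (s + 1 - 1) - srw1 k (s + 1 + 1))"
    unfolding srw1_difference[symmetric] using assms
    by (intro mult_nonneg_nonneg srw1_nonneg) simp
  then have "0 \<le> srw1 k (s + 1 - 1) - srw1 k (s + 1 + 1)"
    by (simp add: zero_le_mult_iff)
  then show ?thesis by (simp add: algebra_simps)
qed

lemma srw1_le_shift: "int (2 * i) \<le> s + 1 \<Longrightarrow> srw1 k s \<le> srw1 k (s - int (2 * i))"
proof (induction i)
  case (Suc i)
  have "srw1 k (s - int (2 * Suc i) + 2) \<le> srw1 k (s - int (2 * Suc i))"
    using Suc.prems by (intro srw1_unimodal) simp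
  with Suc show ?case by (simp add: algebra_simps)
qed simp

text \<open>
  By unimodality each of the roughly \<open>s / 2\<close> values \<open>srw1 k s\<close>, \<open>srw1 k (s - 2)\<close>, \<dots> down to the
  centre is at least \<open>srw1 k s\<close>, and they sum to at most \<open>1\<close>.
\<close>

lemma srw1_times_abs_le: "\<bar>of_int s\<bar> * srw1 k s \<le> 2"
proof -
  have *: "of_int s * srw1 k s \<le> 2" if s: "s \<ge> 0" for s
  proof -
    define n where "n = nat (s div 2)"
    have "(real n + 1) * srw1 k s = (\<Sum>i\<le>n. srw1 k s)" by simp
    also have "\<dots> \<le> (\<Sum>i\<le>n. srw1 k (s - int (2 * i)))"
      using s by (intro sum_mono srw1_le_shift) (auto simp: n_def)
    also have "\<dots> = (\<Sum>t\<in>(\<lambda>i. s - int (2 * i)) ` {..n}. srw1 k t)"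
      by (subst sum.reindex) (auto simp: inj_on_def)
    also have "\<dots> \<le> 1" by (rule srw1_sum_le_1) simp
    finally have "(real n + 1) * srw1 k s \<le> 1" .
    moreover have "of_int s \<le> 2 * (real n + 1)"
    proof -
      have "s \<le> 2 * (int n + 1)" using s by (simp add: n_def)
      then have "(of_int s :: real) \<le> of_int (2 * (int n + 1))" by (rule of_int_le_iff[THEN iffD2])
      then show ?thesis by simp
    qed
    then have "of_int s * srw1 k s \<le> 2 * (real n + 1) * srw1 k s"
      by (intro mult_right_mono srw1_nonneg)
    ultimately show ?thesis by linarith
  qed
  show ?thesis
    using *[of s] *[of "- s"] by (cases "s \<ge> 0") (simp_all add: srw1_minus)
qed

lemma srw1_gradient: "\<bar>srw1 k s - srw1 k (s + 2)\<bar> \<le> 4 / (real k + 1)"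
proof -
  have "(real k + 1) / 2 * \<bar>srw1 k s - srw1 k (s + 2)\<bar> = \<bar>of_int (s + 1) * srw1 (Suc k) (s + 1)\<bar>"
    unfolding srw1_difference by (simp add: abs_mult add.commute)
  also have "\<dots> \<le> 2"
    using srw1_times_abs_le[of "s + 1" "Suc k"] by (simp add: abs_mult srw1_nonneg del: srw1.simps)
  finally show ?thesis by (simp add: field_simps)
qed

lemma srw1_gradient_shift: "\<bar>srw1 k s - srw1 k (s + 2 * int m)\<bar> \<le> 4 * real m / (real k + 1)"
proof (induction m)
  case (Suc m)
  have "\<bar>srw1 k s - srw1 k (s + 2 * int (Suc m))\<bar> \<le>
     \<bar>srw1 k s - srw1 k (s + 2 * int m)\<bar> + \<bar>srw1 k (s + 2 * int m) - srw1 k (s + 2 * int m + 2)\<bar>"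
    by (simp add: algebra_simps del: srw1.simps)
  also have "\<dots> \<le> 4 * real m / (real k + 1) + 4 / (real k + 1)"
    by (intro add_mono Suc srw1_gradient)
  finally show ?case by (simp add: add_divide_distrib algebra_simps)
qed simp

lemma srw1_gradient_even:
  assumes "even (s - t)" shows "\<bar>srw1 k s - srw1 k t\<bar> \<le> 2 * \<bar>of_int (s - t)\<bar> / (real k + 1)"
proof -
  have *: "\<bar>srw1 k s - srw1 k t\<bar> \<le> 2 * \<bar>of_int (s - t)\<bar> / (real k + 1)" if "even (s - t)" "s \<le> t" for s t
  proof -
    obtain m where m: "t = s + 2 * int m"
    proof -
      from \<open>even (s - t)\<close> have "even (t - s)" by presburger
      then obtain c where "t - s = 2 * c" by (elim evenE)
      with \<open>s \<le> t\<close> show ?thesis by (intro that[of "nat c"]) auto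
    qed
    show ?thesis unfolding m using srw1_gradient_shift[of k s m] by simp
  qed
  show ?thesis using *[of s t] *[of t s] assms
    by (cases "s \<le> t") (auto simp: abs_minus_commute)
qed

definition return1 :: "nat \<Rightarrow> real" where
  "return1 m = srw1 (2 * m) 0"

lemma return1_0 [simp]: "return1 0 = 1"
  by (simp add: return1_def)

text \<open>
  Two relations between \<open>srw1 (2 m) 0\<close> and \<open>srw1 (2 m) 2\<close> are available, namely the recursion and
  \<open>srw1_difference\<close>, both evaluated at time \<open>2 m + 1\<close>; eliminating \<open>srw1 (2 m) 2\<close> gives the ratio of
  consecutive central binomial weights.
\<close>

lemma return1_Suc: "return1 (Suc m) = (2 * real m + 1) / (2 * real m + 2) * return1 m"
proof -
  have odd1: "srw1 (2 * m + 1) 1 = return1 (Suc m)"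
  proof -
    have "return1 (Suc m) = srw1 (Suc (2 * m + 1)) 0" by (simp add: return1_def)
    also have "\<dots> = (srw1 (2 * m + 1) (- 1) + srw1 (2 * m + 1) 1) / 2"
      by (simp only: srw1.simps(2)[of "2 * m + 1"]) simp
    finally show ?thesis by (simp only: srw1_minus) simp
  qed
  have "srw1 (2 * m + 1) 1 = (2 * real m + 1) / 2 * (srw1 (2 * m) 0 - srw1 (2 * m) 2)"
    using srw1_difference[of 1 "2 * m"] by simp
  moreover have "srw1 (2 * m + 1) 1 = (srw1 (2 * m) 0 + srw1 (2 * m) 2) / 2" by simp
  ultimately show ?thesis
    unfolding odd1 return1_def[of m, symmetric] by (simp add: divide_simps) (simp add: algebra_simps)
qed

lemma return1_pos: "return1 m > 0"
  by (induction m) (simp_all add: return1_Suc)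

lemma return1_sq: "(2 * real m + 1) * (return1 m)\<^sup>2 = 1 / (\<Prod>k=1..m. 4 * (real k)\<^sup>2 / (4 * (real k)\<^sup>2 - 1))"
proof (induction m)
  case (Suc m)
  have "(2 * real (Suc m) + 1) * (return1 (Suc m))\<^sup>2 =
      ((2 * real m + 1) * (return1 m)\<^sup>2) * ((2 * real m + 1) * (2 * real m + 3) / (2 * real m + 2)\<^sup>2)"
    by (simp add: return1_Suc power_mult_distrib power_divide) (simp add: field_simps power2_eq_square)
  also have "(2 * real m + 1) * (2 * real m + 3) / (2 * real m + 2)\<^sup>2 =
      1 / (4 * (real (Suc m))\<^sup>2 / (4 * (real (Suc m))\<^sup>2 - 1))"
    by (simp add: field_simps power2_eq_square)
  finally show ?case unfolding Suc by (simp add: mult_ac)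
qed simp

lemma return1_sq_tendsto: "(\<lambda>m. (2 * real m + 1) * (return1 m)\<^sup>2) \<longlonglongrightarrow> 2 / pi"
proof -
  have "(\<lambda>m. 1 / (\<Prod>k=1..m. 4 * (real k)\<^sup>2 / (4 * (real k)\<^sup>2 - 1))) \<longlonglongrightarrow> 1 / (pi / 2)"
    by (intro tendsto_intros wallis) simp
  then show ?thesis by (simp add: return1_sq)
qed

text \<open>
  The two explicit bounds on \<open>(return1 m)\<^sup>2\<close> hold because \<open>(2 m + 1) (return1 m)\<^sup>2\<close> decreases and
  \<open>2 m (return1 m)\<^sup>2\<close> increases to the common limit \<open>2 / \<pi>\<close> given by Wallis' product.
\<close>

lemma return1_sq_lower: "2 / (pi * (2 * real m + 1)) \<le> (return1 m)\<^sup>2"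
proof -
  have "decseq (\<lambda>m. (2 * real m + 1) * (return1 m)\<^sup>2)"
  proof (rule decseq_SucI)
    fix m
    have "(2 * real (Suc m) + 1) * (return1 (Suc m))\<^sup>2 =
      ((2 * real m + 1) * (return1 m)\<^sup>2) * ((2 * real m + 1) * (2 * real m + 3) / (2 * real m + 2)\<^sup>2)"
      by (simp add: return1_Suc power_mult_distrib power_divide) (simp add: field_simps power2_eq_square)
    also have "\<dots> \<le> ((2 * real m + 1) * (return1 m)\<^sup>2) * 1"
      by (intro mult_left_mono, subst divide_le_eq_1_pos) (auto simp: algebra_simps power2_eq_square add_pos_nonneg)
    finally show "(2 * real (Suc m) + 1) * (return1 (Suc m))\<^sup>2 \<le> (2 * real m + 1) * (return1 m)\<^sup>2" by simp
  qed
  from decseq_ge[OF this return1_sq_tendsto, of m]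
  have "2 / pi / (2 * real m + 1) \<le> (return1 m)\<^sup>2"
    by (subst pos_divide_le_eq) (simp_all add: mult.commute)
  then show ?thesis by simp
qed

lemma return1_sq_upper: assumes "m > 0" shows "(return1 m)\<^sup>2 \<le> 1 / (pi * real m)"
proof -
  let ?b = "\<lambda>m. (2 * real m) * (return1 m)\<^sup>2"
  have lim: "?b \<longlonglongrightarrow> 2 / pi"
  proof -
    have "(\<lambda>m. (2 * real m / (2 * real m + 1)) * ((2 * real m + 1) * (return1 m)\<^sup>2)) \<longlonglongrightarrow> 1 * (2 / pi)"
      by (intro tendsto_mult return1_sq_tendsto) real_asymp
    moreover have "(2 * real m / (2 * real m + 1)) * ((2 * real m + 1) * (return1 m)\<^sup>2) = ?b m" for m
    proof -
      have "2 * real m + 1 \<noteq> 0" by linarith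
      then show ?thesis by simp
    qed
    ultimately show ?thesis by (simp only: mult_1)
  qed
  have "incseq ?b"
  proof (rule incseq_SucI)
    fix m
    show "?b m \<le> ?b (Suc m)"
    proof (cases "m = 0")
      case False
      have "?b m * 1 \<le> ?b m * ((2 * real m + 1)\<^sup>2 / ((2 * real m) * (2 * real m + 2)))"
        using False
        by (intro mult_left_mono, subst le_divide_eq_1_pos)
          (auto simp: algebra_simps power2_eq_square add_pos_nonneg)
      also have "\<dots> = (2 * real m + 2) * ((2 * real m + 1) / (2 * real m + 2) * return1 m)\<^sup>2"
      proof -
        have "a * r\<^sup>2 * (q\<^sup>2 / (a * p)) = p * (q / p * r)\<^sup>2" if "a \<noteq> 0" "p \<noteq> 0" for a p q r :: real
          using that by (simp add: field_simps power2_eq_square)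
        moreover have "2 * real m + 2 \<noteq> 0" by linarith
        ultimately show ?thesis using False by (metis mult_eq_0_iff of_nat_eq_0_iff zero_neq_numeral)
      qed
      also have "\<dots> = ?b (Suc m)" by (simp add: return1_Suc)
      finally show ?thesis by simp
    qed auto
  qed
  from incseq_le[OF this lim, of m] assms show ?thesis by (simp add: field_simps)
qed

lemma srw1_even_le: "srw1 (2 * m) s \<le> return1 m"
proof -
  have *: "srw1 (2 * m) s \<le> return1 m" if "s \<ge> 0" for s
  proof (cases "even s")
    case True
    with that obtain i where "s = int (2 * i)" by (metis evenE int_nat_eq of_nat_mult of_nat_numeral zero_le_mult_iff nonneg_int_cases even_of_nat)
    then show ?thesis using srw1_le_shift[of i s "2 * m"] by (simp add: return1_def)
  next
    case False
    then show ?thesis using srw1_odd[of "2 * m" s] return1_pos[of m] by simp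
  qed
  show ?thesis using *[of s] *[of "- s"] by (cases "s \<ge> 0") (simp_all add: srw1_minus)
qed

lemma return1_le: "m > 0 \<Longrightarrow> return1 m \<le> 1 / sqrt (2 * real m + 1)"
proof -
  assume "m > 0"
  have "(2 * real m + 1) * (return1 m)\<^sup>2 \<le> 1 / (pi * real m) * (2 * real m + 1)"
    using return1_sq_upper[OF \<open>m > 0\<close>] by (subst mult.commute) (intro mult_right_mono, auto)
  also have "\<dots> \<le> 1"
  proof -
    have "2 * real m + 1 \<le> 3 * real m" using \<open>m > 0\<close> by simp
    also have "\<dots> \<le> pi * real m" using pi_gt3 by (intro mult_right_mono) auto
    finally show ?thesis using \<open>m > 0\<close> by (simp add: field_simps)
  qed
  finally have "(return1 m)\<^sup>2 \<le> (1 / sqrt (2 * real m + 1))\<^sup>2"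
    by (simp add: field_simps power_divide)
  then show ?thesis by (rule power2_le_imp_le) simp
qed

lemma srw1_le: assumes "k > 0" shows "srw1 k s \<le> 1 / sqrt (real k)"
proof -
  have even: "srw1 (2 * m) s \<le> 1 / sqrt (2 * real m + 1)" for m s
    using srw1_even_le[of m s] return1_le[of m] by (cases "m = 0") auto
  show ?thesis
  proof (cases "even k")
    case True
    then obtain m where k: "k = 2 * m" by (elim evenE)
    have "1 / sqrt (2 * real m + 1) \<le> 1 / sqrt (real k)"
      using assms by (intro divide_left_mono) (auto simp: k)
    with even[of m s] show ?thesis by (simp add: k)
  next
    case False
    then obtain m where k: "k = 2 * m + 1" by (elim oddE)
    show ?thesis using even[of m "s - 1"] even[of m "s + 1"] by (simp add: k field_simps)
  qed
qed

section \<open>Heat kernel and Green function of the planar walk\<close>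

text \<open>
  One step of the planar walk changes each of \<open>x\<^sub>1 + x\<^sub>2\<close> and \<open>x\<^sub>1 - x\<^sub>2\<close> by \<open>\<plusminus>1\<close>, and the four
  combinations of signs are equally likely.  The two coordinates are thus independent
  one-dimensional walks, and the product below is the law of the planar walk
  (\<open>path_mean_endpoint\<close>).
\<close>

definition heat :: "nat \<Rightarrow> int \<times> int \<Rightarrow> real" where
  "heat n z = srw1 n (fst z + snd z) * srw1 n (fst z - snd z)"

definition green :: "nat \<Rightarrow> int \<times> int \<Rightarrow> real" where
  "green n z = (\<Sum>k\<le>n. heat k z)"

lemma heat_nonneg: "heat n z \<ge> 0"
  by (simp add: heat_def srw1_nonneg)

lemma heat_0: "heat 0 z = of_bool (z = 0)"
  by (auto simp: heat_def prod_eq_iff)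

lemma heat_Suc: "heat (Suc n) z = step_mean (\<lambda>e. heat n (z + e))"
  by (cases z) (simp add: heat_def step_mean_eq field_simps)

lemma heat_minus: "heat n (- z) = heat n z"
  using srw1_minus[of n "fst z + snd z"] srw1_minus[of n "fst z - snd z"] by (simp add: heat_def)

lemma path_mean_endpoint: "path_mean n (\<lambda>w. of_bool (z + sum_list w = y)) = heat n (z - y)"
proof (induction n arbitrary: z)
  case 0
  then show ?case by (simp add: heat_0)
next
  case (Suc n)
  have "path_mean (Suc n) (\<lambda>w. of_bool (z + sum_list w = y)) = step_mean (\<lambda>e. heat n (z + e - y))"
    using Suc[of "z + _"] by (simp add: add.assoc)
  then show ?case by (simp add: heat_Suc algebra_simps)
qed

lemma heat_le: "n > 0 \<Longrightarrow> heat n z \<le> 1 / real n"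
  using mult_mono[OF srw1_le srw1_le, of n n "fst z + snd z" "fst z - snd z"]
  by (simp add: heat_def srw1_nonneg mult.commute)

lemma heat_0_even: "heat (2 * m) 0 = (return1 m)\<^sup>2"
  by (simp add: heat_def return1_def power2_eq_square)

lemma heat_0_odd: "heat (2 * m + 1) 0 = 0"
  using srw1_odd[of "2 * m + 1" 0] by (simp add: heat_def del: srw1.simps)

lemma green_nonneg: "green n z \<ge> 0"
  by (simp add: green_def heat_nonneg sum_nonneg)

lemma green_mono: "m \<le> n \<Longrightarrow> green m z \<le> green n z"
  unfolding green_def by (intro sum_mono2) (auto simp: heat_nonneg)

text \<open>
  The time-dependent form of the Poisson equation for the Green function: after multiplication by
  constants, differences of Green functions serve as supersolutions with point sources.
\<close>

lemma green_Suc: "green (Suc n) z = of_bool (z = 0) + step_mean (\<lambda>e. green n (z + e))"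
  unfolding green_def step_mean_sum
  by (subst sum.atMost_Suc_shift) (simp add: heat_0 heat_Suc)

lemma green_0_pairs: "green (2 * m + 1) 0 = (\<Sum>i\<le>m. (return1 i)\<^sup>2)"
proof (induction m)
  case (Suc m)
  have "green (2 * Suc m + 1) 0 = green (2 * m + 1) 0 + heat (2 * Suc m) 0 + heat (2 * Suc m + 1) 0"
    by (simp add: green_def)
  with Suc show ?case by (simp only: heat_0_even heat_0_odd) simp
qed (simp add: green_def heat_0 heat_0_odd[of 0, simplified])

lemma harm_le_ln: "n \<ge> 1 \<Longrightarrow> harm n \<le> 1 + ln (real n)"
proof (induction n rule: dec_induct)
  case base
  then show ?case by (simp add: harm_expand)
next
  case (step n)
  have "ln (real (Suc n)) - ln (real n) \<ge> inverse (real (Suc n))"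
  proof -
    have "ln (real n / real (Suc n)) \<le> real n / real (Suc n) - 1"
      using step by (intro ln_le_minus_one) auto
    also have "\<dots> = - inverse (real (Suc n))" by (simp add: field_simps)
    finally show ?thesis using step by (simp add: ln_div)
  qed
  with step show ?case by (simp add: harm_Suc)
qed

lemma green_0_upper:
  assumes "n \<ge> 1" shows "green n 0 \<le> 1 + (1 + ln (real n)) / pi"
proof (cases "n = 1")
  case True
  then show ?thesis by (simp add: green_def heat_0 heat_0_odd[of 0, simplified])
next
  case False
  define m where "m = n div 2"
  have m: "m \<ge> 1" "m \<le> n" "n \<le> 2 * m + 1" using assms False by (auto simp: m_def)
  have "green n 0 \<le> green (2 * m + 1) 0" by (rule green_mono) (use m in auto)
  also have "\<dots> = 1 + (\<Sum>i=1..m. (return1 i)\<^sup>2)"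
    unfolding green_0_pairs atMost_atLeast0 by (subst sum.atLeast_Suc_atMost) auto
  also have "\<dots> \<le> 1 + (\<Sum>i=1..m. 1 / (pi * real i))"
    by (intro add_left_mono sum_mono return1_sq_upper) auto
  also have "(\<Sum>i=1..m. 1 / (pi * real i)) = harm m / pi"
    unfolding harm_def sum_divide_distrib by (intro sum.cong) (auto simp: field_simps)
  also have "harm m \<le> 1 + ln (real m)" using m by (intro harm_le_ln)
  also have "ln (real m) \<le> ln (real n)" using m by simp
  finally show ?thesis by (simp add: divide_right_mono)
qed

lemma green_0_lower: "ln ((real n + 1) / 2) / pi \<le> green n 0"
proof (cases "n = 0")
  case True
  have "0 \<le> ln 2 / pi" by simp
  then have "- (ln 2 / pi) \<le> 1" by linarith
  with True show ?thesis by (simp add: green_def heat_0 ln_div)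
next
  case False
  define m where "m = (n - 1) div 2"
  have m: "2 * m + 1 \<le> n" "n \<le> 2 * m + 2" using False by (auto simp: m_def)
  have "ln ((real n + 1) / 2) \<le> ln (real (Suc m) + 1)" using m by simp
  also have "\<dots> \<le> harm (Suc m)" by (rule ln_le_harm)
  finally have "ln ((real n + 1) / 2) / pi \<le> harm (Suc m) / pi" by (simp add: divide_right_mono)
  also have "\<dots> = (\<Sum>i\<le>m. 1 / (pi * (real i + 1)))"
    unfolding harm_altdef sum_divide_distrib by (intro sum.cong) (auto simp: field_simps)
  also have "\<dots> \<le> (\<Sum>i\<le>m. (return1 i)\<^sup>2)"
  proof (rule sum_mono)
    fix i
    have "1 / (pi * x) = 2 / (pi * (2 * x))" for x by simp
    from this[of "real i + 1"] have "1 / (pi * (real i + 1)) = 2 / (pi * (2 * real i + 2))"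
      by (simp only: distrib_left mult_1_right)
    also have "\<dots> \<le> 2 / (pi * (2 * real i + 1))" by (intro divide_left_mono) auto
    finally have "1 / (pi * (real i + 1)) \<le> 2 / (pi * (2 * real i + 1))" .
    with return1_sq_lower[of i] show "1 / (pi * (real i + 1)) \<le> (return1 i)\<^sup>2" by linarith
  qed
  also have "\<dots> = green (2 * m + 1) 0" by (rule green_0_pairs[symmetric])
  also have "\<dots> \<le> green n 0" by (rule green_mono) (use m in auto)
  finally show ?thesis .
qed

lemma green_upper:
  assumes "n \<ge> 1" shows "green n z \<le> 2 + ln (real n)"
proof -
  have "green n z = heat 0 z + (\<Sum>k=1..n. heat k z)"
    unfolding green_def atMost_atLeast0 by (subst sum.atLeast_Suc_atMost) auto
  also have "\<dots> \<le> 1 + (\<Sum>k=1..n. inverse (real k))"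
    by (intro add_mono sum_mono) (auto simp: heat_0 intro: heat_le simp flip: inverse_eq_divide intro!: heat_le[unfolded divide_inverse, simplified])
  also have "(\<Sum>k=1..n. inverse (real k)) = harm n" by (simp add: harm_def)
  also have "\<dots> \<le> 1 + ln (real n)" using assms by (rule harm_le_ln)
  finally show ?thesis by simp
qed

section \<open>Exponential moments of local times\<close>

primrec visits :: "int \<times> int \<Rightarrow> int \<times> int \<Rightarrow> (int \<times> int) list \<Rightarrow> nat" where
  "visits x z [] = 0"
| "visits x z (e # w) = of_bool (z + e = x) + visits x (z + e) w"

text \<open>
  Unlike \<open>visits\<close>, the weight includes the starting point of the path.
\<close>

primrec path_weight :: "(int \<times> int \<Rightarrow> real) \<Rightarrow> int \<times> int \<Rightarrow> (int \<times> int) list \<Rightarrow> real" where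
  "path_weight q z [] = q z"
| "path_weight q z (e # w) = q z * path_weight q (z + e) w"

text \<open>
  A supersolution, indexed by the remaining time, dominates the expected weight.  This is the
  Feynman--Kac comparison principle.
\<close>

lemma feynman_kac_bound:
  assumes q: "\<And>z. q z \<ge> 0" "\<And>z. q z \<le> u 0 z"
    and super: "\<And>j z. j < n \<Longrightarrow> q z * step_mean (\<lambda>e. u j (z + e)) \<le> u (Suc j) z"
    and "j \<le> n"
  shows "path_mean j (path_weight q z) \<le> u j z"
  using \<open>j \<le> n\<close>
proof (induction j arbitrary: z)
  case (Suc j)
  have "path_mean (Suc j) (path_weight q z) = q z * step_mean (\<lambda>e. path_mean j (path_weight q (z + e)))"
    by (simp add: path_mean_cmult step_mean_cmult)
  also have "\<dots> \<le> q z * step_mean (\<lambda>e. u j (z + e))"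
    using Suc q by (intro mult_left_mono step_mean_mono) auto
  also have "\<dots> \<le> u (Suc j) z" using Suc by (intro super) auto
  finally show ?case .
qed (simp add: q)

lemma step_mean_green: "step_mean (\<lambda>e. green j (z + e - x)) = green (Suc j) (z - x) - of_bool (z = x)"
  using green_Suc[of j "z - x"] by (simp add: algebra_simps)

text \<open>
  The bound has the form of the generating function of a geometric law: \<open>1 + c green j (\<cdot> - x)\<close> is a
  supersolution for the weight \<open>1 + \<theta>\<close> at \<open>x\<close>, and the equation at \<open>x\<close> determines \<open>c\<close>.  The condition on
  \<open>\<theta>\<close> says that \<open>\<theta>\<close> is below the inverse of the expected number of returns.
\<close>

lemma visits_moment:
  assumes "\<theta> \<ge> 0" "\<theta> * (green n 0 - 1) < 1"
  defines "c \<equiv> \<theta> / (1 - \<theta> * (green n 0 - 1))"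
  shows "path_mean n (\<lambda>w. (1 + \<theta>) ^ visits x z w) \<le> 1 + c * green n (z - x)"
proof -
  define q where "q = (\<lambda>y. if y = x then 1 + \<theta> else 1)"
  have weight: "path_weight q z w = q z * (1 + \<theta>) ^ visits x z w" for w z
    by (induction w arbitrary: z) (auto simp: q_def)
  have g1: "1 \<le> green j 0" for j
    using green_mono[of 0 j 0] by (simp add: green_def[of 0] heat_0)
  have c: "c * (1 - \<theta> * (green n 0 - 1)) = \<theta>" "c \<ge> \<theta>" "c \<ge> 0"
  proof -
    show "c * (1 - \<theta> * (green n 0 - 1)) = \<theta>" using assms by (simp add: c_def)
    show "c \<ge> 0" unfolding c_def using assms by (intro divide_nonneg_nonneg) auto
    then have "c * (1 - \<theta> * (green n 0 - 1)) \<le> c * 1"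
      using assms g1[of n] by (intro mult_left_mono) auto
    with \<open>c * (1 - \<theta> * (green n 0 - 1)) = \<theta>\<close> show "c \<ge> \<theta>" by simp
  qed
  have "path_mean n (path_weight q z) \<le> 1 + c * green n (z - x)"
  proof (rule feynman_kac_bound[where n = n and u = "\<lambda>j y. 1 + c * green j (y - x)"])
    show "q z \<ge> 0" for z using assms by (simp add: q_def)
    show "q z \<le> 1 + c * green 0 (z - x)" for z
      using c by (simp add: q_def green_def heat_0)
    fix j z assume j: "j < n"
    let ?g = "green (Suc j) (z - x)"
    have mean: "step_mean (\<lambda>e. 1 + c * green j (z + e - x)) = 1 + c * (?g - of_bool (z = x))"
      by (simp add: step_mean_add step_mean_cmult step_mean_green)
    show "q z * step_mean (\<lambda>e. 1 + c * green j (z + e - x)) \<le> 1 + c * ?g"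
    proof (cases "z = x")
      case True
      have "c * (1 - \<theta> * (green n 0 - 1)) \<le> c * (1 - \<theta> * (?g - 1))"
        using True j green_mono[of "Suc j" n 0] assms(1) c
        by (intro mult_left_mono diff_left_mono diff_right_mono) auto
      then have "\<theta> \<le> c * (1 - \<theta> * (?g - 1))" using c by simp
      with True show ?thesis unfolding mean by (simp add: q_def algebra_simps)
    qed (simp add: mean q_def)
  qed simp
  moreover have "path_mean n (\<lambda>w. (1 + \<theta>) ^ visits x z w) \<le> path_mean n (path_weight q z)"
    unfolding weight using assms(1)
    by (intro path_mean_mono mult_right_mono[of 1, simplified]) (auto simp: q_def)
  ultimately show ?thesis by linarith
qed

lemma visits_tail:
  assumes "\<theta> \<ge> 0" "\<theta> * (green n 0 - 1) < 1"
  shows "path_mean n (\<lambda>w. of_bool (u \<le> real (visits x z w))) \<le>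
    (1 + \<theta> / (1 - \<theta> * (green n 0 - 1)) * green n (z - x)) * (1 + \<theta>) powr (- u)"
proof -
  have "path_mean n (\<lambda>w. of_bool (u \<le> real (visits x z w))) \<le>
    path_mean n (\<lambda>w. (1 + \<theta>) powr (- u) * (1 + \<theta>) ^ visits x z w)"
  proof (rule path_mean_mono)
    fix w :: "(int \<times> int) list"
    have "1 \<le> (1 + \<theta>) powr (real (visits x z w) - u)" if "u \<le> real (visits x z w)"
      using assms that by (intro ge_one_powr_ge_zero) auto
    also have "(1 + \<theta>) powr (real (visits x z w) - u) = (1 + \<theta>) powr (- u) * (1 + \<theta>) ^ visits x z w"
      using assms powr_add[of "1 + \<theta>" "- u" "real (visits x z w)"] by (simp add: powr_realpow)
    finally show "of_bool (u \<le> real (visits x z w)) \<le> (1 + \<theta>) powr (- u) * (1 + \<theta>) ^ visits x z w"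
      using assms(1) by auto
  qed
  also have "\<dots> \<le> (1 + \<theta>) powr (- u) * (1 + \<theta> / (1 - \<theta> * (green n 0 - 1)) * green n (z - x))"
    unfolding path_mean_cmult using assms by (intro mult_left_mono visits_moment) auto
  finally show ?thesis by (simp add: mult.commute)
qed

text \<open>
  The displacement has even coordinate sum, because points of different parity are never charged
  at the same time and their heat kernels cannot be compared.
\<close>

lemma heat_gradient:
  assumes "k > 0" "even (fst (z - y) + snd (z - y))" "\<bar>fst (z - y)\<bar> + \<bar>snd (z - y)\<bar> \<le> int r"
  shows "\<bar>heat k z - heat k y\<bar> \<le> 4 * real r / (real k * sqrt (real k))"
proof -
  define a b a' b' where "a = fst z + snd z" and "b = fst z - snd z"
    and "a' = fst y + snd y" and "b' = fst y - snd y"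
  have d: "even (a - a')" "even (b - b')" "\<bar>a - a'\<bar> \<le> int r" "\<bar>b - b'\<bar> \<le> int r"
  proof -
    define s t where "s = fst (z - y)" and "t = snd (z - y)"
    have *: "a - a' = s + t" "b - b' = s - t" by (simp_all add: a_def b_def a'_def b'_def s_def t_def)
    show "even (a - a')" "even (b - b')" using assms(2) unfolding * s_def[symmetric] t_def[symmetric] by auto
    show "\<bar>a - a'\<bar> \<le> int r" "\<bar>b - b'\<bar> \<le> int r"
      using assms(3) unfolding * s_def[symmetric] t_def[symmetric] by linarith+
  qed
  have one: "\<bar>srw1 k s - srw1 k t\<bar> \<le> 2 * real r / real k" if "even (s - t)" "\<bar>s - t\<bar> \<le> int r" for s t
  proof -
    have "\<bar>srw1 k s - srw1 k t\<bar> \<le> 2 * \<bar>of_int (s - t)\<bar> / (real k + 1)"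
      using that by (intro srw1_gradient_even)
    also have "\<bar>of_int (s - t) :: real\<bar> \<le> real r"
      using that by linarith
    also have "2 * real r / (real k + 1) \<le> 2 * real r / real k"
      using \<open>k > 0\<close> by (intro divide_left_mono) auto
    finally show ?thesis by (simp add: divide_right_mono)
  qed
  have "\<bar>heat k z - heat k y\<bar> = \<bar>(srw1 k a - srw1 k a') * srw1 k b + srw1 k a' * (srw1 k b - srw1 k b')\<bar>"
    by (simp add: heat_def a_def b_def a'_def b'_def algebra_simps)
  also have "\<dots> \<le> \<bar>srw1 k a - srw1 k a'\<bar> * srw1 k b + srw1 k a' * \<bar>srw1 k b - srw1 k b'\<bar>"
    by (rule order.trans[OF abs_triangle_ineq]) (simp add: abs_mult srw1_nonneg)
  also have "\<dots> \<le> 2 * real r / real k * (1 / sqrt (real k)) + 1 / sqrt (real k) * (2 * real r / real k)"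
    using d \<open>k > 0\<close> by (intro add_mono mult_mono one srw1_le) (auto simp: srw1_nonneg)
  also have "\<dots> = 4 * real r / (real k * sqrt (real k))" by (simp add: field_simps)
  finally show ?thesis .
qed

lemma sum_inverse_three_halves:
  assumes "m > 0" "m \<le> n"
  shows "(\<Sum>k=Suc m..n. 1 / (real k * sqrt (real k))) \<le> 2 / sqrt (real m) - 2 / sqrt (real n)"
  using assms(2)
proof (induction n rule: dec_induct)
  case (step n)
  define s t where "s = sqrt (real n)" and "t = sqrt (real (Suc n))"
  have st: "0 < s" "s \<le> t" "t\<^sup>2 - s\<^sup>2 = 1" "t\<^sup>2 = real (Suc n)"
    using step assms by (auto simp: s_def t_def)
  have "1 / (t\<^sup>2 * t) \<le> 2 / s - 2 / t"
  proof -
    have "1 * (s * t) \<le> 2 * (t - s) * (t\<^sup>2 * t)"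
    proof -
      have "1 * s = (t - s) * (t + s) * s" using st by (simp add: algebra_simps power2_eq_square)
      also have "\<dots> \<le> (t - s) * (2 * t) * t"
        using st by (intro mult_mono mult_left_mono) auto
      finally have "s * t \<le> (t - s) * (2 * t) * t * t"
        using st by (intro mult_right_mono) auto
      then show ?thesis by (simp add: power2_eq_square mult_ac)
    qed
    then have "1 / (t\<^sup>2 * t) \<le> 2 * (t - s) / (s * t)"
      using st by (subst frac_le_eq[THEN iffD2] | simp add: divide_simps)+
    also have "\<dots> = 2 / s - 2 / t" using st by (simp add: field_simps)
    finally show ?thesis .
  qed
  then have "1 / (real (Suc n) * sqrt (real (Suc n))) \<le> 2 / sqrt (real n) - 2 / sqrt (real (Suc n))"
    unfolding st(4) by (simp add: s_def t_def)
  moreover have "(\<Sum>k=Suc m..Suc n. 1 / (real k * sqrt (real k))) =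
      (\<Sum>k=Suc m..n. 1 / (real k * sqrt (real k))) + 1 / (real (Suc n) * sqrt (real (Suc n)))"
    using step by (subst sum.cl_ivl_Suc) auto
  ultimately show ?case using step.IH by linarith
qed simp

text \<open>
  Up to time \<open>r\<^sup>2\<close> each Green function is at most \<open>2 + 2 ln r\<close>; after that time the gradient bound
  makes the difference summable, with a sum bounded by a constant.  The bound is uniform in the
  time horizon, which is why the estimates built on it depend on \<open>ln r\<close> only.
\<close>

lemma green_difference:
  assumes "r > 0" "even (fst (z - y) + snd (z - y))" "\<bar>fst (z - y)\<bar> + \<bar>snd (z - y)\<bar> \<le> int r"
  shows "\<bar>green n z - green n y\<bar> \<le> 10 + 2 * ln (real r)"
proof -
  have short: "\<bar>green m z - green m y\<bar> \<le> 2 + 2 * ln (real r)" if "m \<le> r\<^sup>2" for m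
  proof -
    have *: "green m x \<le> 2 + 2 * ln (real r)" for x
      using green_mono[OF that, of x] green_upper[of "r\<^sup>2" x] \<open>r > 0\<close> by (simp add: ln_realpow)
    show ?thesis using *[of y] *[of z] green_nonneg[of m y] green_nonneg[of m z] by linarith
  qed
  show ?thesis
  proof (cases "n \<le> r\<^sup>2")
    case True
    with short[of n] show ?thesis by linarith
  next
    case False
    \<comment> \<open>Before time \<open>m\<close> the two kernels are bounded separately, afterwards they are compared.\<close>
    define m where "m = r\<^sup>2"
    have m: "m > 0" "m \<le> n" "sqrt (real m) = real r" using False \<open>r > 0\<close> by (auto simp: m_def)
    have split: "green n x = green m x + (\<Sum>k=Suc m..n. heat k x)" for x
    proof -
      have "{..n} = {..m} \<union> {Suc m..n}" using m by auto
      then show ?thesis by (simp add: green_def) (subst sum.union_disjoint; auto)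
    qed
    have "\<bar>(\<Sum>k=Suc m..n. heat k z) - (\<Sum>k=Suc m..n. heat k y)\<bar> \<le> (\<Sum>k=Suc m..n. \<bar>heat k z - heat k y\<bar>)"
      by (simp add: sum_subtractf[symmetric])
    also have "\<dots> \<le> (\<Sum>k=Suc m..n. 4 * real r * (1 / (real k * sqrt (real k))))"
      using assms by (intro sum_mono order.trans[OF heat_gradient]) auto
    also have "\<dots> = 4 * real r * (\<Sum>k=Suc m..n. 1 / (real k * sqrt (real k)))"
      by (simp add: sum_distrib_left)
    also have "\<dots> \<le> 4 * real r * (2 / sqrt (real m))"
      by (intro mult_left_mono order.trans[OF sum_inverse_three_halves]) (use m in auto)
    also have "\<dots> = 8" using m \<open>r > 0\<close> by simp
    finally show ?thesis using short[of m] unfolding split m_def by linarith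
  qed
qed

text \<open>
  The supersolution is \<open>2 D + green j (\<cdot> - x) - green j (\<cdot> - x\<^sub>0)\<close>, with values in \<open>[D, 3 D]\<close>.
  Its source at \<open>x\<close> allows the reward \<open>1 / (3 D)\<close> per visit to \<open>x\<close>, and its sink at \<open>x\<^sub>0\<close> is
  compensated by the penalty \<open>1 / D\<close> per visit to \<open>x\<^sub>0\<close>.  The result does not involve the time horizon \<open>n\<close>.
\<close>

lemma two_point_moment:
  assumes D: "D \<ge> 2" "\<And>j y. \<bar>green j (y - x) - green j (y - x\<^sub>0)\<bar> \<le> D" and "x \<noteq> x\<^sub>0"
  shows "path_mean n (\<lambda>w. (1 + 1 / (3 * D)) ^ visits x z w * (1 - 1 / D) ^ visits x\<^sub>0 z w) \<le> 6 * D"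
proof -
  define q where "q = (\<lambda>y. if y = x then 1 + 1 / (3 * D) else if y = x\<^sub>0 then 1 - 1 / D else 1)"
  define u where "u = (\<lambda>j y. 2 * D + green j (y - x) - green j (y - x\<^sub>0))"
  have weight: "path_weight q z w = q z * ((1 + 1 / (3 * D)) ^ visits x z w * (1 - 1 / D) ^ visits x\<^sub>0 z w)" for w z
    using \<open>x \<noteq> x\<^sub>0\<close> by (induction w arbitrary: z) (auto simp: q_def)
  have invD: "0 < 1 / D" "1 / D \<le> 1 / 2" using D(1) by auto
  have u: "D \<le> u j y" "u j y \<le> 3 * D" for j y
    using D(2)[of j y] by (auto simp: u_def)
  have q: "1 / 2 \<le> q y" "q y \<le> 2" for y
  proof -
    have "0 \<le> 1 / (3 * D)" "1 / (3 * D) \<le> 1" using D(1) by auto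
    moreover have "1 / 2 \<le> (if y = x then 1 + a else if y = x\<^sub>0 then 1 - b else 1) \<and>
        (if y = x then 1 + a else if y = x\<^sub>0 then 1 - b else 1) \<le> 2"
      if "0 \<le> a" "a \<le> 1" "0 < b" "b \<le> 1 / 2" for a b :: real
      using that by auto
    ultimately show "1 / 2 \<le> q y" "q y \<le> 2" using invD unfolding q_def by blast+
  qed
  have "path_mean n (path_weight q z) \<le> u n z"
  proof (rule feynman_kac_bound[where n = n and u = u])
    show "0 \<le> q z" for z using q[of z] by simp
    show "q z \<le> u 0 z" for z using q[of z] u[of 0 z] D(1) by linarith
    fix j z assume "j < n"
    have mean: "step_mean (\<lambda>e. u j (z + e)) = u (Suc j) z - of_bool (z = x) + of_bool (z = x\<^sub>0)"
      by (simp add: u_def step_mean_add step_mean_diff step_mean_green)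
    note u' = u[of "Suc j" z]
    have "1 / (3 * D) * u (Suc j) z \<le> 1 / (3 * D) * (3 * D)"
      using u' D(1) by (intro mult_left_mono) auto
    then have 1: "1 / (3 * D) * u (Suc j) z \<le> 1" using D(1) by simp
    have "1 / D * D \<le> 1 / D * (u (Suc j) z)"
      using u' D(1) by (intro mult_left_mono) auto
    then have 2: "1 \<le> 1 / D * u (Suc j) z" using D(1) by simp
    show "q z * step_mean (\<lambda>e. u j (z + e)) \<le> u (Suc j) z"
    proof -
      have "(1 + a) * (v - 1) \<le> v" if "a * v \<le> 1" "0 \<le> a" for a v :: real
        using that by (simp add: algebra_simps)
      moreover have "(1 - b) * (v + 1) \<le> v" if "1 \<le> b * v" "0 \<le> b" for b v :: real
        using that by (simp add: algebra_simps)
      ultimately have *: "(1 + 1 / (3 * D)) * (u (Suc j) z - 1) \<le> u (Suc j) z"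
        "(1 - 1 / D) * (u (Suc j) z + 1) \<le> u (Suc j) z" using 1 2 D(1) by auto
      have eq: "q z * (v - of_bool (z = x) + of_bool (z = x\<^sub>0)) =
        (if z = x then (1 + 1 / (3 * D)) * (v - 1) else if z = x\<^sub>0 then (1 - 1 / D) * (v + 1) else v)" for v
        using \<open>x \<noteq> x\<^sub>0\<close> by (simp add: q_def)
      show ?thesis unfolding mean eq using * by (simp only: order.refl simp_thms split: if_split)
    qed
  qed simp
  then have "q z * path_mean n (\<lambda>w. (1 + 1 / (3 * D)) ^ visits x z w * (1 - 1 / D) ^ visits x\<^sub>0 z w) \<le> 3 * D"
    using u(2)[of n z] unfolding weight path_mean_cmult by linarith
  moreover have "1 / 2 * path_mean n (\<lambda>w. (1 + 1 / (3 * D)) ^ visits x z w * (1 - 1 / D) ^ visits x\<^sub>0 z w) \<le>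
     q z * path_mean n (\<lambda>w. (1 + 1 / (3 * D)) ^ visits x z w * (1 - 1 / D) ^ visits x\<^sub>0 z w)"
    using invD D(1) by (intro mult_right_mono q path_mean_nonneg) auto
  ultimately show ?thesis by linarith
qed

lemma two_point_tail:
  assumes D: "D \<ge> 2" "\<And>j y. \<bar>green j (y - x) - green j (y - x\<^sub>0)\<bar> \<le> D" and "x \<noteq> x\<^sub>0"
  shows "path_mean n (\<lambda>w. of_bool (u \<le> real (visits x z w) \<and> real (visits x\<^sub>0 z w) \<le> K)) \<le>
    6 * D * ((1 + 1 / (3 * D)) powr (- u) * (1 - 1 / D) powr (- K))"
proof -
  define a b where "a = 1 + 1 / (3 * D)" and "b = 1 - 1 / D"
  have ab: "a \<ge> 1" "0 < b" "b \<le> 1" using D(1) by (auto simp: a_def b_def)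
  have "path_mean n (\<lambda>w. of_bool (u \<le> real (visits x z w) \<and> real (visits x\<^sub>0 z w) \<le> K)) \<le>
    path_mean n (\<lambda>w. (a powr (- u) * b powr (- K)) * (a ^ visits x z w * b ^ visits x\<^sub>0 z w))"
  proof (rule path_mean_mono)
    fix w :: "(int \<times> int) list"
    have "1 * 1 \<le> a powr (real (visits x z w) - u) * b powr (real (visits x\<^sub>0 z w) - K)"
      if "u \<le> real (visits x z w)" "real (visits x\<^sub>0 z w) \<le> K"
    proof (intro mult_mono)
      show "1 \<le> a powr (real (visits x z w) - u)" using ab that by (intro ge_one_powr_ge_zero) auto
      have "b powr 0 \<le> b powr (real (visits x\<^sub>0 z w) - K)" using ab that by (intro powr_mono') auto
      then show "1 \<le> b powr (real (visits x\<^sub>0 z w) - K)" using ab by simp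
    qed auto
    also have "a powr (real (visits x z w) - u) * b powr (real (visits x\<^sub>0 z w) - K) =
      (a powr (- u) * b powr (- K)) * (a ^ visits x z w * b ^ visits x\<^sub>0 z w)"
      using ab powr_add[of a "- u" "real (visits x z w)"] powr_add[of b "- K" "real (visits x\<^sub>0 z w)"]
      by (simp add: powr_realpow mult_ac)
    finally show "of_bool (u \<le> real (visits x z w) \<and> real (visits x\<^sub>0 z w) \<le> K) \<le>
      (a powr (- u) * b powr (- K)) * (a ^ visits x z w * b ^ visits x\<^sub>0 z w)"
      using ab by auto
  qed
  also have "\<dots> \<le> (a powr (- u) * b powr (- K)) * (6 * D)"
    unfolding path_mean_cmult a_def b_def using assms by (intro mult_left_mono two_point_moment) auto
  finally show ?thesis by (simp add: mult_ac a_def b_def)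
qed

section \<open>Returns to the starting point\<close>

lemma visits_append: "visits x z (w @ w') = visits x z w + visits x (z + sum_list w) w'"
  by (induction w arbitrary: z) (simp_all add: add.assoc)

lemma visits_translate: "visits (y + x) (y + z) w = visits x z w"
  by (induction w arbitrary: z) (simp_all add: add.assoc)

lemma path_mean_visits_mono:
  assumes "m \<le> n"
  shows "path_mean m (\<lambda>w. of_bool (i \<le> visits x z w)) \<le> path_mean n (\<lambda>w. of_bool (i \<le> visits x z w))"
proof -
  have "path_mean m (\<lambda>w. of_bool (i \<le> visits x z w)) =
      path_mean m (\<lambda>w. path_mean (n - m) (\<lambda>w'. of_bool (i \<le> visits x z w)))" by simp
  also have "\<dots> \<le> path_mean m (\<lambda>w. path_mean (n - m) (\<lambda>w'. of_bool (i \<le> visits x z (w @ w'))))"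
    by (intro path_mean_mono) (auto simp: visits_append)
  also have "\<dots> = path_mean n (\<lambda>w. of_bool (i \<le> visits x z w))"
    using assms path_mean_append[of m "n - m" "\<lambda>w. of_bool (i \<le> visits x z w)"] by simp
  finally show ?thesis .
qed

text \<open>
  Visits to the origin after time \<open>0\<close> only occur once it has been hit, and from then on their
  expected number is at most \<open>green n 0\<close>.
\<close>

lemma green_le_hitting:
  "green n z - of_bool (z = 0) \<le> path_mean n (\<lambda>w. of_bool (1 \<le> visits 0 z w)) * green n 0"
proof (induction n arbitrary: z)
  case 0
  then show ?case by (simp add: green_def heat_0)
next
  case (Suc n)
  let ?h = "\<lambda>n z. path_mean n (\<lambda>w. of_bool (1 \<le> visits 0 z w))"
  have "green (Suc n) z - of_bool (z = 0) = step_mean (\<lambda>e. green n (z + e))"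
    by (simp add: green_Suc)
  also have "\<dots> \<le> step_mean (\<lambda>e. green (Suc n) 0 * (if z + e = 0 then 1 else ?h n (z + e)))"
  proof (rule step_mean_mono)
    fix e
    show "green n (z + e) \<le> green (Suc n) 0 * (if z + e = 0 then 1 else ?h n (z + e))"
    proof (cases "z + e = 0")
      case True
      then show ?thesis using green_mono[of n "Suc n" 0] by simp
    next
      case False
      have "green n (z + e) \<le> ?h n (z + e) * green n 0" using Suc[of "z + e"] False by simp
      also have "\<dots> \<le> ?h n (z + e) * green (Suc n) 0"
        by (intro mult_left_mono green_mono path_mean_nonneg) auto
      finally show ?thesis using False by (simp add: mult.commute)
    qed
  qed
  also have "\<dots> = green (Suc n) 0 * step_mean (\<lambda>e. (if z + e = 0 then 1 else ?h n (z + e)))"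
    by (rule step_mean_cmult)
  also have "(\<lambda>e. (if z + e = 0 then 1 else ?h n (z + e))) =
      (\<lambda>e. path_mean n (\<lambda>w. of_bool (1 \<le> visits 0 z (e # w))))"
    by auto
  finally show ?case by (simp add: mult.commute)
qed

lemma green_0_ge_1: "1 \<le> green n 0"
  using green_mono[of 0 n 0] by (simp add: green_def[of 0] heat_0)

lemma return_prob_lower:
  "1 - 1 / green n 0 \<le> path_mean n (\<lambda>w. of_bool (1 \<le> visits 0 0 w))"
  using green_le_hitting[of n 0] green_0_ge_1[of n] by (simp add: field_simps)

text \<open>
  A walk that reaches the origin by time \<open>j\<close> has at least \<open>m\<close> steps left at that moment, and having more steps only increases the number of visits.
\<close>

lemma visits_restart:
  "path_mean j (\<lambda>w. of_bool (1 \<le> visits 0 z w)) * path_mean m (\<lambda>w. of_bool (i \<le> visits 0 0 w))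
    \<le> path_mean (j + m) (\<lambda>w. of_bool (Suc i \<le> visits 0 z w))"
proof (induction j arbitrary: z)
  case 0
  then show ?case by (auto intro: path_mean_nonneg)
next
  case (Suc j)
  let ?V = "path_mean m (\<lambda>w. of_bool (i \<le> visits 0 0 w))"
  have "path_mean (Suc j) (\<lambda>w. of_bool (1 \<le> visits 0 z w)) * ?V =
     step_mean (\<lambda>e. ?V * path_mean j (\<lambda>w. of_bool (1 \<le> visits 0 z (e # w))))"
    by (simp add: step_mean_cmult mult.commute)
  also have "\<dots> \<le> step_mean (\<lambda>e. path_mean (j + m) (\<lambda>w. of_bool (Suc i \<le> visits 0 z (e # w))))"
  proof (rule step_mean_mono)
    fix e
    show "?V * path_mean j (\<lambda>w. of_bool (1 \<le> visits 0 z (e # w))) \<le>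
      path_mean (j + m) (\<lambda>w. of_bool (Suc i \<le> visits 0 z (e # w)))"
    proof (cases "z + e = 0")
      case True
      then show ?thesis using path_mean_visits_mono[of m "j + m" i 0 0] by simp
    next
      case False
      then show ?thesis using Suc[of "z + e"] by (simp add: mult.commute)
    qed
  qed
  finally show ?case by simp
qed

text \<open>
  Allotting time \<open>s\<close> to each of the \<open>i\<close> returns costs nothing at the precision needed, since
  \<open>ln s\<close> and \<open>ln (i s)\<close> are asymptotically equal when \<open>i\<close> is a power of \<open>ln s\<close>.
\<close>

lemma many_returns_lower:
  "(1 - 1 / green s 0) ^ i \<le> path_mean (i * s) (\<lambda>w. of_bool (i \<le> visits 0 0 w))"
proof (induction i)
  case (Suc i)
  have "(1 - 1 / green s 0) ^ Suc i \<le>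
    path_mean s (\<lambda>w. of_bool (1 \<le> visits 0 0 w)) * path_mean (i * s) (\<lambda>w. of_bool (i \<le> visits 0 0 w))"
    unfolding power_Suc using green_0_ge_1[of s]
    by (intro mult_mono Suc return_prob_lower path_mean_nonneg) auto
  also have "\<dots> \<le> path_mean (s + i * s) (\<lambda>w. of_bool (Suc i \<le> visits 0 0 w))"
    by (rule visits_restart)
  finally show ?case by simp
qed simp

section \<open>Renewals at a subgroup of the lattice\<close>

text \<open>
  The renewal argument uses that the walk seen from a point of \<open>L\<close> has the same visits to \<open>L\<close> as the
  walk seen from the origin; it applies to every subgroup.
\<close>

locale lattice_subgroup =
  fixes L :: "(int \<times> int) set"
  assumes zero_mem: "0 \<in> L" and add_mem_iff: "\<And>x y. x \<in> L \<Longrightarrow> x + y \<in> L \<longleftrightarrow> y \<in> L"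
begin

definition occupation :: "nat \<Rightarrow> int \<times> int \<Rightarrow> real" where
  "occupation n z = (\<Sum>k\<le>n. path_mean k (\<lambda>w. of_bool (z + sum_list w \<in> L)))"

text \<open>
  The expectation of \<open>\<phi>\<close> evaluated at the time that remains, out of \<open>n\<close>, when the walk from \<open>z\<close> first
  hits \<open>L\<close>; paths that do not hit \<open>L\<close> contribute \<open>0\<close>.  With \<open>\<phi> = 1\<close> it is the probability of hitting
  \<open>L\<close> by time \<open>n\<close>.
\<close>

primrec after_hitting :: "(nat \<Rightarrow> real) \<Rightarrow> nat \<Rightarrow> int \<times> int \<Rightarrow> real" where
  "after_hitting \<phi> 0 z = (if z \<in> L then \<phi> 0 else 0)"
| "after_hitting \<phi> (Suc j) z =
    (if z \<in> L then \<phi> (Suc j) else step_mean (\<lambda>e. after_hitting \<phi> j (z + e)))"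

definition avoiding :: "nat \<Rightarrow> int \<times> int \<Rightarrow> real" where
  "avoiding n z = 1 - after_hitting (\<lambda>_. 1) n z"

lemma after_hitting_nonneg: "(\<And>j. \<phi> j \<ge> 0) \<Longrightarrow> after_hitting \<phi> n z \<ge> 0"
  by (induction n arbitrary: z) (auto intro!: step_mean_nonneg)

lemma avoiding_nonneg: "avoiding n z \<ge> 0"
proof -
  have "after_hitting (\<lambda>_. 1) n z \<le> 1"
  proof (induction n arbitrary: z)
    case (Suc n)
    then show ?case using step_mean_mono[of "\<lambda>e. after_hitting (\<lambda>_. 1) n (z + e)" "\<lambda>_. 1"] by auto
  qed auto
  then show ?thesis by (simp add: avoiding_def)
qed

lemma after_hitting_le:
  assumes "mono \<phi>" "\<And>j. \<phi> j \<ge> 0"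
  shows "after_hitting \<phi> n z \<le> \<phi> n * after_hitting (\<lambda>_. 1) n z"
proof (induction n arbitrary: z)
  case (Suc n)
  have "step_mean (\<lambda>e. after_hitting \<phi> n (z + e)) \<le>
    step_mean (\<lambda>e. \<phi> (Suc n) * after_hitting (\<lambda>_. 1) n (z + e))"
    using assms(2) monoD[OF assms(1), of n "Suc n"]
    by (intro step_mean_mono order.trans[OF Suc] mult_right_mono after_hitting_nonneg) auto
  then show ?case by (simp add: step_mean_cmult)
qed simp

lemma occupation_mono: "mono (\<lambda>n. occupation n z)"
  unfolding occupation_def by (intro monoI sum_mono2) (auto intro: path_mean_nonneg)

lemma occupation_nonneg: "occupation n z \<ge> 0"
  unfolding occupation_def by (intro sum_nonneg path_mean_nonneg) auto

lemma occupation_Suc: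
  "occupation (Suc n) z = of_bool (z \<in> L) + step_mean (\<lambda>e. occupation n (z + e))"
  unfolding occupation_def step_mean_sum
  by (subst sum.atMost_Suc_shift) (simp add: add.assoc)

lemma occupation_translate: "x \<in> L \<Longrightarrow> occupation n (x + z) = occupation n z"
  by (simp add: occupation_def add.assoc add_mem_iff)

text \<open>
  All visits to \<open>L\<close> happen at or after the hitting time, and from then on the walk is, modulo \<open>L\<close>,
  started afresh at the origin.
\<close>

lemma occupation_after_hitting: "after_hitting (\<lambda>j. occupation j 0) n z = occupation n z"
proof (induction n arbitrary: z)
  case 0
  then show ?case by (simp add: occupation_def zero_mem)
next
  case (Suc n)
  show ?case
  proof (cases "z \<in> L")
    case True
    then show ?thesis using occupation_translate[of z "Suc n" 0] by simp
  next
    case False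
    then show ?thesis by (simp add: Suc occupation_Suc)
  qed
qed

lemma occupation_le: "occupation n z \<le> occupation n 0"
proof -
  have "occupation n z \<le> occupation n 0 * after_hitting (\<lambda>_. 1) n z"
    using after_hitting_le[OF occupation_mono[of 0] occupation_nonneg] by (simp add: occupation_after_hitting)
  also have "\<dots> \<le> occupation n 0 * 1"
    using avoiding_nonneg[of n z] by (intro mult_left_mono occupation_nonneg) (simp add: avoiding_def)
  finally show ?thesis by simp
qed

text \<open>
  A bound on the gap between trials: decomposing at the first visit to \<open>L\<close> after time \<open>T\<close>, the
  visits up to time \<open>T + n\<close> number at most \<open>occupation T 0\<close> before that visit, and at most
  \<open>occupation (T + n) 0\<close> times the probability that it occurs afterwards.
\<close>

lemma avoiding_le_ratio:
  "path_mean T (\<lambda>w. avoiding n (sum_list w)) * occupation (T + n) 0 \<le> occupation T 0"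
proof -
  define A where "A = path_mean T (\<lambda>w. after_hitting (\<lambda>_. 1) n (sum_list w))"
  have "occupation (T + n) 0 \<le> occupation T 0 + path_mean T (\<lambda>w. occupation n (sum_list w))"
  proof -
    have "path_mean T (\<lambda>w. occupation n (sum_list w)) =
        (\<Sum>k\<le>n. path_mean (T + k) (\<lambda>w. of_bool (sum_list w \<in> L)))"
      by (simp add: occupation_def path_mean_sum path_mean_append)
    also have "\<dots> = (\<Sum>k\<in>{T..T+n}. path_mean k (\<lambda>w. of_bool (sum_list w \<in> L)))"
      by (rule sum.reindex_bij_witness[of _ "\<lambda>k. k - T" "\<lambda>k. T + k"]) auto
    finally have eq: "path_mean T (\<lambda>w. occupation n (sum_list w)) = \<dots>" .
    have "{..T + n} \<subseteq> {..T} \<union> {T..T + n}" by auto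
    then have "occupation (T + n) 0 \<le> (\<Sum>k\<in>{..T} \<union> {T..T+n}. path_mean k (\<lambda>w. of_bool (sum_list w \<in> L)))"
      unfolding occupation_def by (simp, intro sum_mono2) (auto intro: path_mean_nonneg)
    also have "\<dots> \<le> occupation T 0 + (\<Sum>k\<in>{T..T+n}. path_mean k (\<lambda>w. of_bool (sum_list w \<in> L)))"
      unfolding occupation_def by (subst sum_Un) (auto intro!: sum_nonneg path_mean_nonneg)
    finally show ?thesis unfolding eq .
  qed
  also have "path_mean T (\<lambda>w. occupation n (sum_list w)) \<le>
      path_mean T (\<lambda>w. occupation (T + n) 0 * after_hitting (\<lambda>_. 1) n (sum_list w))"
  proof (rule path_mean_mono)
    fix w
    have "occupation n (sum_list w) \<le> occupation n 0 * after_hitting (\<lambda>_. 1) n (sum_list w)"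
      using after_hitting_le[OF occupation_mono[of 0] occupation_nonneg] by (simp add: occupation_after_hitting)
    also have "\<dots> \<le> occupation (T + n) 0 * after_hitting (\<lambda>_. 1) n (sum_list w)"
      by (intro mult_right_mono monoD[OF occupation_mono] after_hitting_nonneg) auto
    finally show "occupation n (sum_list w) \<le> \<dots>" .
  qed
  also have "\<dots> = occupation (T + n) 0 * A" by (simp add: path_mean_cmult A_def)
  finally have "occupation (T + n) 0 \<le> occupation T 0 + occupation (T + n) 0 * A" by simp
  moreover have "path_mean T (\<lambda>w. avoiding n (sum_list w)) = 1 - A"
    by (simp add: avoiding_def path_mean_diff A_def)
  ultimately show ?thesis by (simp only: left_diff_distrib mult_1) (simp add: mult.commute)
qed

definition miss :: "nat \<Rightarrow> nat \<Rightarrow> real" where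
  "miss u n = path_mean n (\<lambda>w. of_bool (\<forall>x\<in>L. visits x 0 w < u))"

lemma miss_nonneg: "miss u n \<ge> 0"
  unfolding miss_def by (rule path_mean_nonneg) simp

lemma miss_le_1: "miss u n \<le> 1"
  unfolding miss_def by (rule path_mean_of_bool_le_1)

lemma miss_antimono:
  assumes "m \<le> n" shows "miss u n \<le> miss u m"
proof -
  have "miss u n = path_mean m (\<lambda>w. path_mean (n - m) (\<lambda>w'. of_bool (\<forall>x\<in>L. visits x 0 (w @ w') < u)))"
    using assms path_mean_append[of m "n - m" "\<lambda>w. of_bool (\<forall>x\<in>L. visits x 0 w < u)"]
    by (simp add: miss_def)
  also have "\<dots> \<le> path_mean m (\<lambda>w. path_mean (n - m) (\<lambda>w'. of_bool (\<forall>x\<in>L. visits x 0 w < u)))"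
    by (intro path_mean_mono) (auto simp: visits_append intro: add_lessD1)
  finally show ?thesis by (simp add: miss_def)
qed

lemma miss_from:
  "path_mean n (\<lambda>w. of_bool (\<forall>x\<in>L. visits x z w < u)) \<le> avoiding n z + after_hitting (miss u) n z"
proof (induction n arbitrary: z)
  case 0
  then show ?case by (auto simp: avoiding_def miss_def)
next
  case (Suc n)
  show ?case
  proof (cases "z \<in> L")
    case True
    have "(\<forall>x\<in>L. visits x z w < u) \<longleftrightarrow> (\<forall>x\<in>L. visits x 0 w < u)" for w
    proof
      assume *: "\<forall>x\<in>L. visits x z w < u"
      show "\<forall>x\<in>L. visits x 0 w < u"
      proof
        fix x assume "x \<in> L"
        then have "z + x \<in> L" using True add_mem_iff by blast
        then show "visits x 0 w < u" using * visits_translate[of z x 0 w] by force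
      qed
    next
      assume *: "\<forall>x\<in>L. visits x 0 w < u"
      show "\<forall>x\<in>L. visits x z w < u"
      proof
        fix x assume "x \<in> L"
        then have "x - z \<in> L" using True add_mem_iff[of z "x - z"] by simp
        then show "visits x z w < u" using * visits_translate[of z "x - z" 0 w] by force
      qed
    qed
    then have "path_mean (Suc n) (\<lambda>w. of_bool (\<forall>x\<in>L. visits x z w < u)) = miss u (Suc n)"
      unfolding miss_def by (simp only:)
    with True show ?thesis by (simp add: avoiding_def)
  next
    case False
    have "path_mean (Suc n) (\<lambda>w. of_bool (\<forall>x\<in>L. visits x z w < u)) \<le>
      step_mean (\<lambda>e. path_mean n (\<lambda>w. of_bool (\<forall>x\<in>L. visits x (z + e) w < u)))"
      unfolding path_mean.simps
      by (intro step_mean_mono path_mean_of_bool_mono) (auto intro: le_less_trans[rotated])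
    also have "\<dots> \<le> step_mean (\<lambda>e. avoiding n (z + e) + after_hitting (miss u) n (z + e))"
      by (intro step_mean_mono Suc)
    finally show ?thesis using False
      by (simp add: avoiding_def step_mean_add step_mean_diff)
  qed
qed

lemma sum_after_hitting_le:
  assumes "\<And>j. \<phi> j \<ge> 0"
  shows "(\<Sum>n\<le>N. after_hitting \<phi> n z) \<le> (\<Sum>n\<le>N. \<phi> n)"
proof (induction N arbitrary: z)
  case 0
  then show ?case using assms by simp
next
  case (Suc N)
  show ?case
  proof (cases "z \<in> L")
    case True
    then have "after_hitting \<phi> n z = \<phi> n" for n by (cases n) auto
    then show ?thesis by simp
  next
    case False
    then have "(\<Sum>n\<le>Suc N. after_hitting \<phi> n z) = step_mean (\<lambda>e. \<Sum>n\<le>N. after_hitting \<phi> n (z + e))"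
      by (subst sum.atMost_Suc_shift) (simp add: step_mean_sum)
    also have "\<dots> \<le> step_mean (\<lambda>e. \<Sum>n\<le>N. \<phi> n)" by (intro step_mean_mono Suc)
    also have "\<dots> \<le> (\<Sum>n\<le>Suc N. \<phi> n)" using assms by simp
    finally show ?thesis .
  qed
qed

text \<open>
  If no point of \<open>L\<close> reaches \<open>u\<close> visits, then in particular the trial of length \<open>T\<close> from the origin
  fails, and either the walk avoids \<open>L\<close> from then on or it starts afresh at its next visit to \<open>L\<close>.
  Summing over the time horizon turns the convolution over the hitting time into a product: with
  \<open>S\<close> the sum of \<open>miss u j\<close> one gets \<open>S \<le> T + B + (1 - p) S\<close>, where \<open>B\<close> is the total gap probability.
  The failure of a trial and the gap after it are dependent, but after the summation the term for
  the fresh start is at most \<open>S\<close> whatever the position at time \<open>T\<close>.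
\<close>

lemma miss_renewal:
  fixes T N u :: nat
  defines "p \<equiv> path_mean T (\<lambda>w. of_bool (u \<le> visits 0 0 w))"
  shows "p * (\<Sum>j\<le>N. miss u j) \<le> real T + (\<Sum>j\<le>N. path_mean T (\<lambda>w. avoiding j (sum_list w)))"
proof -
  define S where "S = (\<Sum>j\<le>N. miss u j)"
  define B where "B = (\<Sum>j\<le>N. path_mean T (\<lambda>w. avoiding j (sum_list w)))"
  have step: "miss u (T + j) \<le> path_mean T (\<lambda>w. avoiding j (sum_list w)) +
      path_mean T (\<lambda>w. of_bool (visits 0 0 w < u) * after_hitting (miss u) j (sum_list w))" for j
  proof -
    have "miss u (T + j) \<le> path_mean T (\<lambda>w. path_mean j (\<lambda>w'. of_bool (visits 0 0 w < u) *
         of_bool (\<forall>x\<in>L. visits x (sum_list w) w' < u)))"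
      unfolding miss_def path_mean_append using zero_mem
      by (intro path_mean_mono) (auto simp: visits_append intro: le_less_trans[rotated])
    also have "\<dots> = path_mean T (\<lambda>w. of_bool (visits 0 0 w < u) *
         path_mean j (\<lambda>w'. of_bool (\<forall>x\<in>L. visits x (sum_list w) w' < u)))"
      by (simp only: path_mean_cmult)
    also have "\<dots> \<le> path_mean T (\<lambda>w. avoiding j (sum_list w) +
        of_bool (visits 0 0 w < u) * after_hitting (miss u) j (sum_list w))"
      using miss_from avoiding_nonneg by (intro path_mean_mono) auto
    finally show ?thesis by (simp add: path_mean_add)
  qed
  \<comment> \<open>The first \<open>T\<close> terms are at most \<open>1\<close> each; the others start with a complete trial.\<close>
  have "S \<le> (\<Sum>j<T + Suc N. miss u j)"
    unfolding S_def by (intro sum_mono2) (auto simp: miss_nonneg)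
  also have "\<dots> = (\<Sum>j<T. miss u j) + (\<Sum>j\<le>N. miss u (T + j))"
  proof -
    have "(\<Sum>j<T + n. miss u j) = (\<Sum>j<T. miss u j) + (\<Sum>j<n. miss u (T + j))" for n
      by (induction n) simp_all
    then show ?thesis by (simp only: lessThan_Suc_atMost)
  qed
  also have "\<dots> \<le> real T + (\<Sum>j\<le>N. path_mean T (\<lambda>w. avoiding j (sum_list w)) +
      path_mean T (\<lambda>w. of_bool (visits 0 0 w < u) * after_hitting (miss u) j (sum_list w)))"
    using sum_mono[of "{..<T}" "miss u" "\<lambda>_. 1"] by (intro add_mono sum_mono step) (auto simp: miss_le_1)
  also have "\<dots> = real T + B + path_mean T (\<lambda>w. of_bool (visits 0 0 w < u) *
      (\<Sum>j\<le>N. after_hitting (miss u) j (sum_list w)))"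
    by (simp add: B_def sum.distrib path_mean_sum[symmetric] sum_distrib_left)
  also have "\<dots> \<le> real T + B + path_mean T (\<lambda>w. S * of_bool (visits 0 0 w < u))"
    using sum_after_hitting_le[of "miss u" _ N] miss_nonneg unfolding S_def
    by (intro add_left_mono path_mean_mono) auto
  also have "path_mean T (\<lambda>w. S * of_bool (visits 0 0 w < u)) = S * (1 - p)"
    using path_mean_not[of T "\<lambda>w. u \<le> visits 0 0 w"] by (simp add: path_mean_cmult p_def not_le)
  finally show ?thesis unfolding S_def[symmetric] B_def[symmetric] by (simp add: algebra_simps)
qed

end

section \<open>Trials started on a lattice line\<close>

lemma lattice_line_iff: "z \<in> lattice_line a b \<longleftrightarrow> a * fst z + b * snd z = 0"
  by (cases z) (simp add: lattice_line_def)

lemma lattice_ball_iff: "z \<in> lattice_ball r \<longleftrightarrow> sqrt ((real_of_int (fst z))\<^sup>2 + (real_of_int (snd z))\<^sup>2) \<le> r"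
  by (cases z) (simp add: lattice_ball_def norm_Pair)

lemma lattice_subgroup_line: "lattice_subgroup (lattice_line a b)"
  by unfold_locales (auto simp: lattice_line_iff algebra_simps)

lemma path_mean_linear_form_square:
  "path_mean k (\<lambda>w. (real_of_int (a * fst (z + sum_list w) + b * snd (z + sum_list w)))\<^sup>2) =
    (real_of_int (a * fst z + b * snd z))\<^sup>2 + real k * (real_of_int (a\<^sup>2 + b\<^sup>2)) / 2"
proof (induction k arbitrary: z)
  case (Suc k)
  have "path_mean (Suc k) (\<lambda>w. (real_of_int (a * fst (z + sum_list w) + b * snd (z + sum_list w)))\<^sup>2) =
    step_mean (\<lambda>e. (real_of_int (a * fst (z + e) + b * snd (z + e)))\<^sup>2 + real k * (real_of_int (a\<^sup>2 + b\<^sup>2)) / 2)"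
    using Suc[of "z + _"] by (simp add: add.assoc)
  also have "\<dots> = (real_of_int (a * fst z + b * snd z))\<^sup>2 + real (Suc k) * (real_of_int (a\<^sup>2 + b\<^sup>2)) / 2"
    unfolding step_mean_add by (simp add: step_mean_eq power2_eq_square algebra_simps add_divide_distrib)
  finally show ?case .
qed simp

text \<open>
  Chebyshev's inequality.
\<close>

lemma linear_form_spread:
  assumes "real n * real_of_int (a\<^sup>2 + b\<^sup>2) \<le> R\<^sup>2" "R > 0" "k \<le> n"
  shows "1 / 2 \<le> path_mean k (\<lambda>w. of_bool (\<bar>real_of_int (a * fst (sum_list w) + b * snd (sum_list w))\<bar> \<le> R))"
proof -
  let ?Y = "\<lambda>w. real_of_int (a * fst (sum_list w) + b * snd (sum_list w))"
  have "path_mean k (\<lambda>w. of_bool (\<not> \<bar>?Y w\<bar> \<le> R)) \<le> path_mean k (\<lambda>w. 1 / R\<^sup>2 * (?Y w)\<^sup>2)"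
  proof (rule path_mean_mono)
    fix w
    have "1 \<le> 1 / R\<^sup>2 * (?Y w)\<^sup>2" if "R < \<bar>?Y w\<bar>"
      using power_strict_mono[OF that, of 2] \<open>R > 0\<close> by (simp add: field_simps)
    then show "of_bool (\<not> \<bar>?Y w\<bar> \<le> R) \<le> 1 / R\<^sup>2 * (?Y w)\<^sup>2" by auto
  qed
  also have "\<dots> = 1 / R\<^sup>2 * (real k * (real_of_int (a\<^sup>2 + b\<^sup>2)) / 2)"
    unfolding path_mean_cmult
    using arg_cong[OF path_mean_linear_form_square[of k a 0 b], of "\<lambda>x. 1 / R\<^sup>2 * x"] by simp
  also have "\<dots> \<le> 1 / R\<^sup>2 * (R\<^sup>2 / 2)"
  proof -
    have "real k * real_of_int (a\<^sup>2 + b\<^sup>2) \<le> real n * real_of_int (a\<^sup>2 + b\<^sup>2)"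
      using \<open>k \<le> n\<close> by (intro mult_right_mono) auto
    then show ?thesis using assms by (intro mult_left_mono divide_right_mono) auto
  qed
  also have "\<dots> = 1 / 2" using \<open>R > 0\<close> by simp
  finally show ?thesis unfolding path_mean_not by simp
qed

lemma sum_inverse_sqrt: "(\<Sum>k=1..n. 1 / sqrt (real k)) \<le> 2 * sqrt (real n)"
proof (induction n)
  case (Suc n)
  define s t where "s = sqrt (real n)" and "t = sqrt (real (Suc n))"
  have st: "0 \<le> s" "s \<le> t" "0 < t" "t * t - s * s = 1" by (auto simp: s_def t_def)
  have "1 \<le> 2 * (t - s) * t"
  proof -
    have "1 = (t - s) * (t + s)" using st(4) by (simp add: algebra_simps)
    also have "\<dots> \<le> (t - s) * (2 * t)" using st by (intro mult_left_mono) auto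
    finally show ?thesis by (simp only: mult_ac)
  qed
  then have "1 / t \<le> 2 * t - 2 * s" using st by (simp add: field_simps)
  then show ?case using Suc by (simp add: s_def t_def)
qed simp

primrec exits :: "real \<Rightarrow> int \<times> int \<Rightarrow> (int \<times> int) list \<Rightarrow> bool" where
  "exits r z [] \<longleftrightarrow> z \<notin> lattice_ball r"
| "exits r z (e # w) \<longleftrightarrow> z \<notin> lattice_ball r \<or> exits r (z + e) w"

text \<open>
  The squared distance from the origin grows by \<open>1\<close> per step on average, so
  \<open>(|z|\<^sup>2 + n) / r\<^sup>2\<close> is a solution of the heat equation which is at least \<open>1\<close> outside the ball.
\<close>

lemma exit_prob:
  assumes "r > 0"
  shows "path_mean n (\<lambda>w. of_bool (exits r z w)) \<le>
    ((real_of_int (fst z))\<^sup>2 + (real_of_int (snd z))\<^sup>2 + real n) / r\<^sup>2"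
proof -
  have outside: "1 \<le> ((real_of_int (fst z))\<^sup>2 + (real_of_int (snd z))\<^sup>2 + real n) / r\<^sup>2"
    if "z \<notin> lattice_ball r" for z n
  proof -
    have "r \<le> sqrt ((real_of_int (fst z))\<^sup>2 + (real_of_int (snd z))\<^sup>2)"
      using that by (simp add: lattice_ball_iff)
    then have "r\<^sup>2 \<le> (sqrt ((real_of_int (fst z))\<^sup>2 + (real_of_int (snd z))\<^sup>2))\<^sup>2"
      using assms by (intro power_mono) auto
    then show ?thesis using assms by (subst pos_le_divide_eq) auto
  qed
  show ?thesis
  proof (induction n arbitrary: z)
    case 0
    then show ?case using outside[of z 0] by simp
  next
    case (Suc n)
    show ?case
    proof (cases "z \<in> lattice_ball r")
      case True
      have "path_mean (Suc n) (\<lambda>w. of_bool (exits r z w)) =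
          step_mean (\<lambda>e. path_mean n (\<lambda>w. of_bool (exits r (z + e) w)))"
        using True by simp
      also have "\<dots> \<le> step_mean (\<lambda>e.
          ((real_of_int (fst (z + e)))\<^sup>2 + (real_of_int (snd (z + e)))\<^sup>2 + real n) / r\<^sup>2)"
        by (intro step_mean_mono Suc)
      also have "\<dots> = ((real_of_int (fst z))\<^sup>2 + (real_of_int (snd z))\<^sup>2 + real (Suc n)) / r\<^sup>2"
        using assms by (simp add: step_mean_eq field_simps power2_eq_square)
      finally show ?thesis .
    next
      case False
      with path_mean_of_bool_le_1[of "Suc n" "exits r z"] outside[of z "Suc n"]
      show ?thesis by linarith
    qed
  qed
qed

lemma visited_in_ball: "visits x z w > 0 \<Longrightarrow> \<not> exits r z w \<Longrightarrow> x \<in> lattice_ball r"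
proof (induction w arbitrary: z)
  case (Cons e w)
  then show ?case by (cases "z + e = x"; cases w) auto
qed simp

context
  fixes a b :: int
  assumes nz: "a \<noteq> 0 \<or> b \<noteq> 0"
begin

interpretation lattice_subgroup "lattice_line a b"
  by (rule lattice_subgroup_line)

abbreviation (input) form :: "int \<times> int \<Rightarrow> int" where
  "form z \<equiv> a * fst z + b * snd z"

text \<open>
  Up to time \<open>n\<close> the linear form \<open>a x\<^sub>1 + b x\<^sub>2\<close> spends on average at least half of its time among
  \<open>O(sqrt n)\<close> integers, and by \<open>occupation_le\<close> it spends at most as much time at any value as at \<open>0\<close>.
\<close>

lemma occupation_line_lower: "\<exists>c>0. \<forall>n. c * sqrt (real n) \<le> occupation n 0"
proof (intro exI conjI allI)
  define s where "s = real_of_int (a\<^sup>2 + b\<^sup>2)"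
  have s: "s \<ge> 1"
  proof -
    have "a\<^sup>2 + b\<^sup>2 > 0" using nz by (simp add: sum_power2_gt_zero_iff)
    then show ?thesis unfolding s_def by linarith
  qed
  show "0 < 1 / (10 * sqrt s)" using s by simp
  fix n :: nat
  show "1 / (10 * sqrt s) * sqrt (real n) \<le> occupation n 0"
  proof (cases "n = 0")
    case True
    then show ?thesis using occupation_nonneg by simp
  next
    case False
    define R where "R = nat \<lceil>sqrt (real n * s)\<rceil>"
    have "1 * 1 \<le> real n * s" using False s by (intro mult_mono) auto
    then have ns: "1 \<le> sqrt (real n * s)" by simp
    have R: "sqrt (real n * s) \<le> real R" "real R \<le> sqrt (real n * s) + 1" "R > 0"
      using ns unfolding R_def by linarith+
    have at_value: "(\<Sum>k\<le>n. path_mean k (\<lambda>w. of_bool (form (sum_list w) = y))) \<le> occupation n 0" for y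
    proof (cases "\<exists>z. form z = y")
      case True
      then obtain z where z: "form z = y" by blast
      have "(form (sum_list w) = y) \<longleftrightarrow> (- z + sum_list w \<in> lattice_line a b)" for w
        using z by (auto simp: lattice_line_iff algebra_simps)
      then have "(\<Sum>k\<le>n. path_mean k (\<lambda>w. of_bool (form (sum_list w) = y))) = occupation n (- z)"
        by (simp add: occupation_def)
      then show ?thesis using occupation_le by simp
    next
      case False
      then have "path_mean k (\<lambda>w. of_bool (form (sum_list w) = y)) = 0" for k
        by (subst path_mean_cong[where G = "\<lambda>_. 0"]) auto
      then show ?thesis using occupation_nonneg by simp
    qed
    have spread: "1 / 2 \<le> path_mean k (\<lambda>w. of_bool (form (sum_list w) \<in> {- int R..int R}))" if "k \<le> n" for k
    proof -
      have "(sqrt (real n * s))\<^sup>2 \<le> (real R)\<^sup>2" using R(1) s by (intro power_mono) auto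
      then have "1 / 2 \<le> path_mean k (\<lambda>w. of_bool (\<bar>real_of_int (form (sum_list w))\<bar> \<le> real R))"
        using R s that by (intro linear_form_spread) (auto simp: s_def)
      also have "\<dots> \<le> path_mean k (\<lambda>w. of_bool (form (sum_list w) \<in> {- int R..int R}))"
        by (intro path_mean_of_bool_mono) (unfold atLeastAtMost_iff, linarith)
      finally show ?thesis .
    qed
    have "(real n + 1) / 2 = (\<Sum>k\<le>n. 1 / 2)" by simp
    also have "\<dots> \<le> (\<Sum>k\<le>n. path_mean k (\<lambda>w. of_bool (form (sum_list w) \<in> {- int R..int R})))"
      by (intro sum_mono spread) auto
    also have "\<dots> = (\<Sum>k\<le>n. path_mean k (\<lambda>w. \<Sum>y\<in>{- int R..int R}. of_bool (form (sum_list w) = y)))"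
      by (intro sum.cong refl path_mean_cong) (simp add: of_bool_def)
    also have "\<dots> = (\<Sum>y\<in>{- int R..int R}. \<Sum>k\<le>n. path_mean k (\<lambda>w. of_bool (form (sum_list w) = y)))"
      by (simp only: path_mean_sum) (rule sum.swap)
    also have "\<dots> \<le> (\<Sum>y\<in>{- int R..int R}. occupation n 0)"
      by (intro sum_mono at_value)
    also have "\<dots> = (2 * real R + 1) * occupation n 0" by simp
    also have "\<dots> \<le> (5 * sqrt (real n * s)) * occupation n 0"
      using R ns by (intro mult_right_mono occupation_nonneg) linarith
    finally have "real n \<le> (10 * sqrt (real n * s)) * occupation n 0" by simp
    then have "sqrt (real n) * sqrt (real n) \<le> sqrt (real n) * (10 * sqrt s * occupation n 0)"
      by (simp add: real_sqrt_mult mult_ac)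
    then have "sqrt (real n) \<le> 10 * sqrt s * occupation n 0"
      using False by (subst (asm) mult_le_cancel_left_pos) auto
    then show ?thesis using s by (simp add: field_simps)
  qed
qed

text \<open>
  One of the two independent coordinates \<open>x\<^sub>1 + x\<^sub>2\<close> and \<open>x\<^sub>1 - x\<^sub>2\<close> is injective on the line.  Its
  probabilities sum to at most \<open>1\<close>, and those of the other one are at most \<open>1 / sqrt k\<close> at time \<open>k\<close>.
\<close>

lemma occupation_line_upper: "occupation n 0 \<le> 1 + 2 * sqrt (real n)"
proof -
  have at_time: "path_mean k (\<lambda>w. of_bool (sum_list w \<in> lattice_line a b)) \<le> 1 / sqrt (real k)" if "k > 0" for k
  proof -
    define F where "F = lattice_line a b \<inter> {- int k..int k} \<times> {- int k..int k}"
    have "finite F" by (simp add: F_def)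
    have bounded: "\<bar>fst (sum_list w)\<bar> \<le> int (length w) \<and> \<bar>snd (sum_list w)\<bar> \<le> int (length w)"
      if "set w \<subseteq> unit_steps" for w
      using that by (induction w) (auto simp: unit_steps_def)
    have "path_mean k (\<lambda>w. of_bool (sum_list w \<in> lattice_line a b)) \<le>
        path_mean k (\<lambda>w. \<Sum>x\<in>F. of_bool (sum_list w = x))"
    proof (rule path_mean_mono)
      fix w assume w: "length w = k" "set w \<subseteq> unit_steps"
      have "sum_list w \<in> F" if "sum_list w \<in> lattice_line a b"
        using that bounded[OF w(2)] w(1) by (cases "sum_list w") (auto simp: F_def abs_le_iff)
      then show "of_bool (sum_list w \<in> lattice_line a b) \<le> (\<Sum>x\<in>F. of_bool (sum_list w = x) :: real)"
        using \<open>finite F\<close> by (simp add: of_bool_def)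
    qed
    also have "\<dots> = (\<Sum>x\<in>F. heat k x)"
      using path_mean_endpoint[of k 0] by (simp add: path_mean_sum heat_minus)
    also have "\<dots> \<le> 1 / sqrt (real k)"
    proof -
      have prod_bound: "(\<Sum>x\<in>F. srw1 k (f x) * srw1 k (g x)) \<le> 1 / sqrt (real k)" if "inj_on g F" for f g
      proof -
        have "(\<Sum>x\<in>F. srw1 k (f x) * srw1 k (g x)) \<le> (\<Sum>x\<in>F. 1 / sqrt (real k) * srw1 k (g x))"
          using \<open>k > 0\<close> by (intro sum_mono mult_right_mono srw1_le srw1_nonneg)
        also have "\<dots> = 1 / sqrt (real k) * (\<Sum>t\<in>g ` F. srw1 k t)"
          using that by (simp add: sum.reindex sum_distrib_left)
        also have "\<dots> \<le> 1 / sqrt (real k) * 1"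
          using \<open>finite F\<close> by (intro mult_left_mono srw1_sum_le_1) auto
        finally show ?thesis by simp
      qed
      show ?thesis
      proof (cases "a + b = 0")
        case False
        have "inj_on (\<lambda>x. fst x - snd x) F"
        proof (rule inj_onI)
          fix x y assume xy: "x \<in> F" "y \<in> F" "fst x - snd x = fst y - snd y"
          have "(a + b) * (fst x - fst y) = form x - form y - b * ((fst y - snd y) - (fst x - snd x)) - 0"
            by (simp add: algebra_simps)
          also have "\<dots> = 0" using xy by (simp add: F_def lattice_line_iff)
          finally show "x = y" using xy(3) False by (auto simp: prod_eq_iff)
        qed
        from prod_bound[OF this, of "\<lambda>x. fst x + snd x"] show ?thesis by (simp add: heat_def)
      next
        case True
        then have b: "b = - a" "a \<noteq> 0" using nz by auto
        have "inj_on (\<lambda>x. fst x + snd x) F"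
        proof (rule inj_onI)
          fix x y assume xy: "x \<in> F" "y \<in> F" "fst x + snd x = fst y + snd y"
          have "fst x = snd x" "fst y = snd y" using xy b by (auto simp: F_def lattice_line_iff)
          then show "x = y" using xy(3) by (auto simp: prod_eq_iff)
        qed
        from prod_bound[OF this, of "\<lambda>x. fst x - snd x"] show ?thesis by (simp add: heat_def mult.commute)
      qed
    qed
    finally show ?thesis .
  qed
  have "occupation n 0 = path_mean 0 (\<lambda>w. of_bool (sum_list w \<in> lattice_line a b)) +
      (\<Sum>k=1..n. path_mean k (\<lambda>w. of_bool (sum_list w \<in> lattice_line a b)))"
    unfolding occupation_def atMost_atLeast0 by (subst sum.atLeast_Suc_atMost) auto
  also have "\<dots> \<le> 1 + (\<Sum>k=1..n. 1 / sqrt (real k))"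
    by (intro add_mono sum_mono at_time) auto
  also have "\<dots> \<le> 1 + 2 * sqrt (real n)" using sum_inverse_sqrt by simp
  finally show ?thesis .
qed

text \<open>
  Since \<open>miss u\<close> decreases in time, its value at \<open>N\<close> is at most its average up to time \<open>N\<close>, which
  \<open>miss_renewal\<close> controls: the gap probabilities, of order \<open>sqrt (T / j)\<close>, sum to \<open>O(sqrt (T N))\<close>.
\<close>

lemma miss_line_upper:
  "\<exists>C>0. \<forall>T N u. 1 \<le> T \<longrightarrow> T \<le> N \<longrightarrow>
    path_mean T (\<lambda>w. of_bool (u \<le> visits 0 0 w)) * miss u N \<le> C * sqrt (real T / real N)"
proof -
  obtain c where c: "c > 0" "\<And>n. c * sqrt (real n) \<le> occupation n 0"
    using occupation_line_lower by blast
  have "path_mean T (\<lambda>w. of_bool (u \<le> visits 0 0 w)) * miss u N \<le> (1 + 6 / c) * sqrt (real T / real N)"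
    if TN: "1 \<le> T" "T \<le> N" for T N u
  proof -
    let ?p = "path_mean T (\<lambda>w. of_bool (u \<le> visits 0 0 w))"
    have avoid: "path_mean T (\<lambda>w. avoiding j (sum_list w)) \<le> 3 * sqrt (real T) / c * (1 / sqrt (real (Suc j)))" for j
    proof -
      let ?A = "path_mean T (\<lambda>w. avoiding j (sum_list w))"
      have "sqrt (real T) \<ge> 1" using TN by simp
      then have T3: "occupation T 0 \<le> 3 * sqrt (real T)" using occupation_line_upper[of T] by linarith
      have "?A * (c * sqrt (real (Suc j))) \<le> ?A * occupation (T + j) 0"
      proof (intro mult_left_mono path_mean_nonneg avoiding_nonneg)
        have "c * sqrt (real (Suc j)) \<le> c * sqrt (real (T + j))"
          using TN c(1) by (intro mult_left_mono real_sqrt_le_mono) auto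
        also have "\<dots> \<le> occupation (T + j) 0" by (rule c)
        finally show "c * sqrt (real (Suc j)) \<le> occupation (T + j) 0" .
      qed
      also have "\<dots> \<le> 3 * sqrt (real T)" using avoiding_le_ratio[of T j] T3 by linarith
      finally show ?thesis using c(1) by (simp add: field_simps)
    qed
    have "(real N + 1) * (?p * miss u N) = ?p * (\<Sum>j\<le>N. miss u N)" by simp
    also have "\<dots> \<le> ?p * (\<Sum>j\<le>N. miss u j)"
      by (intro mult_left_mono sum_mono miss_antimono path_mean_nonneg) auto
    also have "\<dots> \<le> real T + (\<Sum>j\<le>N. path_mean T (\<lambda>w. avoiding j (sum_list w)))"
      by (rule miss_renewal)
    also have "\<dots> \<le> real T + (\<Sum>j\<le>N. 3 * sqrt (real T) / c * (1 / sqrt (real (Suc j))))"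
      by (intro add_left_mono sum_mono avoid)
    also have "(\<Sum>j\<le>N. 3 * sqrt (real T) / c * (1 / sqrt (real (Suc j)))) =
        3 * sqrt (real T) / c * (\<Sum>k=1..Suc N. 1 / sqrt (real k))"
      by (simp add: sum_distrib_left sum.atLeast_Suc_atMost_Suc_shift atMost_atLeast0 del: sum.cl_ivl_Suc)
    also have "real T + \<dots> \<le> real T + 3 * sqrt (real T) / c * (2 * sqrt (real (Suc N)))"
      using c(1) by (intro add_left_mono mult_left_mono sum_inverse_sqrt) auto
    finally have "(real N + 1) * (?p * miss u N) \<le> real T + 3 * sqrt (real T) / c * (2 * sqrt (real (Suc N)))" .
    moreover have "real T \<le> sqrt (real T) * sqrt (real (Suc N))"
    proof -
      have "real T = sqrt (real T) * sqrt (real T)" by simp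
      also have "\<dots> \<le> sqrt (real T) * sqrt (real (Suc N))" using TN by (intro mult_left_mono) auto
      finally show ?thesis .
    qed
    ultimately have "(real N + 1) * (?p * miss u N) \<le>
        sqrt (real T) * sqrt (real (Suc N)) + 3 * sqrt (real T) / c * (2 * sqrt (real (Suc N)))"
      by linarith
    also have "\<dots> = (1 + 6 / c) * (sqrt (real T) * sqrt (real N + 1))"
      by (simp add: distrib_right add.commute)
    also have "\<dots> = (real N + 1) * ((1 + 6 / c) * (sqrt (real T) / sqrt (real N + 1)))"
    proof -
      have "x * y = (y * y) * (x / y)" if "y > 0" for x y :: real using that by simp
      from this[of "sqrt (real N + 1)" "sqrt (real T)"]
      have "sqrt (real T) * sqrt (real N + 1) = (real N + 1) * (sqrt (real T) / sqrt (real N + 1))" by simp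
      then show ?thesis by (simp only: mult_ac)
    qed
    finally have "?p * miss u N \<le> (1 + 6 / c) * (sqrt (real T) / sqrt (real N + 1))"
      by (subst (asm) mult_le_cancel_left_pos) auto
    also have "\<dots> \<le> (1 + 6 / c) * sqrt (real T / real N)"
      unfolding real_sqrt_divide using TN c(1) by (intro mult_left_mono divide_left_mono) auto
    finally show ?thesis .
  qed
  then show ?thesis using c(1) by (intro exI[of _ "1 + 6 / c"]) (auto intro: add_pos_pos)
qed

lemma miss_in_ball_upper:
  "\<exists>C>0. \<forall>T N n u r. 1 \<le> T \<longrightarrow> T \<le> N \<longrightarrow> N \<le> n \<longrightarrow> 0 < u \<longrightarrow> 0 < r \<longrightarrow>
    0 < path_mean T (\<lambda>w. of_bool (u \<le> visits 0 0 w)) \<longrightarrow>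
    path_mean n (\<lambda>w. of_bool (\<forall>x\<in>lattice_ball r \<inter> lattice_line a b. visits x 0 w < u)) \<le>
    C * sqrt (real T / real N) / path_mean T (\<lambda>w. of_bool (u \<le> visits 0 0 w)) + real N / r\<^sup>2"
proof -
  obtain C where C: "C > 0" "\<And>T N u. 1 \<le> T \<Longrightarrow> T \<le> N \<Longrightarrow>
    path_mean T (\<lambda>w. of_bool (u \<le> visits 0 0 w)) * miss u N \<le> C * sqrt (real T / real N)"
    using miss_line_upper by blast
  have "path_mean n (\<lambda>w. of_bool (\<forall>x\<in>lattice_ball r \<inter> lattice_line a b. visits x 0 w < u)) \<le>
      C * sqrt (real T / real N) / p + real N / r\<^sup>2"
    if h: "1 \<le> T" "T \<le> N" "N \<le> n" "0 < u" "0 < r" "p = path_mean T (\<lambda>w. of_bool (u \<le> visits 0 0 w))" "0 < p"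
    for T N n u r p
  proof -
    let ?A = "lattice_ball r \<inter> lattice_line a b"
    have "path_mean n (\<lambda>w. of_bool (\<forall>x\<in>?A. visits x 0 w < u)) =
        path_mean N (\<lambda>w. path_mean (n - N) (\<lambda>w'. of_bool (\<forall>x\<in>?A. visits x 0 (w @ w') < u)))"
      using h(3) path_mean_append[of N "n - N" "\<lambda>w. of_bool (\<forall>x\<in>?A. visits x 0 w < u)"] by simp
    also have "\<dots> \<le> path_mean N (\<lambda>w. path_mean (n - N) (\<lambda>w'. of_bool (\<forall>x\<in>?A. visits x 0 w < u)))"
      by (intro path_mean_mono) (auto simp: visits_append intro: add_lessD1)
    also have "\<dots> = path_mean N (\<lambda>w. of_bool (\<forall>x\<in>?A. visits x 0 w < u))" by simp
    also have "\<dots> \<le> path_mean N (\<lambda>w. of_bool (\<forall>x\<in>lattice_line a b. visits x 0 w < u) + of_bool (exits r 0 w))"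
    proof (rule path_mean_mono)
      fix w
      have "\<forall>x\<in>lattice_line a b. visits x 0 w < u" if "\<forall>x\<in>?A. visits x 0 w < u" "\<not> exits r 0 w"
      proof
        fix x assume x: "x \<in> lattice_line a b"
        show "visits x 0 w < u"
        proof (cases "visits x 0 w > 0")
          case True
          from visited_in_ball[OF this that(2)] that(1) x show ?thesis by blast
        next
          case False
          with h(4) show ?thesis by simp
        qed
      qed
      then show "of_bool (\<forall>x\<in>?A. visits x 0 w < u) \<le>
        (of_bool (\<forall>x\<in>lattice_line a b. visits x 0 w < u) + of_bool (exits r 0 w) :: real)"
        by auto
    qed
    also have "\<dots> = miss u N + path_mean N (\<lambda>w. of_bool (exits r 0 w))"
      by (simp add: path_mean_add miss_def)
    also have "\<dots> \<le> C * sqrt (real T / real N) / p + real N / r\<^sup>2"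
    proof (rule add_mono)
      show "miss u N \<le> C * sqrt (real T / real N) / p"
        using C(2)[OF h(1,2), of u] h(6,7) by (simp add: field_simps)
      show "path_mean N (\<lambda>w. of_bool (exits r 0 w)) \<le> real N / r\<^sup>2"
        using exit_prob[OF h(5), of N 0] by simp
    qed
    finally show ?thesis .
  qed
  then show ?thesis using C(1) by (intro exI[of _ C]) auto
qed

lemma card_line_ball:
  assumes "R \<ge> 0"
  shows "finite (lattice_ball R \<inter> lattice_line a b)"
    and "real (card (lattice_ball R \<inter> lattice_line a b)) \<le> 2 * R + 1"
proof -
  let ?A = "lattice_ball R \<inter> lattice_line a b"
  obtain f :: "int \<times> int \<Rightarrow> int" where f: "f = fst \<or> f = snd" "inj_on f (lattice_line a b)"
  proof (cases "a = 0")
    case True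
    with nz have "inj_on fst (lattice_line a b)" by (auto simp: inj_on_def lattice_line_iff prod_eq_iff)
    with that show ?thesis by blast
  next
    case False
    have "inj_on snd (lattice_line a b)"
    proof (rule inj_onI)
      fix x y assume "x \<in> lattice_line a b" "y \<in> lattice_line a b" "snd x = snd y"
      then have "a * fst x = a * fst y" unfolding lattice_line_iff by (metis add_right_cancel)
      with False \<open>snd x = snd y\<close> show "x = y" by (simp add: prod_eq_iff)
    qed
    with that show ?thesis by blast
  qed
  have inj: "inj_on f ?A" using f(2) by (rule inj_on_subset) auto
  have sub: "f ` ?A \<subseteq> {- \<lfloor>R\<rfloor>..\<lfloor>R\<rfloor>}"
  proof safe
    fix x :: int and y :: int
    assume "(x, y) \<in> lattice_ball R"
    then have "\<bar>real_of_int x\<bar> \<le> R" "\<bar>real_of_int y\<bar> \<le> R"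
      using real_sqrt_sum_squares_ge1[of x y] real_sqrt_sum_squares_ge2[of y x]
        real_sqrt_sum_squares_ge1[of "- x" y] real_sqrt_sum_squares_ge2[of "- y" x]
      unfolding lattice_ball_iff fst_conv snd_conv of_int_minus power2_minus by linarith+
    then show "f (x, y) \<in> {- \<lfloor>R\<rfloor>..\<lfloor>R\<rfloor>}" using f(1) by auto linarith+
  qed
  show fin: "finite ?A" using finite_subset[OF sub] inj by (auto intro: finite_imageD)
  have "card ?A \<le> card {- \<lfloor>R\<rfloor>..\<lfloor>R\<rfloor>}" using card_inj_on_le[OF inj sub] by simp
  then show "real (card ?A) \<le> 2 * R + 1" using assms by simp linarith
qed

end

lemma path_mean_union_bound:
  assumes "finite A" "\<And>x. x \<in> A \<Longrightarrow> path_mean n (\<lambda>w. of_bool (P x w)) \<le> B" "real (card A) \<le> K" "B \<ge> 0"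
  shows "path_mean n (\<lambda>w. of_bool (\<exists>x\<in>A. P x w)) \<le> K * B"
proof -
  have "path_mean n (\<lambda>w. of_bool (\<exists>x\<in>A. P x w)) \<le> path_mean n (\<lambda>w. \<Sum>x\<in>A. of_bool (P x w))"
  proof (rule path_mean_mono)
    fix w
    show "of_bool (\<exists>x\<in>A. P x w) \<le> (\<Sum>x\<in>A. of_bool (P x w) :: real)"
    proof (cases "\<exists>x\<in>A. P x w")
      case True
      then obtain x where "x \<in> A" "P x w" by blast
      then show ?thesis
        using assms(1) member_le_sum[of x A "\<lambda>x. of_bool (P x w) :: real"] by (simp del: sum_of_bool_eq)
    qed (simp add: sum_nonneg del: sum_of_bool_eq)
  qed
  also have "\<dots> \<le> (\<Sum>x\<in>A. B)" unfolding path_mean_sum using assms by (intro sum_mono) auto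
  also have "\<dots> \<le> K * B" using assms by (simp add: mult_right_mono)
  finally show ?thesis .
qed

section \<open>Estimates for the maximal local time on the line\<close>

text \<open>
  The factor \<open>\<delta>\<close> keeps \<open>\<theta>\<close> away from the critical value \<open>\<pi> / ln n\<close>, so that the prefactor stays
  bounded while the exponential rate is asymptotically sharp as \<open>\<delta>\<close> tends to \<open>0\<close>.
\<close>

lemma visits_tail_uniform:
  assumes "0 < \<delta>" "\<delta> < 1" "n \<ge> 1"
  shows "path_mean n (\<lambda>w. of_bool (u \<le> real (visits x z w))) \<le>
    (1 + 2 * pi / \<delta>) * (1 + (1 - \<delta>) * pi / (1 + ln (real n))) powr (- u)"
proof -
  define l where "l = 1 + ln (real n)"
  define \<theta> where "\<theta> = (1 - \<delta>) * pi / l"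
  have l: "l \<ge> 1" using assms by (simp add: l_def)
  have \<theta>: "\<theta> \<ge> 0" using l assms by (simp add: \<theta>_def)
  have "\<theta> * (green n 0 - 1) \<le> \<theta> * (l / pi)"
    using green_0_upper[OF assms(3)] \<theta> by (intro mult_left_mono) (simp_all add: l_def)
  also have "\<dots> = 1 - \<delta>" using l by (simp add: \<theta>_def)
  finally have killed: "\<theta> * (green n 0 - 1) \<le> 1 - \<delta>" .
  have g: "green n (z - x) \<le> 2 * l"
    using green_upper[OF assms(3), of "z - x"] l by (simp add: l_def)
  have "\<theta> / (1 - \<theta> * (green n 0 - 1)) * green n (z - x) \<le> \<theta> / \<delta> * (2 * l)"
    using killed assms l \<theta> g
    by (intro mult_mono divide_left_mono mult_pos_pos) (auto simp: green_nonneg)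
  also have "\<dots> = (1 - \<delta>) * (2 * pi / \<delta>)" using l assms by (simp add: \<theta>_def)
  also have "\<dots> \<le> 1 * (2 * pi / \<delta>)" using assms by (intro mult_right_mono) auto
  finally have "1 + \<theta> / (1 - \<theta> * (green n 0 - 1)) * green n (z - x) \<le> 1 + 2 * pi / \<delta>" by simp
  then have "(1 + \<theta> / (1 - \<theta> * (green n 0 - 1)) * green n (z - x)) * (1 + \<theta>) powr (- u) \<le>
      (1 + 2 * pi / \<delta>) * (1 + \<theta>) powr (- u)"
    by (intro mult_right_mono) auto
  moreover have "\<theta> * (green n 0 - 1) < 1" using killed assms by simp
  ultimately show ?thesis
    using visits_tail[OF \<theta>, of n u x z] unfolding \<theta>_def l_def by linarith
qed

lemma line_maximum_upper:
  assumes "a \<noteq> 0 \<or> b \<noteq> 0" "R \<ge> 0" "0 < \<delta>" "\<delta> < 1" "n \<ge> 1"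
  shows "path_mean n (\<lambda>w. of_bool (\<exists>x\<in>lattice_ball R \<inter> lattice_line a b. u \<le> real (visits x 0 w))) \<le>
    (2 * R + 1) * ((1 + 2 * pi / \<delta>) * (1 + (1 - \<delta>) * pi / (1 + ln (real n))) powr (- u))"
proof (rule path_mean_union_bound)
  show "finite (lattice_ball R \<inter> lattice_line a b)"
    "real (card (lattice_ball R \<inter> lattice_line a b)) \<le> 2 * R + 1"
    using card_line_ball assms by auto
  show "path_mean n (\<lambda>w. of_bool (u \<le> real (visits x 0 w))) \<le>
    (1 + 2 * pi / \<delta>) * (1 + (1 - \<delta>) * pi / (1 + ln (real n))) powr (- u)" for x
    using assms by (intro visits_tail_uniform)
  show "0 \<le> (1 + 2 * pi / \<delta>) * (1 + (1 - \<delta>) * pi / (1 + ln (real n))) powr (- u)"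
    using assms by (intro mult_nonneg_nonneg add_nonneg_nonneg) auto
qed

text \<open>
  Two reference points are needed because of parity: one for each class of the checkerboard.
\<close>

lemma reference_point:
  assumes "x \<in> lattice_ball R" "R \<ge> 1"
  obtains x\<^sub>0 where "x\<^sub>0 \<in> {(0, 0), (1, 0)}"
    "\<And>j y. \<bar>green j (y - x) - green j (y - x\<^sub>0)\<bar> \<le> 18 + 2 * ln R"
proof -
  define x\<^sub>0 :: "int \<times> int" where "x\<^sub>0 = (if even (fst x + snd x) then (0, 0) else (1, 0))"
  define r where "r = nat \<lceil>2 * R\<rceil> + 1"
  have r: "r > 0" "2 * R + 1 \<le> real r" "real r \<le> 5 * R" using assms(2) unfolding r_def by linarith+
  have "sqrt ((real_of_int (fst x))\<^sup>2 + (real_of_int (snd x))\<^sup>2) \<le> R"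
    using assms(1) by (simp add: lattice_ball_iff)
  then have "\<bar>real_of_int (fst x)\<bar> \<le> R" "\<bar>real_of_int (snd x)\<bar> \<le> R"
    using real_sqrt_sum_squares_ge1[of "\<bar>real_of_int (fst x)\<bar>" "real_of_int (snd x)"]
      real_sqrt_sum_squares_ge2[of "\<bar>real_of_int (snd x)\<bar>" "real_of_int (fst x)"]
    unfolding power2_abs by linarith+
  then have size: "\<bar>fst x\<bar> + \<bar>snd x\<bar> + 1 \<le> int r" using r by linarith
  have "\<bar>green j (y - x) - green j (y - x\<^sub>0)\<bar> \<le> 18 + 2 * ln R" for j y
  proof -
    have d: "y - x - (y - x\<^sub>0) = x\<^sub>0 - x" by simp
    have "\<bar>green j (y - x) - green j (y - x\<^sub>0)\<bar> \<le> 10 + 2 * ln (real r)"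
    proof (rule green_difference[OF r(1)], unfold d)
      show "even (fst (x\<^sub>0 - x) + snd (x\<^sub>0 - x))" by (auto simp: x\<^sub>0_def)
      show "\<bar>fst (x\<^sub>0 - x)\<bar> + \<bar>snd (x\<^sub>0 - x)\<bar> \<le> int r"
        using size by (auto simp: x\<^sub>0_def abs_if split: if_splits)
    qed
    also have "ln (real r) \<le> ln (5 * R)" using r by (intro ln_mono) auto
    also have "\<dots> = ln 5 + ln R" using assms(2) by (simp add: ln_mult)
    also have "ln (5 :: real) \<le> 4" using ln_le_minus_one[of "5 :: real"] by simp
    finally show ?thesis by simp
  qed
  then show ?thesis by (intro that[of x\<^sub>0]) (auto simp: x\<^sub>0_def)
qed

lemma powr_minus_le_exp: fixes u y :: real assumes "0 \<le> y" "y \<le> 1 / 2" "u \<ge> 0" shows "(1 + y) powr (- u) \<le> exp (- (u * y / 2))"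
proof -
  have "y * y \<le> 1 / 2 * y" using assms by (intro mult_right_mono) auto
  then have "y / 2 \<le> ln (1 + y)" using ln_one_plus_pos_lower_bound[of y] assms by (simp add: power2_eq_square)
  then have "u * (y / 2) \<le> u * ln (1 + y)" using assms by (intro mult_left_mono)
  then show ?thesis using assms by (simp add: powr_def)
qed

lemma ln_one_minus_lower: assumes "0 \<le> y" "y \<le> 1 / 2" shows "- (2 * y) \<le> ln (1 - (y :: real))"
proof -
  have "y * y \<le> 1 / 2 * y" using assms by (intro mult_right_mono) auto
  then show ?thesis using ln_one_minus_pos_lower_bound[of y] assms by (simp add: power2_eq_square)
qed

text \<open>
  The first summand bounds the probability that one of the two reference points is visited at
  least \<open>K\<close> times, the second one sums the two-point tail over the points of the line.
\<close>

lemma line_maximum_upper_small_ball: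
  assumes nz: "a \<noteq> 0 \<or> b \<noteq> 0" and R: "R \<ge> 1" and n: "n \<ge> 1" "3 \<le> ln (real n)" and uK: "K \<ge> 0" "u > K"
  defines "D \<equiv> 18 + 2 * ln R"
  shows "path_mean n (\<lambda>w. of_bool (\<exists>x\<in>lattice_ball R \<inter> lattice_line a b. u \<le> real (visits x 0 w))) \<le>
    2 * ((1 + 4 * pi) * exp (- (K * (pi / 2 / (1 + ln (real n))) / 2))) +
    (2 * R + 1) * (6 * D * exp (2 * K / D - u / (6 * D)))"
proof -
  let ?A = "lattice_ball R \<inter> lattice_line a b"
  let ?B1 = "(1 + 4 * pi) * exp (- (K * (pi / 2 / (1 + ln (real n))) / 2))"
  let ?B2 = "6 * D * exp (2 * K / D - u / (6 * D))"
  have D: "D \<ge> 18" using R by (simp add: D_def)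
  have often: "path_mean n (\<lambda>w. of_bool (K \<le> real (visits x 0 w))) \<le> ?B1" for x
  proof -
    have "path_mean n (\<lambda>w. of_bool (K \<le> real (visits x 0 w))) \<le>
        (1 + 4 * pi) * (1 + pi / 2 / (1 + ln (real n))) powr (- K)"
      using visits_tail_uniform[of "1 / 2" n K x 0] n by simp
    also have "\<dots> \<le> ?B1"
    proof (intro mult_left_mono powr_minus_le_exp)
      show "pi / 2 / (1 + ln (real n)) \<le> 1 / 2" using n pi_less_4 by (simp add: field_simps)
    qed (use n uK in auto)
    finally show ?thesis .
  qed
  have tail: "path_mean n (\<lambda>w. of_bool (u \<le> real (visits x 0 w) \<and> real (visits (0, 0) 0 w) \<le> K \<and> real (visits (1, 0) 0 w) \<le> K)) \<le> ?B2"
    if x: "x \<in> ?A" for x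
  proof -
    obtain x\<^sub>0 where x\<^sub>0: "x\<^sub>0 \<in> {(0, 0), (1, 0)}"
      "\<And>j y. \<bar>green j (y - x) - green j (y - x\<^sub>0)\<bar> \<le> D"
      using reference_point[of x R] x R unfolding D_def by blast
    have "path_mean n (\<lambda>w. of_bool (u \<le> real (visits x 0 w) \<and> real (visits (0, 0) 0 w) \<le> K \<and> real (visits (1, 0) 0 w) \<le> K)) \<le>
        path_mean n (\<lambda>w. of_bool (u \<le> real (visits x 0 w) \<and> real (visits x\<^sub>0 0 w) \<le> K))"
      using x\<^sub>0(1) by (intro path_mean_of_bool_mono) auto
    also have "\<dots> \<le> ?B2"
    proof (cases "x = x\<^sub>0")
      case True
      then have "\<not> (u \<le> real (visits x 0 w) \<and> real (visits x\<^sub>0 0 w) \<le> K)" for w using uK by auto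
      then have "path_mean n (\<lambda>w. of_bool (u \<le> real (visits x 0 w) \<and> real (visits x\<^sub>0 0 w) \<le> K)) =
          path_mean n (\<lambda>_. 0)"
        by (intro path_mean_cong) simp
      then show ?thesis using D by simp
    next
      case False
      have "path_mean n (\<lambda>w. of_bool (u \<le> real (visits x 0 w) \<and> real (visits x\<^sub>0 0 w) \<le> K)) \<le>
        6 * D * ((1 + 1 / (3 * D)) powr (- u) * (1 - 1 / D) powr (- K))"
        using D by (intro two_point_tail x\<^sub>0(2) False) auto
      also have "\<dots> \<le> 6 * D * (exp (- (u * (1 / (3 * D)) / 2)) * exp (2 * K / D))"
      proof (intro mult_left_mono mult_mono powr_minus_le_exp)
        have "- (2 * (1 / D)) \<le> ln (1 - 1 / D)" using D by (intro ln_one_minus_lower) auto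
        then have "- K * ln (1 - 1 / D) \<le> - K * (- (2 * (1 / D)))"
          using uK by (intro mult_left_mono_neg) auto
        then show "(1 - 1 / D) powr (- K) \<le> exp (2 * K / D)"
          using D by (simp add: powr_def mult.commute[of 2 K])
      qed (use D uK in auto)
      also have "exp (- (u * (1 / (3 * D)) / 2)) * exp (2 * K / D) = exp (2 * K / D - u / (6 * D))"
        by (simp flip: exp_add)
      finally show ?thesis .
    qed
    finally show ?thesis .
  qed
  have "path_mean n (\<lambda>w. of_bool (\<exists>x\<in>?A. u \<le> real (visits x 0 w))) \<le>
      path_mean n (\<lambda>w. (of_bool (K \<le> real (visits (0, 0) 0 w)) + of_bool (K \<le> real (visits (1, 0) 0 w))) +
        of_bool (\<exists>x\<in>?A. u \<le> real (visits x 0 w) \<and> real (visits (0, 0) 0 w) \<le> K \<and> real (visits (1, 0) 0 w) \<le> K))"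
    by (rule path_mean_mono) (auto simp: of_bool_def)
  also have "\<dots> \<le> (?B1 + ?B1) + (2 * R + 1) * ?B2"
    unfolding path_mean_add using card_line_ball[OF nz, of R] R D
    by (intro add_mono often path_mean_union_bound tail) auto
  finally show ?thesis by simp
qed

text \<open>
  The probability of success of a trial is at least \<open>R\<close> to the power \<open>- 1 / 2 + \<eta> / 4\<close>, gained by lowering the
  target by the factor \<open>1 - \<eta>\<close>; of this gain, \<open>\<eta> / 8\<close> is spent on the condition that the walk stays in
  the ball, for which it is stopped at time \<open>R\<close> to the power \<open>2 - \<eta> / 4\<close>.
\<close>

lemma line_maximum_lower:
  assumes nz: "a \<noteq> 0 \<or> b \<noteq> 0" and \<eta>: "0 < \<eta>" "\<eta> < 1"
  shows "\<exists>C>0. \<forall>\<^sub>F R in at_top. \<forall>n. R\<^sup>2 \<le> real n \<longrightarrow>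
    path_mean n (\<lambda>w. of_bool (\<forall>x\<in>lattice_ball R \<inter> lattice_line a b.
      real (visits x 0 w) < (1 - \<eta>) * (ln R)\<^sup>2 / (2 * pi))) \<le> C * R powr (- (\<eta> / 8))"
proof -
  obtain C where C: "C > 0" "\<And>T N n u r. 1 \<le> T \<Longrightarrow> T \<le> N \<Longrightarrow> N \<le> n \<Longrightarrow> 0 < u \<Longrightarrow> 0 < r \<Longrightarrow>
    0 < path_mean T (\<lambda>w. of_bool (u \<le> visits 0 0 w)) \<Longrightarrow>
    path_mean n (\<lambda>w. of_bool (\<forall>x\<in>lattice_ball r \<inter> lattice_line a b. visits x 0 w < u)) \<le>
    C * sqrt (real T / real N) / path_mean T (\<lambda>w. of_bool (u \<le> visits 0 0 w)) + real N / r\<^sup>2"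
    using miss_in_ball_upper[OF nz] by blast
  \<comment> \<open>With \<open>l = ln R\<close>, the number \<open>x l\<close> bounds the probability of no return to the origin within time
    \<open>R / l\<^sup>3\<close>, and \<open>v l\<close> is the target number of visits; about \<open>v l\<close> periods of that length fit into
    time \<open>R\<close>.\<close>
  define x where "x = (\<lambda>l :: real. pi / (l - ln (2 * l ^ 3)))"
  define v where "v = (\<lambda>l :: real. (1 - \<eta>) * l\<^sup>2 / (2 * pi))"
  have ev_x: "\<forall>\<^sub>F l in at_top. 0 < l - ln (2 * l ^ 3) \<and> x l \<le> 1 / 2"
  proof -
    have "\<forall>\<^sub>F l :: real in at_top. 0 < l - ln (2 * l ^ 3)" by real_asymp
    moreover have "(x \<longlongrightarrow> 0) at_top" unfolding x_def by real_asymp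
    then have "\<forall>\<^sub>F l in at_top. x l < 1 / 2" by (rule order_tendstoD(2)) simp
    ultimately show ?thesis by eventually_elim simp
  qed
  have ev_cost: "\<forall>\<^sub>F l in at_top. (v l + 1) * (x l + 2 * (x l)\<^sup>2) \<le> (1 / 2 - \<eta> / 4) * l"
  proof -
    have "((\<lambda>l. (v l + 1) * (x l + 2 * (x l)\<^sup>2) / l) \<longlongrightarrow> (1 - \<eta>) / 2) at_top"
      unfolding v_def x_def using \<eta> by real_asymp
    from order_tendstoD(2)[OF this, of "1 / 2 - \<eta> / 4"] \<eta>
    have "\<forall>\<^sub>F l in at_top. (v l + 1) * (x l + 2 * (x l)\<^sup>2) / l < 1 / 2 - \<eta> / 4" by simp
    with eventually_gt_at_top[of 0] show ?thesis
      by eventually_elim (simp add: field_simps)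
  qed
  have ev_R: "\<forall>\<^sub>F R in at_top. R + 2 \<le> R powr (2 - \<eta> / 4) \<and> 4 \<le> R \<and> 2 \<le> ln R"
  proof -
    have "\<forall>\<^sub>F R in at_top. R + 2 \<le> R powr (2 - \<eta> / 4)" using \<eta> by real_asymp
    moreover have "\<forall>\<^sub>F R :: real in at_top. 2 \<le> ln R" by real_asymp
    ultimately show ?thesis using eventually_ge_at_top[of 4] by eventually_elim auto
  qed
  have ev_ln: "filterlim (ln :: real \<Rightarrow> real) at_top at_top" by (rule ln_at_top)
  have "\<forall>\<^sub>F R in at_top. \<forall>n. R\<^sup>2 \<le> real n \<longrightarrow>
    path_mean n (\<lambda>w. of_bool (\<forall>x\<in>lattice_ball R \<inter> lattice_line a b.
      real (visits x 0 w) < v (ln R))) \<le> (2 * C + 1) * R powr (- (\<eta> / 8))"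
    using ev_R ev_ln[THEN filterlim_iff[THEN iffD1], rule_format, OF ev_x]
      ev_ln[THEN filterlim_iff[THEN iffD1], rule_format, OF ev_cost]
  proof eventually_elim
    case (elim R)
    define l where "l = ln R"
    define u where "u = nat \<lceil>v l\<rceil>"
    define s where "s = nat \<lfloor>R / l ^ 3\<rfloor>"
    define T where "T = nat \<lfloor>R\<rfloor>"
    define N where "N = nat \<lfloor>R powr (2 - \<eta> / 4)\<rfloor>"
    define p where "p = path_mean T (\<lambda>w. of_bool (u \<le> visits 0 0 w))"
    have R: "R \<ge> 4" "R = exp l" and l: "l \<ge> 2" using elim by (auto simp: l_def)
    have xl: "0 < l - ln (2 * l ^ 3)" "x l \<le> 1 / 2" using elim by (auto simp: l_def)
    have v: "0 < v l" "v l \<le> l\<^sup>2"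
    proof -
      show "0 < v l" using \<eta> l by (simp add: v_def)
      have "(1 - \<eta>) * l\<^sup>2 \<le> (2 * pi) * l\<^sup>2" using \<eta> pi_gt3 by (intro mult_right_mono) auto
      then show "v l \<le> l\<^sup>2" by (simp add: v_def field_simps)
    qed
    have u: "0 < u" "v l \<le> real u" "real u \<le> v l + 1" using v unfolding u_def by linarith+
    have us: "u * s \<le> T"
    proof -
      have "l\<^sup>2 + 1 \<le> 2 * l\<^sup>2" using power_mono[of 2 l 2] l by simp
      also have "\<dots> \<le> l * l\<^sup>2" using l by (intro mult_right_mono) auto
      finally have cube: "l\<^sup>2 + 1 \<le> l ^ 3" by (simp add: power3_eq_cube power2_eq_square)
      have "real u * real s \<le> l ^ 3 * (R / l ^ 3)"
        using u v cube R l by (intro mult_mono) (auto simp: s_def)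
      then have "real (u * s) \<le> R" using l by simp
      then show ?thesis unfolding T_def by linarith
    qed
    have xg: "1 / green s 0 \<le> x l"
    proof -
      have "ln (R / (2 * l ^ 3)) \<le> ln ((real s + 1) / 2)"
      proof (intro ln_mono)
        have "R / l ^ 3 \<le> real s + 1" unfolding s_def using R l by linarith
        then show "R / (2 * l ^ 3) \<le> (real s + 1) / 2" by (simp add: field_simps)
      qed (use R l in auto)
      moreover have "ln (R / (2 * l ^ 3)) = l - ln (2 * l ^ 3)"
        using R l by (simp add: ln_div)
      ultimately have "(l - ln (2 * l ^ 3)) / pi \<le> green s 0"
        using green_0_lower[of s] by (metis divide_right_mono order.trans pi_ge_zero)
      then have "1 / green s 0 \<le> 1 / ((l - ln (2 * l ^ 3)) / pi)"
        using xl green_0_ge_1[of s] by (intro divide_left_mono mult_pos_pos divide_pos_pos) auto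
      then show ?thesis by (simp add: x_def)
    qed
    have x0: "x l \<ge> 0" using xl by (simp add: x_def)
    have p_lower: "R powr (- (1 / 2 - \<eta> / 4)) \<le> p"
    proof -
      have "- (1 / 2 - \<eta> / 4) * l \<le> - ((v l + 1) * (x l + 2 * (x l)\<^sup>2))"
        using elim(3) unfolding l_def mult_minus_left neg_le_iff_le .
      also have "\<dots> \<le> real u * (- x l - 2 * (x l)\<^sup>2)"
        using u x0 mult_right_mono[of "real u" "v l + 1" "x l + 2 * (x l)\<^sup>2"] by (simp add: algebra_simps)
      also have "\<dots> \<le> real u * ln (1 - x l)"
        using xl x0 by (intro mult_left_mono ln_one_minus_pos_lower_bound) auto
      finally have "R powr (- (1 / 2 - \<eta> / 4)) \<le> exp (real u * ln (1 - x l))"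
        using R by (simp add: powr_def)
      also have "\<dots> = (1 - x l) ^ u"
        using xl by (simp add: exp_of_nat_mult)
      also have "\<dots> \<le> (1 - 1 / green s 0) ^ u"
        using xg xl by (intro power_mono) auto
      also have "\<dots> \<le> path_mean (u * s) (\<lambda>w. of_bool (u \<le> visits 0 0 w))"
        by (rule many_returns_lower)
      also have "\<dots> \<le> p"
        unfolding p_def using us by (rule path_mean_visits_mono)
      finally show ?thesis .
    qed
    have p: "p > 0" using p_lower R by (auto intro: less_le_trans[rotated])
    have N: "T \<le> N" "1 \<le> T" "R powr (2 - \<eta> / 4) / 2 \<le> real N" "real N \<le> R powr (2 - \<eta> / 4)"
      using elim R unfolding T_def N_def by linarith+
    have T: "real T \<le> R" using R by (simp add: T_def)
    show ?case
    proof (intro allI impI)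
      fix n :: nat assume n: "R\<^sup>2 \<le> real n"
      have "R powr (2 - \<eta> / 4) \<le> R powr 2" using R(1) \<eta> by (intro powr_mono) auto
      then have "N \<le> n" using N n R by (simp add: powr_numeral)
      have "path_mean n (\<lambda>w. of_bool (\<forall>x\<in>lattice_ball R \<inter> lattice_line a b. real (visits x 0 w) < v (ln R))) \<le>
        path_mean n (\<lambda>w. of_bool (\<forall>x\<in>lattice_ball R \<inter> lattice_line a b. visits x 0 w < u))"
        using u by (intro path_mean_of_bool_mono) (force simp: l_def)
      also have "\<dots> \<le> C * sqrt (real T / real N) / p + real N / R\<^sup>2"
        unfolding p_def using N \<open>N \<le> n\<close> u R p by (intro C(2)) (auto simp: p_def)
      also have "\<dots> \<le> 2 * C * R powr (- (\<eta> / 8)) + R powr (- (\<eta> / 8))"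
      proof (rule add_mono)
        have "real T / real N \<le> R / (R powr (2 - \<eta> / 4) / 2)"
          using T N R by (intro frac_le) auto
        also have "\<dots> = 2 * R powr (1 - (2 - \<eta> / 4))"
          using R by (simp only: powr_diff) (simp add: powr_one)
        also have "\<dots> \<le> (2 * R powr (- 1 / 2 + \<eta> / 8))\<^sup>2"
        proof -
          have "(R powr (- 1 / 2 + \<eta> / 8))\<^sup>2 = R powr (1 - (2 - \<eta> / 4))"
            using R by (simp add: power2_eq_square flip: powr_add)
          then show ?thesis by (simp add: power_mult_distrib)
        qed
        finally have "sqrt (real T / real N) \<le> 2 * R powr (- 1 / 2 + \<eta> / 8)"
          by (intro real_le_lsqrt) auto
        then have "C * sqrt (real T / real N) / p \<le>
            C * (2 * R powr (- 1 / 2 + \<eta> / 8)) / R powr (- (1 / 2 - \<eta> / 4))"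
          using C(1) p_lower R by (intro frac_le mult_left_mono) auto
        also have "\<dots> = 2 * C * R powr ((- 1 / 2 + \<eta> / 8) - (- (1 / 2 - \<eta> / 4)))"
          by (simp only: powr_diff) simp
        also have "(- 1 / 2 + \<eta> / 8) - (- (1 / 2 - \<eta> / 4)) = - (\<eta> / 8)" by simp
        finally show "C * sqrt (real T / real N) / p \<le> 2 * C * R powr (- (\<eta> / 8))" .
        have "real N / R\<^sup>2 \<le> R powr (2 - \<eta> / 4) / R powr 2"
          using N R by (simp add: powr_numeral divide_right_mono)
        also have "\<dots> = R powr (- (\<eta> / 4))" by (simp flip: powr_diff)
        also have "\<dots> \<le> R powr (- (\<eta> / 8))" using R(1) \<eta> by (intro powr_mono) auto
        finally show "real N / R\<^sup>2 \<le> R powr (- (\<eta> / 8))" .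
      qed
      finally show "path_mean n (\<lambda>w. of_bool (\<forall>x\<in>lattice_ball R \<inter> lattice_line a b. real (visits x 0 w) < v (ln R))) \<le>
        (2 * C + 1) * R powr (- (\<eta> / 8))" by (simp add: algebra_simps)
    qed
  qed
  then show ?thesis unfolding v_def using C(1) by (intro exI[of _ "2 * C + 1"]) auto
qed

lemma summable_exp_powr:
  fixes c \<gamma> :: real
  assumes "c > 0" "\<gamma> > 0"
  shows "summable (\<lambda>k. exp (- (c * real k powr \<gamma>)))"
proof (rule summable_comparison_test_ev)
  show "\<forall>\<^sub>F k in sequentially. norm (exp (- (c * real k powr \<gamma>))) \<le> 1 / (real k)\<^sup>2"
  proof -
    have "\<forall>\<^sub>F k in sequentially. exp (- (c * real k powr \<gamma>)) \<le> 1 / (real k)\<^sup>2"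
      using assms by real_asymp
    then show ?thesis by simp
  qed
  show "summable (\<lambda>k. 1 / (real k)\<^sup>2)"
    using inverse_power_summable[of 2, where ?'a = real] by (simp add: inverse_eq_divide)
qed

section \<open>From path averages to almost sure statements\<close>

text \<open>
  Unfolding the recursion into a sum over lists identifies the average with a probability, since
  each list of \<open>n\<close> unit steps has probability \<open>1 / 4 ^ n\<close> (\<open>prob_steps\<close>).
\<close>

lemma path_mean_eq_sum:
  "path_mean n F = (\<Sum>w | length w = n \<and> set w \<subseteq> unit_steps. F w) / 4 ^ n"
proof (induction n arbitrary: F)
  case (Suc n)
  let ?W = "\<lambda>n. {w. length w = n \<and> set w \<subseteq> unit_steps}"
  have W: "?W (Suc n) = (\<lambda>(e, w). e # w) ` (unit_steps \<times> ?W n)"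
    by (auto simp: length_Suc_conv image_iff)
  have "(\<Sum>w\<in>?W (Suc n). F w) = (\<Sum>(e, w)\<in>unit_steps \<times> ?W n. F (e # w))"
    unfolding W by (subst sum.reindex) (auto simp: inj_on_def case_prod_unfold)
  also have "\<dots> = (\<Sum>e\<in>unit_steps. \<Sum>w\<in>?W n. F (e # w))"
    by (simp add: sum.cartesian_product)
  finally show ?case
    by (simp add: Suc step_mean_def sum_divide_distrib mult.commute)
qed (simp add: Collect_conv_if cong: conj_cong)

lemma le_max_local_time_iff:
  assumes "A \<noteq> {}"
  shows "u \<le> max_local_time X A n \<omega> \<longleftrightarrow> (\<exists>x\<in>A. u \<le> local_time X x n \<omega>)"
proof -
  have "local_time X x n \<omega> \<in> {..n}" for x
  proof -
    have "{k. 0 < k \<and> k \<le> n \<and> walk X k \<omega> = x} \<subseteq> {1..n}" by auto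
    from card_mono[OF _ this] show ?thesis by (simp add: local_time_def)
  qed
  then have "finite ((\<lambda>x. local_time X x n \<omega>) ` A)"
    by (intro finite_subset[OF image_subsetI finite_atMost])
  then show ?thesis unfolding max_local_time_def using assms by (subst Max_ge_iff) auto
qed

lemma local_time_mono: "m \<le> n \<Longrightarrow> local_time X x m \<omega> \<le> local_time X x n \<omega>"
  unfolding local_time_def by (rule card_mono[OF finite_subset[of _ "{1..n}"]]) auto

lemma origin_in_ball_line: "r \<ge> 0 \<Longrightarrow> (0, 0) \<in> lattice_ball r \<inter> lattice_line a b"
  by (simp add: lattice_ball_def lattice_line_def norm_Pair)

lemma lattice_ball_mono: "r \<le> r' \<Longrightarrow> lattice_ball r \<subseteq> lattice_ball r'"
  by (auto simp: lattice_ball_iff)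

lemma eventually_dyadic:
  assumes "\<forall>\<^sub>F k in sequentially. \<forall>n. 2 ^ k \<le> n \<and> n \<le> 2 ^ Suc k \<longrightarrow> P n"
  shows "\<forall>\<^sub>F n :: nat in sequentially. P n"
proof -
  obtain k\<^sub>0 where k\<^sub>0: "\<And>k n. k \<ge> k\<^sub>0 \<Longrightarrow> 2 ^ k \<le> n \<Longrightarrow> n \<le> 2 ^ Suc k \<Longrightarrow> P n"
    using assms unfolding eventually_sequentially by blast
  have "P n" if "2 ^ k\<^sub>0 \<le> n" for n
  proof -
    have "n \<ge> 1" using that by (metis one_le_numeral one_le_power order.trans)
    then obtain k where k: "2 ^ k \<le> n" "n < 2 ^ (k + 1)" using ex_power_ivl1[of 2 n] by auto
    have "(2 :: nat) ^ k\<^sub>0 < 2 ^ (k + 1)" using that k by linarith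
    then have "k\<^sub>0 \<le> k" by (subst (asm) power_strict_increasing_iff) auto
    with k show ?thesis by (intro k\<^sub>0[of k]) auto
  qed
  then show ?thesis unfolding eventually_sequentially by blast
qed

context simple_random_walk_Z2
begin

definition steps_upto :: "nat \<Rightarrow> 'a \<Rightarrow> (int \<times> int) list" where
  "steps_upto n \<omega> = map (\<lambda>k. X k \<omega>) [1..<Suc n]"

lemma steps_upto_Suc: "steps_upto (Suc n) \<omega> = steps_upto n \<omega> @ [X (Suc n) \<omega>]"
  by (simp add: steps_upto_def)

lemma sum_list_steps_upto: "sum_list (steps_upto n \<omega>) = walk X n \<omega>"
  by (induction n) (simp_all add: steps_upto_Suc walk_def, simp add: steps_upto_def)

lemma local_time_eq_visits: "local_time X x n \<omega> = visits x 0 (steps_upto n \<omega>)"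
proof (induction n)
  case 0
  have "{k :: nat. 0 < k \<and> k \<le> 0 \<and> walk X k \<omega> = x} = {}" by auto
  then show ?case by (simp only: local_time_def) (simp add: steps_upto_def)
next
  case (Suc n)
  have "{k. 0 < k \<and> k \<le> Suc n \<and> walk X k \<omega> = x} =
    {k. 0 < k \<and> k \<le> n \<and> walk X k \<omega> = x} \<union> (if walk X (Suc n) \<omega> = x then {Suc n} else {})"
    by (auto simp: le_Suc_eq)
  then have "local_time X x (Suc n) \<omega> = local_time X x n \<omega> + of_bool (walk X (Suc n) \<omega> = x)"
    unfolding local_time_def by (simp add: card_Un_disjoint)
  moreover have "walk X (Suc n) \<omega> = walk X n \<omega> + X (Suc n) \<omega>" by (simp add: walk_def)
  ultimately show ?case using Suc by (simp add: steps_upto_Suc visits_append sum_list_steps_upto)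
qed

lemma step_measurable: "k \<ge> 1 \<Longrightarrow> X k \<in> measurable M (count_space UNIV)"
  using indep_steps by (auto simp: indep_vars_def)

lemma steps_upto_eq_iff:
  "steps_upto n \<omega> = w \<longleftrightarrow> length w = n \<and> (\<forall>k\<in>{1..n}. X k \<omega> = w ! (k - 1))"
proof -
  have "(\<forall>k\<in>{1..n}. X k \<omega> = w ! (k - 1)) \<longleftrightarrow> (\<forall>i<n. X (Suc i) \<omega> = w ! i)"
    by (subst image_Suc_lessThan[symmetric]) auto
  then show ?thesis by (auto simp: steps_upto_def list_eq_iff_nth_eq simp del: upt_Suc)
qed

lemma steps_event: "{\<omega> \<in> space M. steps_upto n \<omega> = w} \<in> events"
proof (cases "length w = n")
  case True
  have "{\<omega> \<in> space M. steps_upto n \<omega> = w} = {\<omega> \<in> space M. \<forall>k\<in>{1..n}. X k \<omega> = w ! (k - 1)}"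
    using True by (auto simp: steps_upto_eq_iff)
  also have "\<dots> \<in> events"
  proof (rule sets.sets_Collect_finite_All)
    fix k assume "k \<in> {1..n}"
    then have "X k -` {w ! (k - 1)} \<inter> space M \<in> events"
      by (intro measurable_sets[OF step_measurable]) auto
    then show "{\<omega> \<in> space M. X k \<omega> = w ! (k - 1)} \<in> events"
      by (simp add: vimage_def Int_def conj_commute)
  qed simp
  finally show ?thesis .
next
  case False
  then have "{\<omega> \<in> space M. steps_upto n \<omega> = w} = {}" by (auto simp: steps_upto_def)
  then show ?thesis by (simp only: sets.empty_sets)
qed

lemma path_event: "{\<omega> \<in> space M. Q (steps_upto n \<omega>)} \<in> events"
proof -
  have "{\<omega> \<in> space M. Q (steps_upto n \<omega>)} = (\<Union>w\<in>{w. Q w}. {\<omega> \<in> space M. steps_upto n \<omega> = w})"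
    by auto
  also have "\<dots> \<in> events" by (intro sets.countable_UN'' steps_event) auto
  finally show ?thesis .
qed

lemma prob_steps:
  assumes "length w = n" "set w \<subseteq> unit_steps"
  shows "prob {\<omega> \<in> space M. steps_upto n \<omega> = w} = 1 / 4 ^ n"
proof (cases "n = 0")
  case True
  then show ?thesis using assms by (simp add: steps_upto_def prob_space)
next
  case False
  have "{\<omega> \<in> space M. steps_upto n \<omega> = w} = (\<Inter>k\<in>{1..n}. X k -` {w ! (k - 1)} \<inter> space M)"
    using assms(1) False by (auto simp: steps_upto_eq_iff)
  also have "prob \<dots> = (\<Prod>k\<in>{1..n}. prob (X k -` {w ! (k - 1)} \<inter> space M))"
    using False by (intro indep_varsD[OF indep_steps]) auto
  also have "\<dots> = (\<Prod>k\<in>{1..n}. 1 / 4)"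
  proof (rule prod.cong)
    fix k assume k: "k \<in> {1..n}"
    then have "w ! (k - 1) \<in> set w" using assms(1) by (intro nth_mem) auto
    then have "w ! (k - 1) \<in> {(1, 0), (-1, 0), (0, 1), (0, -1)}"
      using assms(2) by (auto simp: unit_steps_def)
    moreover have "X k -` {w ! (k - 1)} \<inter> space M = {\<omega> \<in> space M. X k \<omega> = w ! (k - 1)}" by auto
    ultimately show "prob (X k -` {w ! (k - 1)} \<inter> space M) = 1 / 4" using step_prob[of k] k by simp
  qed simp
  finally show ?thesis by (simp add: power_divide)
qed

text \<open>
  The steps are only assumed to take each of the four unit vectors with probability \<open>1 / 4\<close>; they
  are unit steps almost surely because these probabilities add up to \<open>1\<close>.
\<close>

lemma prob_path: "prob {\<omega> \<in> space M. Q (steps_upto n \<omega>)} = path_mean n (\<lambda>w. of_bool (Q w))"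
proof -
  let ?W = "{w. length w = n \<and> set w \<subseteq> unit_steps}"
  have fin: "finite ?W"
    using finite_lists_length_eq[of unit_steps n] by (simp add: unit_steps_def conj_commute)
  have count: "prob {\<omega> \<in> space M. steps_upto n \<omega> \<in> V} = real (card V) / 4 ^ n" if "V \<subseteq> ?W" for V
  proof -
    have finV: "finite V" using fin that by (rule rev_finite_subset)
    have "{\<omega> \<in> space M. steps_upto n \<omega> \<in> V} = (\<Union>w\<in>V. {\<omega> \<in> space M. steps_upto n \<omega> = w})" by auto
    also have "prob \<dots> = (\<Sum>w\<in>V. prob {\<omega> \<in> space M. steps_upto n \<omega> = w})"
      using finV by (intro finite_measure_finite_Union) (auto simp: steps_event disjoint_family_on_def)
    also have "\<dots> = (\<Sum>w\<in>V. 1 / 4 ^ n)" using that by (intro sum.cong refl prob_steps) auto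
    finally show ?thesis by simp
  qed
  have "path_mean n (\<lambda>_. 1) = real (card ?W) / 4 ^ n" by (simp only: path_mean_eq_sum) simp
  then have "prob {\<omega> \<in> space M. steps_upto n \<omega> \<in> ?W} = 1" using count[of ?W] by simp
  then have "AE \<omega> in M. \<omega> \<in> {\<omega> \<in> space M. steps_upto n \<omega> \<in> ?W}"
    using path_event by (subst (asm) prob_eq_1) auto
  then have "prob {\<omega> \<in> space M. Q (steps_upto n \<omega>)} = prob {\<omega> \<in> space M. steps_upto n \<omega> \<in> ?W \<inter> Collect Q}"
    by (intro measure_eq_AE path_event) (auto elim: AE_mp)
  also have "\<dots> = real (card (?W \<inter> Collect Q)) / 4 ^ n" by (intro count) auto
  also have "real (card (?W \<inter> Collect Q)) = (\<Sum>w\<in>?W. of_bool (Q w))" using fin by simp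
  finally show ?thesis by (simp only: path_mean_eq_sum)
qed

lemma AE_eventually_not:
  assumes "summable b" "\<forall>\<^sub>F k in sequentially. path_mean (N k) (\<lambda>w. of_bool (Q k w)) \<le> b k"
  shows "AE \<omega> in M. \<forall>\<^sub>F k in sequentially. \<not> Q k (steps_upto (N k) \<omega>)"
proof -
  let ?A = "\<lambda>k. {\<omega> \<in> space M. Q k (steps_upto (N k) \<omega>)}"
  have "summable (\<lambda>k. prob (?A k))"
    using assms(2) by (intro summable_comparison_test_ev[OF _ assms(1)]) (simp add: prob_path path_mean_nonneg)
  then have "AE \<omega> in M. \<forall>\<^sub>F k in sequentially. \<omega> \<in> space M - ?A k"
    by (intro borel_cantelli_AE1 path_event) (auto simp: emeasure_eq_measure)
  then show ?thesis by (rule AE_mp) (auto intro!: AE_I2 elim: eventually_mono)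
qed

text \<open>
  Both the radius and the local times increase with \<open>n\<close>, so the maximum at \<open>n\<close> between \<open>2 ^ k\<close> and
  \<open>2 ^ (k + 1)\<close> is bounded by the one at the right end point, and below by the one at the left end
  point in the lemma that follows.
\<close>

lemma AE_max_local_time_le:
  fixes r v u :: "nat \<Rightarrow> real"
  assumes r: "\<And>m n. 1 \<le> m \<Longrightarrow> m \<le> n \<Longrightarrow> r m \<le> r n" "\<And>n. r n \<ge> 0"
    and u: "\<forall>\<^sub>F k in sequentially. \<forall>n. 2 ^ k \<le> n \<and> n \<le> 2 ^ Suc k \<longrightarrow> u k \<le> v n"
    and b: "summable b" "\<forall>\<^sub>F k in sequentially. path_mean (2 ^ Suc k) (\<lambda>w. of_bool
      (\<exists>x\<in>lattice_ball (r (2 ^ Suc k)) \<inter> lattice_line a\<^sub>1 a\<^sub>2. u k \<le> real (visits x 0 w))) \<le> b k"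
  shows "AE \<omega> in M. \<forall>\<^sub>F n in sequentially.
    real (max_local_time X (lattice_ball (r n) \<inter> lattice_line a\<^sub>1 a\<^sub>2) n \<omega>) \<le> v n"
  using AE_eventually_not[OF b]
proof (rule AE_mp, intro AE_I2 impI)
  fix \<omega>
  assume "\<forall>\<^sub>F k in sequentially. \<not> (\<exists>x\<in>lattice_ball (r (2 ^ Suc k)) \<inter> lattice_line a\<^sub>1 a\<^sub>2.
      u k \<le> real (visits x 0 (steps_upto (2 ^ Suc k) \<omega>)))"
  with u have "\<forall>\<^sub>F k in sequentially. \<forall>n. 2 ^ k \<le> n \<and> n \<le> 2 ^ Suc k \<longrightarrow>
    real (max_local_time X (lattice_ball (r n) \<inter> lattice_line a\<^sub>1 a\<^sub>2) n \<omega>) \<le> v n"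
  proof eventually_elim
    case (elim k)
    have "real (max_local_time X (lattice_ball (r n) \<inter> lattice_line a\<^sub>1 a\<^sub>2) n \<omega>) \<le> v n"
      if kn: "2 ^ k \<le> n" "n \<le> 2 ^ Suc k" for n
    proof -
      let ?A = "lattice_ball (r n) \<inter> lattice_line a\<^sub>1 a\<^sub>2"
      have n: "2 ^ k \<le> n" "n \<le> 2 ^ Suc k" "1 \<le> n"
        using kn order.trans[OF one_le_power[of 2 k] kn(1)] by auto
      have ne: "?A \<noteq> {}" using origin_in_ball_line[OF r(2)] by (metis empty_iff)
      have "\<exists>x\<in>?A. max_local_time X ?A n \<omega> \<le> local_time X x n \<omega>"
        by (rule le_max_local_time_iff[OF ne, THEN iffD1, OF order.refl])
      then obtain x where x: "x \<in> ?A" "max_local_time X ?A n \<omega> \<le> local_time X x n \<omega>"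
        by (rule bexE)
      have "x \<in> lattice_ball (r (2 ^ Suc k)) \<inter> lattice_line a\<^sub>1 a\<^sub>2"
        using x(1) lattice_ball_mono[OF r(1)[OF n(3,2)]] by blast
      then have "real (local_time X x (2 ^ Suc k) \<omega>) < u k"
        using elim by (auto simp: local_time_eq_visits not_le)
      moreover have "local_time X x n \<omega> \<le> local_time X x (2 ^ Suc k) \<omega>" using n by (intro local_time_mono)
      moreover have "u k \<le> v n" using elim n by blast
      ultimately show ?thesis using x(2) by linarith
    qed
    then show ?case by blast
  qed
  then show "\<forall>\<^sub>F n in sequentially.
    real (max_local_time X (lattice_ball (r n) \<inter> lattice_line a\<^sub>1 a\<^sub>2) n \<omega>) \<le> v n"
    by (rule eventually_dyadic)
qed

lemma AE_max_local_time_ge: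
  fixes r v :: "nat \<Rightarrow> real"
  assumes nz: "a\<^sub>1 \<noteq> 0 \<or> a\<^sub>2 \<noteq> 0" and \<eta>: "0 < \<eta>" "\<eta> < 1"
    and r: "\<And>m n. 1 \<le> m \<Longrightarrow> m \<le> n \<Longrightarrow> r m \<le> r n" "\<And>n. r n \<ge> 0"
    and lim: "filterlim (\<lambda>k. r (2 ^ k)) at_top sequentially"
    and sq: "\<forall>\<^sub>F k in sequentially. (r (2 ^ k))\<^sup>2 \<le> 2 ^ k"
    and v: "\<forall>\<^sub>F k in sequentially. \<forall>n. 2 ^ k \<le> n \<and> n \<le> 2 ^ Suc k \<longrightarrow>
      v n \<le> (1 - \<eta>) * (ln (r (2 ^ k)))\<^sup>2 / (2 * pi)"
    and sum: "summable (\<lambda>k. r (2 ^ k) powr (- (\<eta> / 8)))"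
  shows "AE \<omega> in M. \<forall>\<^sub>F n in sequentially.
    v n \<le> real (max_local_time X (lattice_ball (r n) \<inter> lattice_line a\<^sub>1 a\<^sub>2) n \<omega>)"
proof -
  obtain C where C: "C > 0" "\<forall>\<^sub>F R in at_top. \<forall>n. R\<^sup>2 \<le> real n \<longrightarrow>
    path_mean n (\<lambda>w. of_bool (\<forall>x\<in>lattice_ball R \<inter> lattice_line a\<^sub>1 a\<^sub>2.
      real (visits x 0 w) < (1 - \<eta>) * (ln R)\<^sup>2 / (2 * pi))) \<le> C * R powr (- (\<eta> / 8))"
    using line_maximum_lower[OF nz \<eta>] by blast
  have "AE \<omega> in M. \<forall>\<^sub>F k in sequentially. \<not> (\<forall>x\<in>lattice_ball (r (2 ^ k)) \<inter> lattice_line a\<^sub>1 a\<^sub>2.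
      real (visits x 0 (steps_upto (2 ^ k) \<omega>)) < (1 - \<eta>) * (ln (r (2 ^ k)))\<^sup>2 / (2 * pi))"
  proof (rule AE_eventually_not)
    show "summable (\<lambda>k. C * r (2 ^ k) powr (- (\<eta> / 8)))" using sum by (rule summable_mult)
    show "\<forall>\<^sub>F k in sequentially. path_mean (2 ^ k) (\<lambda>w. of_bool (\<forall>x\<in>lattice_ball (r (2 ^ k)) \<inter> lattice_line a\<^sub>1 a\<^sub>2.
      real (visits x 0 w) < (1 - \<eta>) * (ln (r (2 ^ k)))\<^sup>2 / (2 * pi))) \<le> C * r (2 ^ k) powr (- (\<eta> / 8))"
      using lim[THEN filterlim_iff[THEN iffD1], rule_format, OF C(2)] sq
    proof eventually_elim
      case (elim k)
      show ?case by (rule elim(1)[rule_format]) (use elim(2) in simp)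
    qed
  qed
  then show ?thesis
  proof (rule AE_mp, intro AE_I2 impI)
    fix \<omega>
    assume "\<forall>\<^sub>F k in sequentially. \<not> (\<forall>x\<in>lattice_ball (r (2 ^ k)) \<inter> lattice_line a\<^sub>1 a\<^sub>2.
      real (visits x 0 (steps_upto (2 ^ k) \<omega>)) < (1 - \<eta>) * (ln (r (2 ^ k)))\<^sup>2 / (2 * pi))"
    with v have "\<forall>\<^sub>F k in sequentially. \<forall>n. 2 ^ k \<le> n \<and> n \<le> 2 ^ Suc k \<longrightarrow>
      v n \<le> real (max_local_time X (lattice_ball (r n) \<inter> lattice_line a\<^sub>1 a\<^sub>2) n \<omega>)"
    proof eventually_elim
      case (elim k)
      have "v n \<le> real (max_local_time X (lattice_ball (r n) \<inter> lattice_line a\<^sub>1 a\<^sub>2) n \<omega>)"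
        if n: "2 ^ k \<le> n" "n \<le> 2 ^ Suc k" for n
      proof -
        let ?A = "lattice_ball (r n) \<inter> lattice_line a\<^sub>1 a\<^sub>2"
        obtain x where x: "x \<in> lattice_ball (r (2 ^ k)) \<inter> lattice_line a\<^sub>1 a\<^sub>2"
          "(1 - \<eta>) * (ln (r (2 ^ k)))\<^sup>2 / (2 * pi) \<le> real (local_time X x (2 ^ k) \<omega>)"
          using elim by (auto simp: local_time_eq_visits not_less)
        have "x \<in> ?A" using x(1) lattice_ball_mono[OF r(1)[of "2 ^ k" n]] n by auto
        then have "local_time X x n \<omega> \<le> max_local_time X ?A n \<omega>"
          by (intro le_max_local_time_iff[THEN iffD2] bexI[of _ x]) auto
        moreover have "local_time X x (2 ^ k) \<omega> \<le> local_time X x n \<omega>" using n by (intro local_time_mono)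
        moreover have "v n \<le> (1 - \<eta>) * (ln (r (2 ^ k)))\<^sup>2 / (2 * pi)" using elim n by blast
        ultimately show ?thesis using x(2) by linarith
      qed
      then show ?case by blast
    qed
    then show "\<forall>\<^sub>F n in sequentially.
      v n \<le> real (max_local_time X (lattice_ball (r n) \<inter> lattice_line a\<^sub>1 a\<^sub>2) n \<omega>)"
      by (rule eventually_dyadic)
  qed
qed

end

section \<open>Power and subpower radii\<close>

context simple_random_walk_Z2
begin

text \<open>
  With \<open>O(n\<^sup>\<alpha>)\<close> points and tail exponent \<open>\<pi> c > \<alpha>\<close>, the union bound decays geometrically along
  \<open>n = 2 ^ k\<close>.
\<close>

lemma AE_upper_power_radius:
  fixes \<alpha> c :: real
  assumes nz: "a\<^sub>1 \<noteq> 0 \<or> a\<^sub>2 \<noteq> 0" and \<alpha>: "0 < \<alpha>" and c: "\<alpha> / pi < c"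
  shows "AE \<omega> in M. \<forall>\<^sub>F n in sequentially.
    real (max_local_time X (lattice_ball (real n powr \<alpha>) \<inter> lattice_line a\<^sub>1 a\<^sub>2) n \<omega>) \<le> c * (ln (real n))\<^sup>2"
proof -
  have "c > 0" using c \<alpha> by (auto intro: less_trans[rotated])
  \<comment> \<open>Chosen such that \<open>(1 - \<delta>) \<pi> c\<close> is still larger than \<open>\<alpha>\<close>.\<close>
  define t where "t = \<alpha> / (pi * c)"
  define \<delta> where "\<delta> = (1 - t) / 2"
  define q where "q = (1 - \<delta>) * pi"
  have t: "0 < t" "t < 1" "\<alpha> = t * (pi * c)" using c \<alpha> \<open>c > 0\<close> by (auto simp: t_def field_simps)
  then have \<delta>: "0 < \<delta>" "\<delta> < 1" by (auto simp: \<delta>_def)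
  have "t < 1 - \<delta>" using t(2) by (simp add: \<delta>_def field_simps)
  then have "t * (pi * c) < (1 - \<delta>) * (pi * c)" using \<open>c > 0\<close> by (intro mult_strict_right_mono) auto
  then have q: "\<alpha> < q * c" unfolding t(3) q_def by (simp only: mult.assoc)
  have "q > 0" using \<delta> by (simp add: q_def)
  \<comment> \<open>The logarithm of the union bound at \<open>n = 2 ^ (k + 1)\<close>, up to a constant.\<close>
  define g where "g = (\<lambda>k :: nat. \<alpha> * ((real k + 1) * ln 2) - c * (real k * ln 2)\<^sup>2 * ln (1 + q / (1 + (real k + 1) * ln 2)))"
  define \<kappa> where "\<kappa> = (q * c - \<alpha>) * ln 2 / 2"
  have "\<kappa> > 0" using q by (simp add: \<kappa>_def)
  have ev_g: "\<forall>\<^sub>F k in sequentially. g k \<le> - (\<kappa> * real k)"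
  proof -
    have "(\<lambda>k. g k / real k) \<longlonglongrightarrow> \<alpha> * ln 2 - c * ln 2 * q"
      unfolding g_def using \<open>q > 0\<close> \<open>c > 0\<close> \<alpha>
      by (real_asymp, simp add: power2_eq_square field_simps)
    moreover have "\<alpha> * ln 2 - c * ln 2 * q < - \<kappa>"
    proof -
      have "2 * \<kappa> = (q * c - \<alpha>) * ln 2" by (simp add: \<kappa>_def)
      then have "\<alpha> * ln 2 - c * ln 2 * q = - (2 * \<kappa>)" by (simp add: algebra_simps)
      with \<open>\<kappa> > 0\<close> show ?thesis by linarith
    qed
    ultimately have "\<forall>\<^sub>F k in sequentially. g k / real k < - \<kappa>" by (rule order_tendstoD(2))
    with eventually_gt_at_top[of 0] show ?thesis by eventually_elim (simp add: field_simps)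
  qed
  let ?b = "\<lambda>k :: nat. 3 * (1 + 2 * pi / \<delta>) * exp (- (\<kappa> * real k powr 1))"
  show ?thesis
  proof (rule AE_max_local_time_le)
    show "real m powr \<alpha> \<le> real n powr \<alpha>" if "1 \<le> m" "m \<le> n" for m n
      using that \<alpha> by (intro powr_mono2) auto
    show "0 \<le> real n powr \<alpha>" for n by simp
    show "\<forall>\<^sub>F k in sequentially. \<forall>n. 2 ^ k \<le> n \<and> n \<le> 2 ^ Suc k \<longrightarrow> c * (real k * ln 2)\<^sup>2 \<le> c * (ln (real n))\<^sup>2"
    proof (intro always_eventually allI impI)
      fix k n :: nat assume n: "2 ^ k \<le> n \<and> n \<le> 2 ^ Suc k"
      then have "(2 :: real) ^ k \<le> real n" by (metis of_nat_le_iff of_nat_numeral of_nat_power)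
      then have "ln ((2 :: real) ^ k) \<le> ln (real n)" by (intro ln_mono) auto
      then have "real k * ln 2 \<le> ln (real n)" by (simp add: ln_realpow)
      then show "c * (real k * ln 2)\<^sup>2 \<le> c * (ln (real n))\<^sup>2"
        using \<open>c > 0\<close> by (intro mult_left_mono power_mono) auto
    qed
    show "summable ?b" using summable_exp_powr[OF \<open>\<kappa> > 0\<close>, of 1] by (intro summable_mult) auto
    show "\<forall>\<^sub>F k in sequentially. path_mean (2 ^ Suc k) (\<lambda>w. of_bool
      (\<exists>x\<in>lattice_ball (real (2 ^ Suc k) powr \<alpha>) \<inter> lattice_line a\<^sub>1 a\<^sub>2. c * (real k * ln 2)\<^sup>2 \<le> real (visits x 0 w))) \<le> ?b k"
      using ev_g
    proof eventually_elim
      case (elim k)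
      define R where "R = real (2 ^ Suc k) powr \<alpha>"
      define l where "l = (real k + 1) * ln 2"
      have l: "ln (real (2 ^ Suc k)) = l" by (simp add: l_def ln_realpow ln_mult algebra_simps)
      have R: "R = exp (\<alpha> * l)" unfolding R_def powr_def l by simp
      have "l \<ge> 0" by (simp add: l_def)
      then have R1: "R \<ge> 1" using \<alpha> by (simp add: R)
      have "path_mean (2 ^ Suc k) (\<lambda>w. of_bool
          (\<exists>x\<in>lattice_ball R \<inter> lattice_line a\<^sub>1 a\<^sub>2. c * (real k * ln 2)\<^sup>2 \<le> real (visits x 0 w))) \<le>
        (2 * R + 1) * ((1 + 2 * pi / \<delta>) * (1 + (1 - \<delta>) * pi / (1 + ln (real (2 ^ Suc k)))) powr (- (c * (real k * ln 2)\<^sup>2)))"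
        using R1 \<delta> by (intro line_maximum_upper nz) auto
      also have "\<dots> = (2 * R + 1) * ((1 + 2 * pi / \<delta>) * (1 + q / (1 + l)) powr (- (c * (real k * ln 2)\<^sup>2)))"
        unfolding l q_def by simp
      also have "\<dots> \<le> (3 * R) * ((1 + 2 * pi / \<delta>) * (1 + q / (1 + l)) powr (- (c * (real k * ln 2)\<^sup>2)))"
        using R1 \<delta> by (intro mult_right_mono) auto
      also have "\<dots> = 3 * (1 + 2 * pi / \<delta>) * exp (g k)"
      proof -
        have "1 + q / (1 + l) > 0" using \<open>q > 0\<close> \<open>l \<ge> 0\<close> by (intro add_pos_nonneg) auto
        then have "(1 + q / (1 + l)) powr (- (c * (real k * ln 2)\<^sup>2)) = exp (- (c * (real k * ln 2)\<^sup>2 * ln (1 + q / (1 + l))))"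
          by (simp add: powr_def)
        then have "R * (1 + q / (1 + l)) powr (- (c * (real k * ln 2)\<^sup>2)) = exp (g k)"
          unfolding R g_def l_def[symmetric] by (simp flip: exp_add)
        moreover have "(3 * x) * (y * z) = 3 * y * e" if "x * z = e" for x y z e :: real
          using that by auto
        ultimately show ?thesis by blast
      qed
      also have "\<dots> \<le> ?b k"
        using elim \<delta> by (intro mult_left_mono) auto
      finally show ?case unfolding R_def .
    qed
  qed
qed

lemma AE_lower_power_radius:
  fixes \<alpha> \<eta> :: real
  assumes nz: "a\<^sub>1 \<noteq> 0 \<or> a\<^sub>2 \<noteq> 0" and \<alpha>: "0 < \<alpha>" "\<alpha> \<le> 1 / 2" and \<eta>: "0 < \<eta>" "\<eta> < 1"
  shows "AE \<omega> in M. \<forall>\<^sub>F n in sequentially. (1 - \<eta>) * \<alpha>\<^sup>2 / (2 * pi) * (ln (real n))\<^sup>2 \<le>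
    real (max_local_time X (lattice_ball (real n powr \<alpha>) \<inter> lattice_line a\<^sub>1 a\<^sub>2) n \<omega>)"
proof (rule AE_max_local_time_ge[OF nz])
  have ln_r: "ln (real (2 ^ k) powr \<alpha>) = \<alpha> * (real k * ln 2)" for k
    by (simp add: ln_powr ln_realpow)
  have r_exp: "real (2 ^ k) powr \<alpha> = exp (\<alpha> * (real k * ln 2))" for k
    by (simp add: powr_def ln_realpow)
  show "0 < \<eta> / 2" "\<eta> / 2 < 1" using \<eta> by auto
  show "real m powr \<alpha> \<le> real n powr \<alpha>" if "1 \<le> m" "m \<le> n" for m n
    using that \<alpha> by (intro powr_mono2) auto
  show "0 \<le> real n powr \<alpha>" for n by simp
  show "filterlim (\<lambda>k. real (2 ^ k) powr \<alpha>) at_top sequentially"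
    unfolding r_exp using \<alpha> by real_asymp
  show "\<forall>\<^sub>F k in sequentially. (real (2 ^ k) powr \<alpha>)\<^sup>2 \<le> 2 ^ k"
  proof (intro always_eventually allI)
    fix k
    have "(real (2 ^ k) powr \<alpha>)\<^sup>2 = real (2 ^ k) powr (2 * \<alpha>)"
      by (simp add: power2_eq_square flip: powr_add)
    also have "\<dots> \<le> real (2 ^ k) powr 1" using \<alpha> by (intro powr_mono) auto
    finally show "(real (2 ^ k) powr \<alpha>)\<^sup>2 \<le> 2 ^ k" by simp
  qed
  show "\<forall>\<^sub>F k in sequentially. \<forall>n. 2 ^ k \<le> n \<and> n \<le> 2 ^ Suc k \<longrightarrow>
    (1 - \<eta>) * \<alpha>\<^sup>2 / (2 * pi) * (ln (real n))\<^sup>2 \<le> (1 - \<eta> / 2) * (ln (real (2 ^ k) powr \<alpha>))\<^sup>2 / (2 * pi)"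
  proof -
    have "\<forall>\<^sub>F k in sequentially. (1 - \<eta>) * (real k + 1)\<^sup>2 \<le> (1 - \<eta> / 2) * (real k)\<^sup>2"
      using \<eta> by real_asymp
    then show ?thesis
    proof eventually_elim
      case (elim k)
      have "(1 - \<eta>) * \<alpha>\<^sup>2 / (2 * pi) * (ln (real n))\<^sup>2 \<le> (1 - \<eta> / 2) * (ln (real (2 ^ k) powr \<alpha>))\<^sup>2 / (2 * pi)"
        if n: "2 ^ k \<le> n" "n \<le> 2 ^ Suc k" for n
      proof -
        have n1: "n \<ge> 1" using order.trans[OF one_le_power[of 2 k] n(1)] by auto
        have "real n \<le> (2 :: real) ^ Suc k" using n(2) by (metis of_nat_le_iff of_nat_numeral of_nat_power)
        then have "ln (real n) \<le> ln ((2 :: real) ^ Suc k)" using n1 by (intro ln_mono) auto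
        also have "\<dots> = (real k + 1) * ln 2" by (simp add: ln_realpow ln_mult algebra_simps)
        finally have "(ln (real n))\<^sup>2 \<le> ((real k + 1) * ln 2)\<^sup>2"
          using n1 by (intro power_mono) auto
        then have "(1 - \<eta>) * \<alpha>\<^sup>2 / (2 * pi) * (ln (real n))\<^sup>2 \<le> (1 - \<eta>) * \<alpha>\<^sup>2 / (2 * pi) * ((real k + 1) * ln 2)\<^sup>2"
          using \<eta> by (intro mult_left_mono) auto
        also have "\<dots> = ((1 - \<eta>) * (real k + 1)\<^sup>2) * (\<alpha>\<^sup>2 * (ln 2)\<^sup>2 / (2 * pi))"
          by (simp add: power_mult_distrib)
        also have "\<dots> \<le> ((1 - \<eta> / 2) * (real k)\<^sup>2) * (\<alpha>\<^sup>2 * (ln 2)\<^sup>2 / (2 * pi))"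
          using elim by (intro mult_right_mono) auto
        also have "\<dots> = (1 - \<eta> / 2) * (ln (real (2 ^ k) powr \<alpha>))\<^sup>2 / (2 * pi)"
          unfolding ln_r by (simp add: power_mult_distrib)
        finally show ?thesis .
      qed
      then show ?case by blast
    qed
  qed
  show "summable (\<lambda>k. (real (2 ^ k) powr \<alpha>) powr (- (\<eta> / 2 / 8)))"
  proof -
    have "(real (2 ^ k) powr \<alpha>) powr (- (\<eta> / 2 / 8)) = exp (- (\<alpha> * ln 2 * \<eta> / 16 * real k powr 1))" for k
      unfolding r_exp by (simp add: powr_def)
    moreover have "0 < \<alpha> * ln 2 * \<eta> / 16" using \<alpha> \<eta> by simp
    ultimately show ?thesis using summable_exp_powr[of "\<alpha> * ln 2 * \<eta> / 16" 1] by simp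
  qed
qed

lemma AE_lower_subpower_radius:
  fixes \<beta> \<eta> :: real
  assumes nz: "a\<^sub>1 \<noteq> 0 \<or> a\<^sub>2 \<noteq> 0" and \<beta>: "0 < \<beta>" "\<beta> < 1" and \<eta>: "0 < \<eta>" "\<eta> < 1"
  shows "AE \<omega> in M. \<forall>\<^sub>F n in sequentially. (1 - \<eta>) / (2 * pi) * ln (real n) powr (2 * \<beta>) \<le>
    real (max_local_time X (lattice_ball (exp (ln (real n) powr \<beta>)) \<inter> lattice_line a\<^sub>1 a\<^sub>2) n \<omega>)"
proof (rule AE_max_local_time_ge[OF nz])
  have ln_2k: "ln (real (2 ^ k)) = real k * ln 2" for k by (simp add: ln_realpow)
  show "0 < \<eta> / 2" "\<eta> / 2 < 1" using \<eta> by auto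
  show "exp (ln (real m) powr \<beta>) \<le> exp (ln (real n) powr \<beta>)" if "1 \<le> m" "m \<le> n" for m n
  proof -
    have "ln (real m) \<le> ln (real n)" "0 \<le> ln (real m)" using that by auto
    then show ?thesis using \<beta> by (simp add: powr_mono2)
  qed
  show "0 \<le> exp (ln (real n) powr \<beta>)" for n by simp
  show "filterlim (\<lambda>k. exp (ln (real (2 ^ k)) powr \<beta>)) at_top sequentially"
    unfolding ln_2k using \<beta> by real_asymp
  show "\<forall>\<^sub>F k in sequentially. (exp (ln (real (2 ^ k)) powr \<beta>))\<^sup>2 \<le> 2 ^ k"
  proof -
    have "\<forall>\<^sub>F k in sequentially. 2 * (real k * ln 2) powr \<beta> \<le> real k * ln 2"
      using \<beta> by real_asymp
    then show ?thesis
    proof eventually_elim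
      case (elim k)
      have "(exp (ln (real (2 ^ k)) powr \<beta>))\<^sup>2 = exp (2 * (real k * ln 2) powr \<beta>)"
        unfolding ln_2k by (simp add: power2_eq_square flip: exp_add)
      also have "\<dots> \<le> exp (real k * ln 2)" using elim by simp
      also have "\<dots> = 2 ^ k" by (simp add: exp_of_nat_mult)
      finally show ?case .
    qed
  qed
  show "\<forall>\<^sub>F k in sequentially. \<forall>n. 2 ^ k \<le> n \<and> n \<le> 2 ^ Suc k \<longrightarrow>
    (1 - \<eta>) / (2 * pi) * ln (real n) powr (2 * \<beta>) \<le> (1 - \<eta> / 2) * (ln (exp (ln (real (2 ^ k)) powr \<beta>)))\<^sup>2 / (2 * pi)"
  proof -
    have "\<forall>\<^sub>F k in sequentially. (1 - \<eta>) * ((real k + 1) * ln 2) powr (2 * \<beta>) \<le> (1 - \<eta> / 2) * (real k * ln 2) powr (2 * \<beta>)"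
      using \<eta> \<beta> by real_asymp
    then show ?thesis
    proof eventually_elim
      case (elim k)
      have "(1 - \<eta>) / (2 * pi) * ln (real n) powr (2 * \<beta>) \<le> (1 - \<eta> / 2) * (ln (exp (ln (real (2 ^ k)) powr \<beta>)))\<^sup>2 / (2 * pi)"
        if n: "2 ^ k \<le> n" "n \<le> 2 ^ Suc k" for n
      proof -
        have n1: "n \<ge> 1" using order.trans[OF one_le_power[of 2 k] n(1)] by auto
        have "real n \<le> (2 :: real) ^ Suc k" using n(2) by (metis of_nat_le_iff of_nat_numeral of_nat_power)
        then have "ln (real n) \<le> ln ((2 :: real) ^ Suc k)" using n1 by (intro ln_mono) auto
        also have "\<dots> = (real k + 1) * ln 2" by (simp add: ln_realpow ln_mult algebra_simps)
        finally have "ln (real n) powr (2 * \<beta>) \<le> ((real k + 1) * ln 2) powr (2 * \<beta>)"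
          using n1 \<beta> by (intro powr_mono2) auto
        then have "(1 - \<eta>) * ln (real n) powr (2 * \<beta>) \<le> (1 - \<eta>) * ((real k + 1) * ln 2) powr (2 * \<beta>)"
          using \<eta> by (intro mult_left_mono) auto
        also note elim
        also have "(real k * ln 2) powr (2 * \<beta>) = (ln (exp (ln (real (2 ^ k)) powr \<beta>)))\<^sup>2"
          unfolding ln_2k by (simp add: power2_eq_square flip: powr_add)
        finally show ?thesis by (simp add: divide_right_mono)
      qed
      then show ?case by blast
    qed
  qed
  show "summable (\<lambda>k. exp (ln (real (2 ^ k)) powr \<beta>) powr (- (\<eta> / 2 / 8)))"
  proof -
    have "exp (ln (real (2 ^ k)) powr \<beta>) powr (- (\<eta> / 2 / 8)) = exp (- (ln 2 powr \<beta> * \<eta> / 16 * real k powr \<beta>))" for k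
      unfolding ln_2k by (simp add: powr_def[of "exp _"] powr_mult)
    moreover have "0 < ln 2 powr \<beta> * \<eta> / 16" using \<eta> by simp
    ultimately show ?thesis using summable_exp_powr[of "ln 2 powr \<beta> * \<eta> / 16" \<beta>] \<beta> by simp
  qed
qed

text \<open>
  Write \<open>l = ln n\<close>, \<open>b = l\<^sup>\<beta> = ln r\<close> and let \<open>y\<close> be \<open>l\<close> to the power \<open>\<epsilon> / 2\<close>.  The reference points are
  allowed \<open>K = b\<^sup>2 y\<close> visits, which exceeds their typical number \<open>l\<close> by at least the factor \<open>y\<close>
  because \<open>b\<^sup>2 \<ge> l\<close> for \<open>\<beta> \<ge> 1 / 2\<close>.  The target is a constant multiple of \<open>b\<^sup>2 y\<^sup>2\<close>.  At the scale \<open>D \<approx> b\<close>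
  the target contributes \<open>- b y\<^sup>2\<close> to the exponent, against \<open>b y\<close> from the reference points and \<open>b\<close>
  from the number of points of the line.
\<close>

lemma AE_upper_subpower_radius:
  fixes \<beta> \<epsilon> :: real
  assumes nz: "a\<^sub>1 \<noteq> 0 \<or> a\<^sub>2 \<noteq> 0" and \<beta>: "1 / 2 \<le> \<beta>" and \<epsilon>: "0 < \<epsilon>"
  shows "AE \<omega> in M. \<forall>\<^sub>F n in sequentially.
    real (max_local_time X (lattice_ball (exp (ln (real n) powr \<beta>)) \<inter> lattice_line a\<^sub>1 a\<^sub>2) n \<omega>)
      \<le> ln (real n) powr (2 * \<beta> + \<epsilon>)"
proof -
  define l where "l = (\<lambda>k :: nat. (real k + 1) * ln 2)"
  \<comment> \<open>The target at \<open>2 ^ k\<close> is lowered to \<open>u k\<close>, which uses half of \<open>ln (2 ^ (k + 1))\<close> in place of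
    \<open>ln (2 ^ k)\<close>; this costs the constant factor \<open>q\<close>.\<close>
  define q where "q = 2 powr (2 * \<beta> + \<epsilon>)"
  define u where "u = (\<lambda>k. (l k / 2) powr (2 * \<beta> + \<epsilon>))"
  have "q > 0" by (simp add: q_def)
  let ?c = "360 + 2 * (1 + 4 * pi)"
  let ?b = "\<lambda>k :: nat. ?c * exp (- (ln 2 powr (\<epsilon> / 2) / 4 * real k powr (\<epsilon> / 2)))"
  have ln_2k: "ln (real (2 ^ Suc k)) = l k" for k by (simp add: l_def ln_realpow ln_mult algebra_simps)
  show ?thesis
  proof (rule AE_max_local_time_le)
    show "exp (ln (real m) powr \<beta>) \<le> exp (ln (real n) powr \<beta>)" if "1 \<le> m" "m \<le> n" for m n
    proof -
      have "ln (real m) \<le> ln (real n)" "0 \<le> ln (real m)" using that by auto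
      then show ?thesis using \<beta> by (simp add: powr_mono2)
    qed
    show "0 \<le> exp (ln (real n) powr \<beta>)" for n by simp
    show "\<forall>\<^sub>F k in sequentially. \<forall>n. 2 ^ k \<le> n \<and> n \<le> 2 ^ Suc k \<longrightarrow> u k \<le> ln (real n) powr (2 * \<beta> + \<epsilon>)"
      using eventually_ge_at_top[of 1]
    proof eventually_elim
      case (elim k)
      have "u k \<le> ln (real n) powr (2 * \<beta> + \<epsilon>)" if n: "2 ^ k \<le> n" for n
      proof -
        have "(2 :: real) ^ k \<le> real n" using n by (metis of_nat_le_iff of_nat_numeral of_nat_power)
        then have "ln ((2 :: real) ^ k) \<le> ln (real n)" by (intro ln_mono) auto
        then have "real k * ln 2 \<le> ln (real n)" by (simp add: ln_realpow)
        moreover have "l k / 2 \<le> real k * ln 2" using elim by (simp add: l_def)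
        ultimately have "l k / 2 \<le> ln (real n)" by linarith
        then show ?thesis unfolding u_def using \<beta> \<epsilon> by (intro powr_mono2) (auto simp: l_def)
      qed
      then show ?case by blast
    qed
    show "summable ?b"
      using summable_exp_powr[of "ln 2 powr (\<epsilon> / 2) / 4" "\<epsilon> / 2"] \<epsilon> by (intro summable_mult) auto
    have ev_y: "\<forall>\<^sub>F k in sequentially. 2 + l k powr (\<epsilon> / 2) - (l k powr (\<epsilon> / 2))\<^sup>2 / (120 * q) \<le> - (l k powr (\<epsilon> / 2)) \<and>
        q < l k powr (\<epsilon> / 2) \<and> 3 \<le> l k"
    proof -
      have y: "filterlim (\<lambda>k. l k powr (\<epsilon> / 2)) at_top sequentially"
        unfolding l_def using \<epsilon> by real_asymp
      have "\<forall>\<^sub>F y in at_top. 2 + y - y\<^sup>2 / (120 * q) \<le> - y"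
        using \<open>q > 0\<close> by real_asymp
      from y[THEN filterlim_iff[THEN iffD1], rule_format, OF this]
        y[THEN filterlim_at_top_dense[THEN iffD1], rule_format, of q]
      have "\<forall>\<^sub>F k in sequentially. 2 + l k powr (\<epsilon> / 2) - (l k powr (\<epsilon> / 2))\<^sup>2 / (120 * q) \<le> - (l k powr (\<epsilon> / 2)) \<and>
        q < l k powr (\<epsilon> / 2)" by eventually_elim simp
      moreover have "\<forall>\<^sub>F k in sequentially. 3 \<le> l k" unfolding l_def by real_asymp
      ultimately show ?thesis by eventually_elim simp
    qed
    show "\<forall>\<^sub>F k in sequentially. path_mean (2 ^ Suc k) (\<lambda>w. of_bool
      (\<exists>x\<in>lattice_ball (exp (ln (real (2 ^ Suc k)) powr \<beta>)) \<inter> lattice_line a\<^sub>1 a\<^sub>2. u k \<le> real (visits x 0 w))) \<le> ?b k"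
      using ev_y
    proof eventually_elim
      case (elim k)
      define b where "b = l k powr \<beta>"
      define y where "y = l k powr (\<epsilon> / 2)"
      define R where "R = exp b"
      define D where "D = 18 + 2 * ln R"
      define K where "K = b\<^sup>2 * y"
      have lk: "l k \<ge> 3" and y: "q < y" "2 + y - y\<^sup>2 / (120 * q) \<le> - y" using elim by (auto simp: y_def)
      have "y > 0" using y \<open>q > 0\<close> by simp
      have b: "b \<ge> 1" using lk \<beta> by (simp add: b_def ge_one_powr_ge_zero)
      have b_sq: "l k \<le> b\<^sup>2"
      proof -
        have "l k powr 1 \<le> l k powr (2 * \<beta>)" using lk \<beta> by (intro powr_mono) auto
        also have "\<dots> = b\<^sup>2" by (simp add: b_def power2_eq_square flip: powr_add)
        finally show ?thesis using lk by simp
      qed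
      have u: "u k = b\<^sup>2 * y\<^sup>2 / q"
        unfolding u_def q_def b_def y_def using lk
        by (simp add: powr_divide power2_eq_square flip: powr_add)
      have "K < u k"
      proof -
        have "b\<^sup>2 * y * q < b\<^sup>2 * y * y" using b y \<open>y > 0\<close> by (intro mult_strict_left_mono) auto
        then show ?thesis using \<open>q > 0\<close> by (simp add: u K_def field_simps power2_eq_square)
      qed
      have D: "2 * b \<le> D" "D \<le> 20 * b" using b by (auto simp: D_def R_def)
      have "path_mean (2 ^ Suc k) (\<lambda>w. of_bool
          (\<exists>x\<in>lattice_ball R \<inter> lattice_line a\<^sub>1 a\<^sub>2. u k \<le> real (visits x 0 w))) \<le>
        2 * ((1 + 4 * pi) * exp (- (K * (pi / 2 / (1 + ln (real (2 ^ Suc k)))) / 2))) +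
        (2 * R + 1) * (6 * D * exp (2 * K / D - u k / (6 * D)))"
        unfolding D_def
      proof (rule line_maximum_upper_small_ball[OF nz])
        show "R \<ge> 1" using b by (simp add: R_def)
        show "(2 :: nat) ^ Suc k \<ge> 1" by simp
        show "3 \<le> ln (real (2 ^ Suc k))" unfolding ln_2k by (rule lk)
        show "0 \<le> K" using \<open>y > 0\<close> by (simp add: K_def)
      qed fact
      also have "\<dots> \<le> 2 * ((1 + 4 * pi) * exp (- (y / 4))) + 360 * exp (- (y / 4))"
      proof (rule add_mono)
        have "y / 4 \<le> K * (pi / 2 / (1 + l k)) / 2"
        proof -
          have "1 + l k \<le> 2 * l k" using lk by simp
          also have "\<dots> \<le> 2 * b\<^sup>2" using b_sq by simp
          also have "\<dots> \<le> pi * b\<^sup>2" using pi_gt3 by (intro mult_right_mono) auto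
          finally have "y * (1 + l k) \<le> y * (pi * b\<^sup>2)" using \<open>y > 0\<close> by (intro mult_left_mono) auto
          then show ?thesis using lk by (simp add: K_def field_simps)
        qed
        then show "2 * ((1 + 4 * pi) * exp (- (K * (pi / 2 / (1 + ln (real (2 ^ Suc k)))) / 2))) \<le>
            2 * ((1 + 4 * pi) * exp (- (y / 4)))"
          unfolding ln_2k by (intro mult_left_mono) auto
        have "2 * K / D - u k / (6 * D) \<le> b * y - b * y\<^sup>2 / (120 * q)"
        proof (rule diff_mono)
          have "2 * K / D \<le> 2 * K / (2 * b)"
            using D b \<open>y > 0\<close> by (intro divide_left_mono) (auto simp: K_def)
          also have "\<dots> = b * y" using b by (simp add: K_def power2_eq_square)
          finally show "2 * K / D \<le> b * y" .
          have "b * y\<^sup>2 / (120 * q) = u k / (6 * (20 * b))"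
            using b by (simp add: u power2_eq_square)
          also have "\<dots> \<le> u k / (6 * D)"
            using D b \<open>q > 0\<close> by (intro divide_left_mono) (auto simp: u)
          finally show "b * y\<^sup>2 / (120 * q) \<le> u k / (6 * D)" .
        qed
        then have "exp (2 * K / D - u k / (6 * D)) \<le> exp (b * y - b * y\<^sup>2 / (120 * q))" by simp
        moreover have "2 * R + 1 \<le> 3 * exp b" using b by (simp add: R_def)
        moreover have "6 * D \<le> 120 * exp b"
        proof -
          have "b \<le> exp b" using exp_ge_add_one_self[of b] by linarith
          then show ?thesis using D by linarith
        qed
        ultimately have "(2 * R + 1) * (6 * D * exp (2 * K / D - u k / (6 * D))) \<le>
            3 * exp b * (120 * exp b * exp (b * y - b * y\<^sup>2 / (120 * q)))"
          using D b by (intro mult_mono[of "2 * R + 1" "3 * exp b"] mult_mono[of "6 * D" "120 * exp b"]) (auto simp: R_def)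
        also have "\<dots> = 360 * exp (b * (2 + y - y\<^sup>2 / (120 * q)))"
          by (simp add: algebra_simps flip: exp_add)
        also have "\<dots> \<le> 360 * exp (- (y / 4))"
        proof -
          have "b * (2 + y - y\<^sup>2 / (120 * q)) \<le> b * (- y)" using y b by (intro mult_left_mono) auto
          also have "\<dots> \<le> 1 * (- y)" using b \<open>y > 0\<close> by (intro mult_right_mono_neg) auto
          also have "\<dots> \<le> - (y / 4)" using \<open>y > 0\<close> by simp
          finally show ?thesis by simp
        qed
        finally show "(2 * R + 1) * (6 * D * exp (2 * K / D - u k / (6 * D))) \<le> 360 * exp (- (y / 4))" .
      qed
      also have "\<dots> = ?c * exp (- (y / 4))" by (simp add: algebra_simps)
      also have "\<dots> \<le> ?b k"
      proof -
        have "ln 2 powr (\<epsilon> / 2) * real k powr (\<epsilon> / 2) = (real k * ln 2) powr (\<epsilon> / 2)"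
          by (simp add: powr_mult mult.commute)
        also have "\<dots> \<le> y" unfolding y_def using \<epsilon> by (intro powr_mono2) (auto simp: l_def)
        finally show ?thesis by (intro mult_left_mono) auto
      qed
      finally show ?case unfolding R_def b_def ln_2k .
    qed
  qed
qed

end

theorem corollary1p1:
  fixes M :: "'a measure" and X :: "nat \<Rightarrow> 'a \<Rightarrow> int \<times> int" and a\<^sub>1 a\<^sub>2 :: int
  assumes "simple_random_walk_Z2 M X"
    and "a\<^sub>1 \<noteq> 0 \<or> a\<^sub>2 \<noteq> 0"
  shows "(\<forall>\<alpha>::real. 0 < \<alpha> \<and> \<alpha> \<le> 1 / 2 \<longrightarrow>
      (AE \<omega> in M.
        (let \<rho> = (\<lambda>n::nat. ereal (
               real (max_local_time X (lattice_ball (real n powr \<alpha>) \<inter> lattice_line a\<^sub>1 a\<^sub>2) n \<omega>)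
               / (ln (real n))\<^sup>2))
         in ereal (\<alpha>\<^sup>2 / (2 * pi)) \<le> liminf \<rho> \<and>
            liminf \<rho> \<le> limsup \<rho> \<and>
            limsup \<rho> \<le> ereal (1 / pi * min (1 / 2) (2 * \<alpha>)))))
    \<and> (\<forall>\<beta>::real. 1 / 2 \<le> \<beta> \<and> \<beta> < 1 \<longrightarrow>
      (\<forall>\<epsilon>::real. \<epsilon> > 0 \<longrightarrow>
        (AE \<omega> in M. \<exists>n\<^sub>0::nat. \<forall>n\<ge>n\<^sub>0.
          (let \<xi> = real (max_local_time X
                 (lattice_ball (exp (ln (real n) powr \<beta>)) \<inter> lattice_line a\<^sub>1 a\<^sub>2) n \<omega>)
           in (1 - \<epsilon>) / (2 * pi) * ln (real n) powr (2 * \<beta>) \<le> \<xi> \<and>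
              \<xi> \<le> ln (real n) powr (2 * \<beta> + \<epsilon>)))))"
proof (intro conjI allI impI)
  interpret simple_random_walk_Z2 M X by (rule assms(1))
  note nz = assms(2)
  {
    fix \<alpha> :: real assume "0 < \<alpha> \<and> \<alpha> \<le> 1 / 2"
    then have \<alpha>: "0 < \<alpha>" "\<alpha> \<le> 1 / 2" by auto
    let ?m = "\<lambda>n \<omega>. real (max_local_time X (lattice_ball (real n powr \<alpha>) \<inter> lattice_line a\<^sub>1 a\<^sub>2) n \<omega>)"
    have "AE \<omega> in M. \<forall>j :: nat. \<forall>\<^sub>F n in sequentially. ?m n \<omega> \<le> (\<alpha> / pi + 1 / (real j + 1)) * (ln (real n))\<^sup>2"
      using \<alpha> by (intro AE_all_countable[THEN iffD2] allI AE_upper_power_radius[OF nz]) auto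
    moreover have "AE \<omega> in M. \<forall>j :: nat. \<forall>\<^sub>F n in sequentially.
        (1 - 1 / (real j + 2)) * \<alpha>\<^sup>2 / (2 * pi) * (ln (real n))\<^sup>2 \<le> ?m n \<omega>"
      using \<alpha> by (intro AE_all_countable[THEN iffD2] allI AE_lower_power_radius[OF nz]) (auto simp: field_simps)
    ultimately show "AE \<omega> in M.
        (let \<rho> = (\<lambda>n::nat. ereal (?m n \<omega> / (ln (real n))\<^sup>2))
         in ereal (\<alpha>\<^sup>2 / (2 * pi)) \<le> liminf \<rho> \<and> liminf \<rho> \<le> limsup \<rho> \<and>
            limsup \<rho> \<le> ereal (1 / pi * min (1 / 2) (2 * \<alpha>)))"
    proof eventually_elim
      case (elim \<omega>)
      define \<rho> where "\<rho> = (\<lambda>n::nat. ereal (?m n \<omega> / (ln (real n))\<^sup>2))"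
      have pos: "\<forall>\<^sub>F n :: nat in sequentially. 0 < (ln (real n))\<^sup>2"
        using eventually_gt_at_top[of 1] by eventually_elim simp
      have above: "limsup \<rho> \<le> ereal (\<alpha> / pi + 1 / (real j + 1))" for j
      proof (rule Limsup_bounded)
        show "\<forall>\<^sub>F n in sequentially. \<rho> n \<le> ereal (\<alpha> / pi + 1 / (real j + 1))"
          using elim(1)[rule_format, of j] pos
          by eventually_elim (simp add: \<rho>_def pos_divide_le_eq)
      qed
      have "(\<lambda>j. ereal (\<alpha> / pi + 1 / (real j + 1))) \<longlonglongrightarrow> ereal (\<alpha> / pi)"
        by (intro tendsto_ereal) real_asymp
      then have "limsup \<rho> \<le> ereal (\<alpha> / pi)" by (rule LIMSEQ_le_const) (use above in blast)
      also have "\<dots> \<le> ereal (1 / pi * min (1 / 2) (2 * \<alpha>))"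
        using \<alpha> by (simp add: divide_right_mono)
      finally have upper: "limsup \<rho> \<le> ereal (1 / pi * min (1 / 2) (2 * \<alpha>))" .
      have below: "ereal ((1 - 1 / (real j + 2)) * \<alpha>\<^sup>2 / (2 * pi)) \<le> liminf \<rho>" for j
      proof (rule Liminf_bounded)
        show "\<forall>\<^sub>F n in sequentially. ereal ((1 - 1 / (real j + 2)) * \<alpha>\<^sup>2 / (2 * pi)) \<le> \<rho> n"
          using elim(2)[rule_format, of j] pos
          by eventually_elim (simp add: \<rho>_def pos_le_divide_eq)
      qed
      have "(\<lambda>j. ereal ((1 - 1 / (real j + 2)) * \<alpha>\<^sup>2 / (2 * pi))) \<longlonglongrightarrow> ereal (\<alpha>\<^sup>2 / (2 * pi))"
        by (intro tendsto_ereal, real_asymp) (simp add: field_simps)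
      then have lower: "ereal (\<alpha>\<^sup>2 / (2 * pi)) \<le> liminf \<rho>"
        by (rule LIMSEQ_le_const2) (use below in blast)
      show ?case unfolding Let_def \<rho>_def[symmetric]
        using upper lower by (auto intro: Liminf_le_Limsup)
    qed
  }
  {
    fix \<beta> \<epsilon> :: real assume "1 / 2 \<le> \<beta> \<and> \<beta> < 1" "\<epsilon> > 0"
    then have \<beta>: "1 / 2 \<le> \<beta>" "\<beta> < 1" and \<epsilon>: "\<epsilon> > 0" by auto
    \<comment> \<open>For \<open>\<epsilon> \<ge> 1\<close> the lower bound is not positive, so smaller values of \<open>\<epsilon>\<close> suffice.\<close>
    define \<eta> where "\<eta> = min \<epsilon> (1 / 2)"
    have \<eta>: "0 < \<eta>" "\<eta> < 1" "\<eta> \<le> \<epsilon>" using \<epsilon> by (auto simp: \<eta>_def)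
    have "0 < \<beta>" using \<beta> by simp
    from AE_lower_subpower_radius[OF nz this \<beta>(2) \<eta>(1,2)] AE_upper_subpower_radius[OF nz \<beta>(1) \<epsilon>]
    show "AE \<omega> in M. \<exists>n\<^sub>0::nat. \<forall>n\<ge>n\<^sub>0.
          (let \<xi> = real (max_local_time X
                 (lattice_ball (exp (ln (real n) powr \<beta>)) \<inter> lattice_line a\<^sub>1 a\<^sub>2) n \<omega>)
           in (1 - \<epsilon>) / (2 * pi) * ln (real n) powr (2 * \<beta>) \<le> \<xi> \<and>
              \<xi> \<le> ln (real n) powr (2 * \<beta> + \<epsilon>))"
    proof eventually_elim
      case (elim \<omega>)
      have "\<forall>\<^sub>F n in sequentially. (let \<xi> = real (max_local_time X
                 (lattice_ball (exp (ln (real n) powr \<beta>)) \<inter> lattice_line a\<^sub>1 a\<^sub>2) n \<omega>)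
           in (1 - \<epsilon>) / (2 * pi) * ln (real n) powr (2 * \<beta>) \<le> \<xi> \<and>
              \<xi> \<le> ln (real n) powr (2 * \<beta> + \<epsilon>))"
        using elim
      proof eventually_elim
        case (elim n)
        have "(1 - \<epsilon>) / (2 * pi) * ln (real n) powr (2 * \<beta>) \<le> (1 - \<eta>) / (2 * pi) * ln (real n) powr (2 * \<beta>)"
          using \<eta> by (intro mult_right_mono divide_right_mono) auto
        with elim show ?case unfolding Let_def by linarith
      qed
      then show ?case unfolding eventually_sequentially .
    qed
  }
qed

end
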